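(* For $i,j\in I$, $i\ne j$, let $N=1-a_{ij}$. There exists a split exact sequence of $\mathcal H^-(N\alpha_i+\alpha_j)$-modules $$0\to\Pi^{p(0;i,j)}P_{i^{(N)}j}\to\Pi^{p(1;i,j)}P_{i^{(N-1)}ji}\to\cdots\to\Pi^{p(k;i,j)}P_{i^{(N-k)}ji^{(k)}}\to\cdots\to\Pi^{p(N;i,j)}P_{ji^{(N)}}\to0 .$$ In particular, there is an isomorphism $$\bigoplus_{k=0}^{\lfloor\frac{N+1}{2}\rfloor}\Pi^{p(2k;i,j)}P_{i^{(N-2k)}ji^{(2k)}}\cong\bigoplus_{k=0}^{\lfloor\frac N2\rfloor}\Pi^{p(2k+1;i,j)}P_{i^{(N-2k-1)}ji^{(2k+1)}} .$$
   Context: **Root data.** $\mathbb K$ is a field, $\operatorname{char}\mathbb K\ne2$. $\widetilde\Gamma$ is a finite quiver without loops with vertex set $\widetilde I$, (multi)set of edges $\widetilde H$, source and target maps $\mathrm{src},\mathrm{tgt}:\widetilde H\to\widetilde I$, and $a$ is an automorphism of $\widetilde\Gamma$ commuting with $\mathrm{src},\mathrm{tgt}$ such that no edge joins two vertices in the same $a$-orbit. $I$ is a set of representatives of the $a$-orbits on $\widetilde I$, and $\alpha_i$ is the orbit of $i\in I$. Put $s_i=|\alpha_i|$, $(\alpha_i,\alpha_i)=2s_i$, $(\alpha_i,\alpha_j)=-\#\{\text{edges joining a vertex of }\alpha_i\text{ to a vertex of }\alpha_j\}$ for $i\neq j$, and $a_{ij}=(\alpha_i,\alpha_j)/s_i$.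 Assume $\gcd\{s_i\}=1$. Put $p(i)=0$ (and $i\in I_{\bar0}$, "even") if $s_i$ is even, $p(i)=1$ (and $i\in I_{\bar1}$, "odd") if $s_i$ is odd; so $I_{\bar 1}\ne\emptyset$. Assume $a_{ij}\in2\mathbb Z$ for all $i\in I_{\bar1}$, $j\in I$. Let $d_{ij}$ be the number of $a$-orbits on $\{h\in\widetilde H: \mathrm{src}(h)\in\alpha_i,\mathrm{tgt}(h)\in\alpha_j\}$ and $m(i,j)=\mathrm{lcm}\{(\alpha_i,\alpha_i),(\alpha_j,\alpha_j)\}$; one has $d_{ij}+d_{ji}=-2(\alpha_i,\alpha_j)/m(i,j)$ for $i\ne j$. $Q^+=\bigoplus_{i\in I}\mathbb Z_{\ge0}\alpha_i$. Set $\mathcal Q_{ii}(u,v)=0$ and, for $i\ne j$, $\mathcal Q_{ij}(u,v)=(-1)^{d_{ij}}\big(u^{m(i,j)/(\alpha_i,\alpha_i)}-v^{m(i,j)/(\alpha_j,\alpha_j)}\big)^{-2(\alpha_i,\alpha_j)/m(i,j)}$ in $\mathbb K\langle u,v\rangle/\langle uv-(-1)^{p(i)p(j)}vu\rangle$. **Spin quiver Hecke algebra.** For $\nu=\sum n_i\alpha_i\in Q^+$ of height $n=\sum n_i$ let $I^\nu=\{\underline i\in I^n:\alpha_{i_1}+\dots+\alpha_{i_n}=\nu\}$; $S_n$ acts by $w\cdot\underline i=(i_{w(1)},\dots,i_{w(n)})$, $s_r=(r,r+1)$. $\mathcal H^-(\nu)$ is the unital $\mathbb K$-algebra with generators $e(\underline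 i)$ ($\underline i\in I^\nu$), $y_1,\dots,y_n$, $\tau_1,\dots,\tau_{n-1}$ and relations: $e(\underline i)e(\underline j)=\delta_{\underline i,\underline j}e(\underline i)$; $\sum_{\underline i}e(\underline i)=1$; $y_re(\underline i)=e(\underline i)y_r$; $\tau_re(\underline i)=e(s_r\cdot\underline i)\tau_r$; $y_ry_se(\underline i)=(-1)^{p(i_r)p(i_s)}y_sy_re(\underline i)$ for $r\ne s$; $\tau_ry_se(\underline i)=(-1)^{p(i_r)p(i_{r+1})p(i_s)}y_s\tau_re(\underline i)$ for $s\ne r,r+1$; $\tau_r\tau_se(\underline i)=(-1)^{p(i_r)p(i_{r+1})p(i_s)p(i_{s+1})}\tau_s\tau_re(\underline i)$ for $|r-s|>1$; $\tau_ry_{r+1}e(\underline i)=\big((-1)^{p(i_r)p(i_{r+1})}y_r\tau_r+\delta_{i_r,i_{r+1}}\big)e(\underline i)$; $y_{r+1}\tau_re(\underline i)=\big((-1)^{p(i_r)p(i_{r+1})}\tau_ry_r+\delta_{i_r,i_{r+1}}\big)e(\underline i)$; $\tau_r^2e(\underline i)=\mathcal Q_{i_r,i_{r+1}}(y_r,y_{r+1})e(\underline i)$; and $(\tau_r\tau_{r+1}\tau_r-\tau_{r+1}\tau_r\tau_{r+1})e(\underline i)$ equals $\frac{\mathcal Q_{i_r,i_{r+1}}(y_{r+2},y_{r+1})-\mathcal Q_{i_r,i_{r+1}}(y_r,y_{r+1})}{y_{r+2}-y_r}e(\underline i)$ if $i_r=i_{r+2}\in I_{\bar0}$, equals $(-1)^{p(i_{r+1})}(y_{r+2}-y_r)\frac{\mathcal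 Q_{i_r,i_{r+1}}(y_{r+2},y_{r+1})-\mathcal Q_{i_r,i_{r+1}}(y_r,y_{r+1})}{y_{r+2}^2-y_r^2}e(\underline i)$ if $i_r=i_{r+2}\in I_{\bar1}$, and $0$ otherwise. It is $\mathbb Z\times\mathbb Z_2$-graded: $\deg e(\underline i)=0$, $\deg y_re(\underline i)=(\alpha_{i_r},\alpha_{i_r})$, $\deg\tau_re(\underline i)=-(\alpha_{i_r},\alpha_{i_{r+1}})$, with parities $0$, $p(i_r)$, $p(i_r)p(i_{r+1})$. **Modules.** Modules are finitely generated $\mathbb Z\times\mathbb Z_2$-graded left modules, and all morphisms preserve both the $\mathbb Z$- and the $\mathbb Z_2$-grading. $\Pi$ is the parity shift functor; $(M\{a\})[k]=M[k-a]$. **Notation.** $p(k;i,j)=kp(i)p(j)+\frac12k(k-1)p(i)$. In $\mathcal H^-(n\alpha_i)$ put $\bar\partial_r=-\tau_ry_r$ if $i$ is even and $\bar\partial_r=\tau_ry_r$ if $i$ is odd, and $\mathbf e_{i,n}=(\bar\partial_1\bar\partial_2\cdots\bar\partial_{n-1})(\bar\partial_1\cdots\bar\partial_{n-2})\cdots(\bar\partial_1)$ (an idempotent). The (super) tensor product $\mathcal H^-(b\alpha_i)\otimes\mathcal H^-(\alpha_j)\otimes\mathcal H^-(c\alpha_i)$ is embedded in $\mathcal H^-((b+c)\alpha_i+\alpha_j)$ by placing strands side by side, and $$P_{i^{(b)}ji^{(c)}}=\Pi^{p(i)\left(\binom b2+\binom c2\right)}\,\mathcal H^-((b+c)\alpha_i+\alpha_j)\,(\mathbf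 e_{i,b}\otimes e(j)\otimes\mathbf e_{i,c})\Big\{-s_i\Big(\tbinom b2+\tbinom c2\Big)\Big\}.$$ Exponents $0$ and $1$ are abbreviated in the usual way ($i^{(0)}$ omitted, $i^{(1)}=i$); a term with a negative exponent is zero. *)

theory Defs
  imports
    "HOL-Library.Poly_Mapping"
    "HOL-Library.Multiset"
    "HOL-Library.Z2"
    "HOL-Combinatorics.Orbits"
    "HOL-Computational_Algebra.Computational_Algebra"
    "HOL-Algebra.QuotRing"
    "HOL-Algebra.Module"
    "Graph_Theory.Digraph"
begin

section \<open>Root data\<close>

record ('v, 'e) quiver_datum =
  quiver :: "('v, 'e) pre_digraph"
  aut_verts :: "'v \<Rightarrow> 'v"
  aut_arcs :: "'e \<Rightarrow> 'e"
  reps :: "'v set"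

definition vorb :: "('v, 'e) quiver_datum \<Rightarrow> 'v \<Rightarrow> 'v set" where
  "vorb D i = orbit (aut_verts D) i"

definition orbsize :: "('v, 'e) quiver_datum \<Rightarrow> 'v \<Rightarrow> nat" where
  "orbsize D i = card (vorb D i)"

text \<open>The pairing \<open>(\<alpha>\<^sub>i, \<alpha>\<^sub>j)\<close>, for \<open>i\<close>, \<open>j\<close> in the set of representatives;
  edges are counted regardless of their orientation.\<close>

definition form :: "('v, 'e) quiver_datum \<Rightarrow> 'v \<Rightarrow> 'v \<Rightarrow> int" where
  "form D i j = (if i = j then 2 * int (orbsize D i)
     else - int (card {h \<in> arcs (quiver D).
        (tail (quiver D) h \<in> vorb D i \<and> head (quiver D) h \<in> vorb D j) \<or>
        (tail (quiver D) h \<in> vorb D j \<and> head (quiver D) h \<in> vorb D i)}))"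

text \<open>The division is exact: the automorphism permutes \<open>\<alpha>\<^sub>i\<close> transitively, so every vertex
  of \<open>\<alpha>\<^sub>i\<close> meets the same number of the edges counted by \<^term>\<open>form D i j\<close>.\<close>

definition cartan :: "('v, 'e) quiver_datum \<Rightarrow> 'v \<Rightarrow> 'v \<Rightarrow> int" where
  "cartan D i j = form D i j div int (orbsize D i)"

definition par :: "('v, 'e) quiver_datum \<Rightarrow> 'v \<Rightarrow> nat" where
  "par D i = (if even (orbsize D i) then 0 else 1)"

definition dnum :: "('v, 'e) quiver_datum \<Rightarrow> 'v \<Rightarrow> 'v \<Rightarrow> nat" where
  "dnum D i j = card (orbit (aut_arcs D) `
     {h \<in> arcs (quiver D). tail (quiver D) h \<in> vorb D i \<and> head (quiver D) h \<in> vorb D j})"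

definition mlcm :: "('v, 'e) quiver_datum \<Rightarrow> 'v \<Rightarrow> 'v \<Rightarrow> int" where
  "mlcm D i j = lcm (form D i i) (form D j j)"

locale spin_datum =
  fixes D :: "('v, 'e) quiver_datum"
  assumes fin_quiver: "fin_digraph (quiver D)"
    and loopfree_quiver: "loopfree_digraph (quiver D)"
    and bij_verts: "bij_betw (aut_verts D) (verts (quiver D)) (verts (quiver D))"
    and bij_arcs: "bij_betw (aut_arcs D) (arcs (quiver D)) (arcs (quiver D))"
    and aut_tail: "\<And>h. h \<in> arcs (quiver D) \<Longrightarrow>
          tail (quiver D) (aut_arcs D h) = aut_verts D (tail (quiver D) h)"
    and aut_head: "\<And>h. h \<in> arcs (quiver D) \<Longrightarrow>
          head (quiver D) (aut_arcs D h) = aut_verts D (head (quiver D) h)"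
    and no_edge_in_orbit: "\<And>h. h \<in> arcs (quiver D) \<Longrightarrow>
          head (quiver D) h \<notin> vorb D (tail (quiver D) h)"
    and reps_subset: "reps D \<subseteq> verts (quiver D)"
    and reps_unique: "\<And>v. v \<in> verts (quiver D) \<Longrightarrow> \<exists>!i. i \<in> reps D \<and> v \<in> vorb D i"
    and gcd_orbsize: "Gcd (orbsize D ` reps D) = 1"
    and odd_row: "\<And>i j. i \<in> reps D \<Longrightarrow> j \<in> reps D \<Longrightarrow> odd (orbsize D i) \<Longrightarrow> even (cartan D i j)"


section \<open>Free algebras\<close>

text \<open>Lists become the free monoid, written additively as \<^typ>\<open>('a, 'b) poly_mapping\<close> requires;
  \<^typ>\<open>'g list \<Rightarrow>\<^sub>0 'k\<close> is then its monoid algebra, that is, the algebra of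
  noncommutative polynomials in the letters \<^typ>\<open>'g\<close>.\<close>

instantiation list :: (type) monoid_add
begin

definition zero_list :: "'a list" where "zero_list = []"

definition plus_list :: "'a list \<Rightarrow> 'a list \<Rightarrow> 'a list" where "plus_list xs ys = xs @ ys"

instance by standard (simp_all add: zero_list_def plus_list_def)

end

type_synonym ('g, 'k) ncpoly = "'g list \<Rightarrow>\<^sub>0 'k"

definition letter :: "'g \<Rightarrow> ('g, 'k::field) ncpoly" where
  "letter g = Poly_Mapping.single [g] 1"

definition scalar :: "'k \<Rightarrow> ('g, 'k::field) ncpoly" where
  "scalar c = Poly_Mapping.single [] c"

definition free_alg :: "'g set \<Rightarrow> (('g, 'k::field) ncpoly) ring" where
  "free_alg A = \<lparr>carrier = {f. Poly_Mapping.keys f \<subseteq> lists A},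
     mult = (*), one = 1, zero = 0, add = (+)\<rparr>"


section \<open>The spin quiver Hecke algebra\<close>

text \<open>An element \<open>\<nu>\<close> of \<open>Q\<^sup>+\<close> is a finite multiset of elements of \<open>I\<close>, its height is the size.
  Strands are numbered from \<open>0\<close>, in accordance with list indexing: \<open>is ! r\<close>, \<open>Dot r\<close> and
  \<open>Cross r\<close> are \<open>i\<^sub>r\<^sub>+\<^sub>1\<close>, \<open>y\<^sub>r\<^sub>+\<^sub>1\<close> and \<open>\<tau>\<^sub>r\<^sub>+\<^sub>1\<close> in the usual numbering.\<close>

datatype 'v gen = Idemp "'v list" | Dot nat | Cross nat

definition seqs :: "'v multiset \<Rightarrow> 'v list set" where
  "seqs \<nu> = {is. mset is = \<nu>}"

definition swap_at :: "nat \<Rightarrow> 'v list \<Rightarrow> 'v list" where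
  "swap_at r is = is[r := is ! Suc r, Suc r := is ! r]"

definition gens :: "'v multiset \<Rightarrow> 'v gen set" where
  "gens \<nu> = Idemp ` seqs \<nu> \<union> Dot ` {r. r < size \<nu>} \<union> Cross ` {r. Suc r < size \<nu>}"

abbreviation ee :: "'v list \<Rightarrow> ('v gen, 'k::field) ncpoly" where
  "ee is \<equiv> letter (Idemp is)"

abbreviation yy :: "nat \<Rightarrow> ('v gen, 'k::field) ncpoly" where
  "yy r \<equiv> letter (Dot r)"

abbreviation tt :: "nat \<Rightarrow> ('v gen, 'k::field) ncpoly" where
  "tt r \<equiv> letter (Cross r)"

text \<open>\<open>\<Q>\<^sub>i\<^sub>j(u, v)\<close>, for elements \<open>u\<close>, \<open>v\<close> of an arbitrary ring. All three divisions are exact;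
  for the outer exponent this is because the size of an orbit of edges joining \<open>\<alpha>\<^sub>i\<close> and \<open>\<alpha>\<^sub>j\<close> is a
  multiple of \<open>lcm s\<^sub>i s\<^sub>j\<close>.\<close>

definition QQ :: "('v, 'e) quiver_datum \<Rightarrow> 'v \<Rightarrow> 'v \<Rightarrow> 'a::ring_1 \<Rightarrow> 'a \<Rightarrow> 'a" where
  "QQ D i j u v = (if i = j then 0
     else (- 1) ^ dnum D i j *
       (u ^ nat (mlcm D i j div form D i i) - v ^ nat (mlcm D i j div form D j j))
         ^ nat (- 2 * form D i j div mlcm D i j))"

text \<open>The skew polynomial ring generated by the dots on strands coloured by \<open>is\<close> is
  \<^term>\<open>free_alg (Dot ` {r. r < length is})\<close> modulo \<^term>\<open>skew_ideal D is\<close>. It is a domain,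
  so a quotient \<open>A / B\<close> of two of its elements, with \<open>B\<close> nonzero and central, is the unique \<open>F\<close> with
  \<open>B F = A\<close>. Elements are given by representatives in the free algebra, so \<open>F\<close> is determined
  modulo \<^term>\<open>skew_ideal D is\<close>. In the cases used below \<open>F\<close> exists: for odd \<open>i\<close> because the
  evenness of the entries \<open>a\<^sub>i\<^sub>j\<close> makes \<open>\<Q>\<^sub>i\<^sub>j(u, v)\<close> a polynomial in \<open>u\<^sup>2\<close> and \<open>v\<close>.\<close>

definition skew_ideal :: "('v, 'e) quiver_datum \<Rightarrow> 'v list \<Rightarrow> (('v gen, 'k::field) ncpoly) set" where
  "skew_ideal D is = Idl\<^bsub>free_alg (Dot ` {r. r < length is})\<^esub>
     {yy a * yy b - (- 1) ^ (par D (is ! a) * par D (is ! b)) * (yy b * yy a) |a b.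
        a < length is \<and> b < length is \<and> a \<noteq> b}"

definition skew_quotient ::
    "('v, 'e) quiver_datum \<Rightarrow> 'v list \<Rightarrow> ('v gen, 'k::field) ncpoly \<Rightarrow> ('v gen, 'k) ncpoly \<Rightarrow>
     ('v gen, 'k) ncpoly \<Rightarrow> bool" where
  "skew_quotient D is A B F \<longleftrightarrow>
     F \<in> carrier (free_alg (Dot ` {r. r < length is})) \<and> B * F - A \<in> skew_ideal D is"

text \<open>The difference of the two values of \<open>\<Q>\<close> in the numerator of the deformed braid relation.\<close>

definition QQ_diff :: "('v, 'e) quiver_datum \<Rightarrow> 'v list \<Rightarrow> nat \<Rightarrow> ('v gen, 'k::field) ncpoly" where
  "QQ_diff D is r = QQ D (is ! r) (is ! Suc r) (yy (r + 2)) (yy (Suc r))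
                  - QQ D (is ! r) (is ! Suc r) (yy r) (yy (Suc r))"

abbreviation braid_diff :: "nat \<Rightarrow> ('v gen, 'k::field) ncpoly" where
  "braid_diff r \<equiv> tt r * tt (Suc r) * tt r - tt (Suc r) * tt r * tt (Suc r)"

text \<open>The defining relations, each written as an element of the free algebra to be set to zero.\<close>

inductive_set klr_rels :: "('v, 'e) quiver_datum \<Rightarrow> 'v multiset \<Rightarrow> (('v gen, 'k::field) ncpoly) set"
  for D \<nu> where
  idem_idem: "is \<in> seqs \<nu> \<Longrightarrow> js \<in> seqs \<nu> \<Longrightarrow>
    ee is * ee js - (if is = js then ee is else 0) \<in> klr_rels D \<nu>"
| idem_sum: "(\<Sum>is\<in>seqs \<nu>. ee is) - 1 \<in> klr_rels D \<nu>"
| dot_idem: "is \<in> seqs \<nu> \<Longrightarrow> r < size \<nu> \<Longrightarrow> yy r * ee is - ee is * yy r \<in> klr_rels D \<nu>"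
| cross_idem: "is \<in> seqs \<nu> \<Longrightarrow> Suc r < size \<nu> \<Longrightarrow>
    tt r * ee is - ee (swap_at r is) * tt r \<in> klr_rels D \<nu>"
| dot_dot: "is \<in> seqs \<nu> \<Longrightarrow> r < size \<nu> \<Longrightarrow> s < size \<nu> \<Longrightarrow> r \<noteq> s \<Longrightarrow>
    yy r * yy s * ee is - (- 1) ^ (par D (is ! r) * par D (is ! s)) * (yy s * yy r * ee is)
      \<in> klr_rels D \<nu>"
| cross_dot_far: "is \<in> seqs \<nu> \<Longrightarrow> Suc r < size \<nu> \<Longrightarrow> s < size \<nu> \<Longrightarrow> s \<noteq> r \<Longrightarrow> s \<noteq> Suc r \<Longrightarrow>
    tt r * yy s * ee is
      - (- 1) ^ (par D (is ! r) * par D (is ! Suc r) * par D (is ! s)) * (yy s * tt r * ee is)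
      \<in> klr_rels D \<nu>"
| cross_cross_far: "is \<in> seqs \<nu> \<Longrightarrow> Suc r < size \<nu> \<Longrightarrow> Suc s < size \<nu> \<Longrightarrow>
    Suc r < s \<or> Suc s < r \<Longrightarrow>
    tt r * tt s * ee is
      - (- 1) ^ (par D (is ! r) * par D (is ! Suc r) * par D (is ! s) * par D (is ! Suc s))
          * (tt s * tt r * ee is)
      \<in> klr_rels D \<nu>"
| cross_dot: "is \<in> seqs \<nu> \<Longrightarrow> Suc r < size \<nu> \<Longrightarrow>
    tt r * yy (Suc r) * ee is
      - ((- 1) ^ (par D (is ! r) * par D (is ! Suc r)) * (yy r * tt r)
          + (if is ! r = is ! Suc r then 1 else 0)) * ee is
      \<in> klr_rels D \<nu>"
| dot_cross: "is \<in> seqs \<nu> \<Longrightarrow> Suc r < size \<nu> \<Longrightarrow>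
    yy (Suc r) * tt r * ee is
      - ((- 1) ^ (par D (is ! r) * par D (is ! Suc r)) * (tt r * yy r)
          + (if is ! r = is ! Suc r then 1 else 0)) * ee is
      \<in> klr_rels D \<nu>"
| cross_sq: "is \<in> seqs \<nu> \<Longrightarrow> Suc r < size \<nu> \<Longrightarrow>
    tt r * tt r * ee is - QQ D (is ! r) (is ! Suc r) (yy r) (yy (Suc r)) * ee is \<in> klr_rels D \<nu>"
| braid_even: "is \<in> seqs \<nu> \<Longrightarrow> r + 2 < size \<nu> \<Longrightarrow> is ! r = is ! (r + 2) \<Longrightarrow> par D (is ! r) = 0 \<Longrightarrow>
    skew_quotient D is (QQ_diff D is r) (yy (r + 2) - yy r) F \<Longrightarrow>
    braid_diff r * ee is - F * ee is \<in> klr_rels D \<nu>"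
| braid_odd: "is \<in> seqs \<nu> \<Longrightarrow> r + 2 < size \<nu> \<Longrightarrow> is ! r = is ! (r + 2) \<Longrightarrow> par D (is ! r) = 1 \<Longrightarrow>
    skew_quotient D is (QQ_diff D is r) (yy (r + 2) ^ 2 - yy r ^ 2) F \<Longrightarrow>
    braid_diff r * ee is
      - (- 1) ^ par D (is ! Suc r) * ((yy (r + 2) - yy r) * F * ee is) \<in> klr_rels D \<nu>"
| braid: "is \<in> seqs \<nu> \<Longrightarrow> r + 2 < size \<nu> \<Longrightarrow> is ! r \<noteq> is ! (r + 2) \<Longrightarrow>
    braid_diff r * ee is \<in> klr_rels D \<nu>"

definition klr_ideal :: "('v, 'e) quiver_datum \<Rightarrow> 'v multiset \<Rightarrow> (('v gen, 'k::field) ncpoly) set" where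
  "klr_ideal D \<nu> = Idl\<^bsub>free_alg (gens \<nu>)\<^esub> (klr_rels D \<nu>)"

definition klr :: "('v, 'e) quiver_datum \<Rightarrow> 'v multiset \<Rightarrow> (('v gen, 'k::field) ncpoly set) ring" where
  "klr D \<nu> = free_alg (gens \<nu>) Quot klr_ideal D \<nu>"

definition klr_class ::
    "('v, 'e) quiver_datum \<Rightarrow> 'v multiset \<Rightarrow> ('v gen, 'k::field) ncpoly \<Rightarrow> ('v gen, 'k) ncpoly set" where
  "klr_class D \<nu> x = klr_ideal D \<nu> +>\<^bsub>free_alg (gens \<nu>)\<^esub> x"

text \<open>\<open>klr_homog D \<nu> d \<epsilon> x\<close>: \<open>x\<close> lies in the component of \<open>\<H>\<^sup>-(\<nu>)\<close> of degree \<open>d\<close> and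
  parity \<open>\<epsilon>\<close>, that is, in the span of the products of homogeneous generators
  \<open>e(i)\<close>, \<open>y\<^sub>r e(i)\<close>, \<open>\<tau>\<^sub>r e(i)\<close> of total degree \<open>d\<close> and total parity \<open>\<epsilon>\<close>.\<close>

inductive klr_homog ::
    "('v, 'e) quiver_datum \<Rightarrow> 'v multiset \<Rightarrow> int \<Rightarrow> bit \<Rightarrow> ('v gen, 'k::field) ncpoly set \<Rightarrow> bool"
  for D \<nu> where
  zero: "klr_homog D \<nu> d \<epsilon> \<zero>\<^bsub>klr D \<nu>\<^esub>"
| add: "klr_homog D \<nu> d \<epsilon> x \<Longrightarrow> klr_homog D \<nu> d \<epsilon> y \<Longrightarrow> klr_homog D \<nu> d \<epsilon> (x \<oplus>\<^bsub>klr D \<nu>\<^esub> y)"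
| scale: "klr_homog D \<nu> d \<epsilon> x \<Longrightarrow> klr_homog D \<nu> d \<epsilon> (klr_class D \<nu> (scalar c) \<otimes>\<^bsub>klr D \<nu>\<^esub> x)"
| idem: "is \<in> seqs \<nu> \<Longrightarrow> klr_homog D \<nu> 0 0 (klr_class D \<nu> (ee is))"
| dot: "is \<in> seqs \<nu> \<Longrightarrow> r < size \<nu> \<Longrightarrow>
    klr_homog D \<nu> (form D (is ! r) (is ! r)) (of_nat (par D (is ! r)))
      (klr_class D \<nu> (yy r * ee is))"
| cross: "is \<in> seqs \<nu> \<Longrightarrow> Suc r < size \<nu> \<Longrightarrow>
    klr_homog D \<nu> (- form D (is ! r) (is ! Suc r)) (of_nat (par D (is ! r) * par D (is ! Suc r)))
      (klr_class D \<nu> (tt r * ee is))"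
| mult: "klr_homog D \<nu> d \<epsilon> x \<Longrightarrow> klr_homog D \<nu> d' \<epsilon>' y \<Longrightarrow>
    klr_homog D \<nu> (d + d') (\<epsilon> + \<epsilon>') (x \<otimes>\<^bsub>klr D \<nu>\<^esub> y)"


section \<open>Graded left modules\<close>

text \<open>The library's module record is reused for left modules over a noncommutative ring; its fields
  \<^const>\<open>mult\<close> and \<^const>\<open>one\<close> play no role.\<close>

record ('a, 'b) graded_module = "('a, 'b) module" +
  component :: "int \<Rightarrow> bit \<Rightarrow> 'b set"

definition graded_hom ::
    "('a, 'r) ring_scheme \<Rightarrow> ('a, 'b) graded_module \<Rightarrow> ('a, 'c) graded_module \<Rightarrow> ('b \<Rightarrow> 'c) set" where
  "graded_hom R M N = {f \<in> carrier M \<rightarrow> carrier N.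
     (\<forall>x\<in>carrier M. \<forall>y\<in>carrier M. f (x \<oplus>\<^bsub>M\<^esub> y) = f x \<oplus>\<^bsub>N\<^esub> f y) \<and>
     (\<forall>a\<in>carrier R. \<forall>x\<in>carrier M. f (a \<odot>\<^bsub>M\<^esub> x) = a \<odot>\<^bsub>N\<^esub> f x) \<and>
     (\<forall>d \<epsilon>. f ` component M d \<epsilon> \<subseteq> component N d \<epsilon>)}"

definition graded_iso ::
    "('a, 'r) ring_scheme \<Rightarrow> ('a, 'b) graded_module \<Rightarrow> ('a, 'c) graded_module \<Rightarrow> bool" where
  "graded_iso R M N \<longleftrightarrow> (\<exists>f\<in>graded_hom R M N. \<exists>g\<in>graded_hom R N M.
     (\<forall>x\<in>carrier M. g (f x) = x) \<and> (\<forall>y\<in>carrier N. f (g y) = y))"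

text \<open>The parity shift \<open>\<Pi>\<close> keeps the action. The variant in which an odd element \<open>a\<close> acts on
  \<open>\<Pi> M\<close> with an additional sign is naturally isomorphic to it, by the map sending a homogeneous
  \<open>m\<close> to \<open>(-1)\<^sup>|\<^sup>m\<^sup>| m\<close>.\<close>

definition parity_shift :: "('a, 'b) graded_module \<Rightarrow> ('a, 'b) graded_module" where
  "parity_shift M = M\<lparr>component := \<lambda>d \<epsilon>. component M d (\<epsilon> + 1)\<rparr>"

definition degree_shift :: "int \<Rightarrow> ('a, 'b) graded_module \<Rightarrow> ('a, 'b) graded_module" where
  "degree_shift a M = M\<lparr>component := \<lambda>d \<epsilon>. component M (d - a) \<epsilon>\<rparr>"

definition zero_gmodule :: "'b \<Rightarrow> ('a, 'b) graded_module" where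
  "zero_gmodule z = \<lparr>carrier = {z}, mult = \<lambda>_ _. z, one = z, zero = z, add = \<lambda>_ _. z,
     smult = \<lambda>_ _. z, component = \<lambda>_ _. {z}\<rparr>"

text \<open>Direct sums are only taken over finite index sets, where they are products.\<close>

definition gdirect_sum :: "'i set \<Rightarrow> ('i \<Rightarrow> ('a, 'b) graded_module) \<Rightarrow> ('a, 'i \<Rightarrow> 'b) graded_module" where
  "gdirect_sum K M = \<lparr>carrier = \<Pi>\<^sub>E k\<in>K. carrier (M k),
     mult = \<lambda>x y. \<lambda>k\<in>K. x k \<otimes>\<^bsub>M k\<^esub> y k, one = \<lambda>k\<in>K. \<one>\<^bsub>M k\<^esub>,
     zero = \<lambda>k\<in>K. \<zero>\<^bsub>M k\<^esub>, add = \<lambda>x y. \<lambda>k\<in>K. x k \<oplus>\<^bsub>M k\<^esub> y k,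
     smult = \<lambda>a x. \<lambda>k\<in>K. a \<odot>\<^bsub>M k\<^esub> x k,
     component = \<lambda>d \<epsilon>. \<Pi>\<^sub>E k\<in>K. component (M k) d \<epsilon>\<rparr>"

text \<open>Exactness of \<open>0 \<rightarrow> M 0 \<rightarrow> M 1 \<rightarrow> \<dots> \<rightarrow> M N \<rightarrow> 0\<close> with maps \<open>d k : M k \<rightarrow> M (k + 1)\<close>: the
  image of the incoming map equals the kernel of the outgoing map at every \<open>M k\<close>, including the
  two ends.\<close>

definition exact_seq ::
    "('a, 'r) ring_scheme \<Rightarrow> nat \<Rightarrow> (nat \<Rightarrow> ('a, 'b) graded_module) \<Rightarrow> (nat \<Rightarrow> 'b \<Rightarrow> 'b) \<Rightarrow> bool" where
  "exact_seq R N M d \<longleftrightarrow>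
     (\<forall>k<N. d k \<in> graded_hom R (M k) (M (Suc k))) \<and>
     (\<forall>k\<le>N. (if k = 0 then {\<zero>\<^bsub>M 0\<^esub>} else d (k - 1) ` carrier (M (k - 1)))
          = (if k < N then {x \<in> carrier (M k). d k x = \<zero>\<^bsub>M (Suc k)\<^esub>} else carrier (M N)))"

text \<open>A complex is split if there are morphisms \<open>s k : M (k + 1) \<rightarrow> M k\<close> with \<open>d s d = d\<close>;
  equivalently, all kernels and images are direct summands (as graded modules).\<close>

definition split_exact_seq ::
    "('a, 'r) ring_scheme \<Rightarrow> nat \<Rightarrow> (nat \<Rightarrow> ('a, 'b) graded_module) \<Rightarrow> (nat \<Rightarrow> 'b \<Rightarrow> 'b) \<Rightarrow> bool" where
  "split_exact_seq R N M d \<longleftrightarrow> exact_seq R N M d \<and>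
     (\<exists>s. (\<forall>k<N. s k \<in> graded_hom R (M (Suc k)) (M k)) \<and>
          (\<forall>k<N. \<forall>x\<in>carrier (M k). d k (s k (d k x)) = d k x))"


section \<open>The projective modules\<close>

definition klr_left_ideal ::
    "('v, 'e) quiver_datum \<Rightarrow> 'v multiset \<Rightarrow> ('v gen, 'k::field) ncpoly set \<Rightarrow>
     (('v gen, 'k) ncpoly set, ('v gen, 'k) ncpoly set) graded_module" where
  "klr_left_ideal D \<nu> x =
     (let P = {h \<otimes>\<^bsub>klr D \<nu>\<^esub> x |h. h \<in> carrier (klr D \<nu>)}
      in \<lparr>carrier = P, mult = mult (klr D \<nu>), one = \<one>\<^bsub>klr D \<nu>\<^esub>, zero = \<zero>\<^bsub>klr D \<nu>\<^esub>,
          add = add (klr D \<nu>), smult = mult (klr D \<nu>),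
          component = \<lambda>d \<epsilon>. {z \<in> P. klr_homog D \<nu> d \<epsilon> z}\<rparr>)"

definition dbar :: "('v, 'e) quiver_datum \<Rightarrow> 'v \<Rightarrow> nat \<Rightarrow> ('v gen, 'k::field) ncpoly" where
  "dbar D i r = (if par D i = 0 then - (tt r * yy r) else tt r * yy r)"

text \<open>The word for \<open>\<^bold>e\<^sub>i\<^sub>,\<^sub>n\<close>, placed on the \<open>n\<close> strands starting at \<open>l\<close>.\<close>

definition divpow :: "('v, 'e) quiver_datum \<Rightarrow> 'v \<Rightarrow> nat \<Rightarrow> nat \<Rightarrow> ('v gen, 'k::field) ncpoly" where
  "divpow D i l n =
     prod_list (map (\<lambda>m. prod_list (map (\<lambda>r. dbar D i (l + r)) [0..<m])) (rev [1..<n]))"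

text \<open>The image of \<open>\<^bold>e\<^sub>i\<^sub>,\<^sub>b \<otimes> e(j) \<otimes> \<^bold>e\<^sub>i\<^sub>,\<^sub>c\<close>; the unit of the tensor product is sent to
  \<open>e(i\<^sup>b j i\<^sup>c)\<close>.\<close>

definition serre_idem ::
    "('v, 'e) quiver_datum \<Rightarrow> 'v \<Rightarrow> 'v \<Rightarrow> nat \<Rightarrow> nat \<Rightarrow> ('v gen, 'k::field) ncpoly" where
  "serre_idem D i j b c =
     divpow D i 0 b * divpow D i (Suc b) c * ee (replicate b i @ [j] @ replicate c i)"

definition serre_weight :: "'v \<Rightarrow> 'v \<Rightarrow> nat \<Rightarrow> 'v multiset" where
  "serre_weight i j n = replicate_mset n i + {#j#}"

text \<open>\<open>P\<close> with divided powers \<open>i\<^sup>(\<^sup>b\<^sup>) j i\<^sup>(\<^sup>c\<^sup>)\<close>; it is zero if an exponent is negative.\<close>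

definition PP ::
    "('v, 'e) quiver_datum \<Rightarrow> 'v \<Rightarrow> 'v \<Rightarrow> int \<Rightarrow> int \<Rightarrow>
     (('v gen, 'k::field) ncpoly set, ('v gen, 'k) ncpoly set) graded_module" where
  "PP D i j b c =
     (let \<nu> = serre_weight i j (nat (b + c)); t = (nat b choose 2) + (nat c choose 2)
      in if b < 0 \<or> c < 0 then zero_gmodule \<zero>\<^bsub>klr D \<nu>\<^esub>
         else (parity_shift ^^ (par D i * t))
           (degree_shift (- int (orbsize D i * t))
             (klr_left_ideal D \<nu> (klr_class D \<nu> (serre_idem D i j (nat b) (nat c))))))"

definition pshift :: "('v, 'e) quiver_datum \<Rightarrow> nat \<Rightarrow> 'v \<Rightarrow> 'v \<Rightarrow> nat" where
  "pshift D k i j = k * par D i * par D j + (k * (k - 1) div 2) * par D i"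

end

theory Submission imports Defs begin

text \<open>Every morphism between the left ideals in question is right multiplication by an element of
  \<open>\<H>\<^sup>-(N\<alpha>\<^sub>i + \<alpha>\<^sub>j)\<close>, so the whole statement is a list of identities in that algebra, and no basis theorem
  is needed. Write \<open>e(b, c)\<close> for \<open>\<^bold>e\<^sub>i\<^sub>,\<^sub>b \<otimes> e(j) \<otimes> \<^bold>e\<^sub>i\<^sub>,\<^sub>c\<close>, where \<open>b + c = N\<close>. An element \<open>x\<close> with
  \<open>e(i\<^sup>b j i\<^sup>c) x = x\<close> satisfies \<open>e(b, c) x = x\<close> if it is annihilated on the left by all the crossings of
  two strands of colour \<open>i\<close>, and \<open>e(b, c)\<close> itself is annihilated by them. The differential
  is \<open>X = \<tau>\<^sub>1 \<dots> \<tau>\<^sub>b e(b - 1, c + 1)\<close>, and \<open>Z = \<tau>\<^sub>N \<dots> \<tau>\<^sub>b e(b, c)\<close> goes back. The braid relation shows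
  that the square of the differential vanishes, and its deformation shows that a signed sum of \<open>X Z\<close> and
  \<open>Z X\<close> equals \<open>\<tau>\<^sub>1 \<dots> \<tau>\<^sub>b\<^sub>-\<^sub>1 \<tau>\<^sub>N \<dots> \<tau>\<^sub>b\<^sub>+\<^sub>2 F e(b, c)\<close>, where \<open>F\<close> has degree \<open>N - 2\<close> in \<open>y\<^sub>b\<close> and \<open>y\<^sub>b\<^sub>+\<^sub>2\<close>. The
  crossings act as divided differences: they annihilate all the monomials of \<open>F\<close> but
  \<open>y\<^sub>b\<^sup>b\<^sup>-\<^sup>1 y\<^sub>b\<^sub>+\<^sub>2\<^sup>c\<^sup>-\<^sup>1\<close>, which they send to a sign. Hence the complex is contractible. None of the signs
  has to be computed, since they can be absorbed in \<open>Z\<close>.\<close>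

section \<open>Equality up to sign\<close>

text \<open>The value of N makes the degrees fit: \<Q> has degree N - 1 in the dot of colour i, so F
  has degree N - 2 = (b - 1) + (c - 1), exactly the number of crossings of equal strands that are
  left over. The obstacle is the signs. They depend on the colours of all the strands involved, and
  equality up to sign is not preserved by sums. Relations are therefore only applied to elements
  \<open>x\<close> with \<open>E p * x = x\<close>, which fixes the colours; calculations up to sign
  are confined to monomials; and the leading coefficient always comes from a single term. For odd i
  the quotient is a difference of two dots times a polynomial in squares, and the parity of c - 1
  decides which of the two products contains the surviving monomial. Numbering the strands from the
  other end preserves the relations, so only one kind of row of crossings has to be studied. The
  signs that occur at neighbouring terms of the complex are reconciled afterwards: multiplied by X
  on either side, the homotopy identities force them to agree on Z X.\<close>

definition eqs :: "'a::ring_1 \<Rightarrow> 'a \<Rightarrow> bool" (infix "=\<^sub>\<plusminus>" 50) where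
  "a =\<^sub>\<plusminus> b \<longleftrightarrow> a = b \<or> a = - b"

lemma eqs_refl [simp]: "a =\<^sub>\<plusminus> a"
  by (simp add: eqs_def)

lemma eqs_sym: "a =\<^sub>\<plusminus> b \<Longrightarrow> b =\<^sub>\<plusminus> a"
  by (auto simp: eqs_def)

lemma eqs_trans [trans]: "a =\<^sub>\<plusminus> b \<Longrightarrow> b =\<^sub>\<plusminus> c \<Longrightarrow> a =\<^sub>\<plusminus> c"
  by (auto simp: eqs_def)

lemma eqs_mult_left: "a =\<^sub>\<plusminus> b \<Longrightarrow> c * a =\<^sub>\<plusminus> c * b"
  by (auto simp: eqs_def)

lemma eqs_0 [simp]: "a =\<^sub>\<plusminus> 0 \<longleftrightarrow> a = 0" "0 =\<^sub>\<plusminus> a \<longleftrightarrow> a = 0"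
  by (auto simp: eqs_def)

lemma eqs_uminus [simp]: "- a =\<^sub>\<plusminus> b \<longleftrightarrow> a =\<^sub>\<plusminus> b" "a =\<^sub>\<plusminus> - b \<longleftrightarrow> a =\<^sub>\<plusminus> b"
  by (auto simp: eqs_def)

lemma eqs_sign_mult: "(- 1) ^ n * a =\<^sub>\<plusminus> a"
  by (cases "even n") (auto simp: eqs_def)

text \<open>Equality up to sign is not compatible with subtraction, so a difference of two terms
  needs its signs by name. It is applied to the two sides of the braid relation, whose difference is
  the surviving leading term.\<close>

lemma eqs_diff_cases:
  assumes "a - b =\<^sub>\<plusminus> x" "a =\<^sub>\<plusminus> a'" "b =\<^sub>\<plusminus> b'"
  shows "\<exists>\<alpha> \<beta>. (\<alpha> = 1 \<or> \<alpha> = - 1) \<and> (\<beta> = 1 \<or> \<beta> = - 1) \<and> x = \<alpha> * a' + \<beta> * b'"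
proof -
  obtain \<sigma> where s: "\<sigma> = 1 \<or> \<sigma> = - 1" "x = \<sigma> * (a - b)"
    using assms(1) unfolding eqs_def by (metis minus_equation_iff mult_1 mult_minus1)
  obtain \<sigma>1 where s1: "\<sigma>1 = 1 \<or> \<sigma>1 = - 1" "a = \<sigma>1 * a'"
    using assms(2) unfolding eqs_def by (metis mult_1 mult_minus1)
  obtain \<sigma>2 where s2: "\<sigma>2 = 1 \<or> \<sigma>2 = - 1" "b = \<sigma>2 * b'"
    using assms(3) unfolding eqs_def by (metis mult_1 mult_minus1)
  show ?thesis
    by (rule exI[of _ "\<sigma> * \<sigma>1"], rule exI[of _ "- \<sigma> * \<sigma>2"])
      (use s s1 s2 in \<open>auto simp: algebra_simps\<close>)
qed


section \<open>Strands of one colour with a single strand of another colour\<close>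

definition swp :: "nat \<Rightarrow> nat \<Rightarrow> nat" where
  "swp r p = (if p = r then Suc r else if p = Suc r then r else p)"

text \<open>Factors act from the right: the strand at position \<open>n\<close> crosses its
  predecessors one at a time until it is at position 0, and these move up by one.\<close>

primrec asc :: "(nat \<Rightarrow> 'a::ring_1) \<Rightarrow> nat \<Rightarrow> 'a" where
  "asc t 0 = 1"
| "asc t (Suc n) = asc t n * t n"

text \<open>\<open>E p\<close> is the idempotent with the strand of colour \<open>j\<close> at position \<open>p\<close>, all the other
  strands having colour \<open>i\<close>.\<close>

locale strands =
  fixes N :: nat and y t E :: "nat \<Rightarrow> 'a::ring_1" and k k' :: 'a
  assumes k: "k = 1 \<or> k = - 1" and k': "k' = 1 \<or> k' = - 1"
    and y_E: "p \<le> N \<Longrightarrow> r \<le> N \<Longrightarrow> E p * x = x \<Longrightarrow> E p * (y r * x) = y r * x"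
    and t_E: "p \<le> N \<Longrightarrow> r < N \<Longrightarrow> E p * x = x \<Longrightarrow> E (swp r p) * (t r * x) = t r * x"
    and y_y: "p \<le> N \<Longrightarrow> r \<le> N \<Longrightarrow> s \<le> N \<Longrightarrow> E p * x = x \<Longrightarrow> y r * (y s * x) =\<^sub>\<plusminus> y s * (y r * x)"
    and y_y_same: "p \<le> N \<Longrightarrow> r \<le> N \<Longrightarrow> s \<le> N \<Longrightarrow> r \<noteq> s \<Longrightarrow> r \<noteq> p \<Longrightarrow> s \<noteq> p \<Longrightarrow> E p * x = x \<Longrightarrow>
      y r * (y s * x) = k * (y s * (y r * x))"
    and t_y_far: "p \<le> N \<Longrightarrow> r < N \<Longrightarrow> s \<le> N \<Longrightarrow> s \<noteq> r \<Longrightarrow> s \<noteq> Suc r \<Longrightarrow> E p * x = x \<Longrightarrow>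
      t r * (y s * x) =\<^sub>\<plusminus> y s * (t r * x)"
    and t_t_far: "p \<le> N \<Longrightarrow> r < N \<Longrightarrow> s < N \<Longrightarrow> Suc r < s \<or> Suc s < r \<Longrightarrow> E p * x = x \<Longrightarrow>
      t r * (t s * x) =\<^sub>\<plusminus> t s * (t r * x)"
    and t_sq: "p \<le> N \<Longrightarrow> r < N \<Longrightarrow> p \<noteq> r \<Longrightarrow> p \<noteq> Suc r \<Longrightarrow> E p * x = x \<Longrightarrow> t r * (t r * x) = 0"
    and t_y_Suc: "p \<le> N \<Longrightarrow> r < N \<Longrightarrow> p \<noteq> r \<Longrightarrow> p \<noteq> Suc r \<Longrightarrow> E p * x = x \<Longrightarrow>
      t r * (y (Suc r) * x) = k * (y r * (t r * x)) + k' * x"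
    and t_y: "p \<le> N \<Longrightarrow> r < N \<Longrightarrow> p \<noteq> r \<Longrightarrow> p \<noteq> Suc r \<Longrightarrow> E p * x = x \<Longrightarrow>
      t r * (y r * x) = k * (y (Suc r) * (t r * x)) - k * k' * x"
    and braid: "p \<le> N \<Longrightarrow> Suc r < N \<Longrightarrow> p \<noteq> Suc r \<Longrightarrow> E p * x = x \<Longrightarrow>
      t r * (t (Suc r) * (t r * x)) = t (Suc r) * (t r * (t (Suc r) * x))"
begin

lemma swp_le: "p \<le> N \<Longrightarrow> r < N \<Longrightarrow> swp r p \<le> N"
  by (auto simp: swp_def)

text \<open>Numbering the strands from the other end interchanges \<open>t_y\<close> and
  \<open>t_y_Suc\<close>, which turns \<open>k'\<close> into \<open>- (k * k')\<close>. The
  parameter \<open>k'\<close> makes the locale closed under this symmetry.\<close>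

lemma reversed: "strands N (\<lambda>r. y (N - r)) (\<lambda>r. t (N - Suc r)) (\<lambda>p. E (N - p)) k (- (k * k'))"
proof
  show "k = 1 \<or> k = - 1" by (rule k)
  show "- (k * k') = 1 \<or> - (k * k') = - 1" using k k' by auto
next
  fix p r :: nat and x assume "p \<le> N" "r \<le> N" "E (N - p) * x = x"
  then show "E (N - p) * (y (N - r) * x) = y (N - r) * x" by (intro y_E) auto
next
  fix p r :: nat and x assume *: "p \<le> N" "r < N" "E (N - p) * x = x"
  have "N - swp r p = swp (N - Suc r) (N - p)" using * by (auto simp: swp_def)
  then show "E (N - swp r p) * (t (N - Suc r) * x) = t (N - Suc r) * x"
    using * by (simp add: t_E)
next
  fix p r s :: nat and x assume "p \<le> N" "r \<le> N" "s \<le> N" "E (N - p) * x = x"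
  then show "y (N - r) * (y (N - s) * x) =\<^sub>\<plusminus> y (N - s) * (y (N - r) * x)"
    by (intro y_y[of "N - p"]) auto
next
  fix p r s :: nat and x
  assume "p \<le> N" "r \<le> N" "s \<le> N" "r \<noteq> s" "r \<noteq> p" "s \<noteq> p" "E (N - p) * x = x"
  then show "y (N - r) * (y (N - s) * x) = k * (y (N - s) * (y (N - r) * x))"
    by (intro y_y_same[of "N - p"]) auto
next
  fix p r s :: nat and x
  assume "p \<le> N" "r < N" "s \<le> N" "s \<noteq> r" "s \<noteq> Suc r" "E (N - p) * x = x"
  then show "t (N - Suc r) * (y (N - s) * x) =\<^sub>\<plusminus> y (N - s) * (t (N - Suc r) * x)"
    by (intro t_y_far[of "N - p"]) auto
next
  fix p r s :: nat and x
  assume "p \<le> N" "r < N" "s < N" "Suc r < s \<or> Suc s < r" "E (N - p) * x = x"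
  then show "t (N - Suc r) * (t (N - Suc s) * x) =\<^sub>\<plusminus> t (N - Suc s) * (t (N - Suc r) * x)"
    by (intro t_t_far[of "N - p"]) auto
next
  fix p r :: nat and x
  assume "p \<le> N" "r < N" "p \<noteq> r" "p \<noteq> Suc r" "E (N - p) * x = x"
  then show "t (N - Suc r) * (t (N - Suc r) * x) = 0"
    by (intro t_sq[of "N - p"]) auto
next
  fix p r :: nat and x
  assume *: "p \<le> N" "r < N" "p \<noteq> r" "p \<noteq> Suc r" "E (N - p) * x = x"
  have "t (N - Suc r) * (y (N - Suc r) * x)
      = k * (y (Suc (N - Suc r)) * (t (N - Suc r) * x)) - k * k' * x"
    using * by (intro t_y[of "N - p"]) auto
  then show "t (N - Suc r) * (y (N - Suc r) * x)
      = k * (y (N - r) * (t (N - Suc r) * x)) + - (k * k') * x"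
    using * by (simp add: Suc_diff_Suc)
next
  fix p r :: nat and x
  assume *: "p \<le> N" "r < N" "p \<noteq> r" "p \<noteq> Suc r" "E (N - p) * x = x"
  have "t (N - Suc r) * (y (Suc (N - Suc r)) * x)
      = k * (y (N - Suc r) * (t (N - Suc r) * x)) + k' * x"
    using * by (intro t_y_Suc[of "N - p"]) auto
  moreover have "k * (- (k * k')) = - k'" using k by auto
  ultimately show "t (N - Suc r) * (y (N - r) * x)
      = k * (y (N - Suc r) * (t (N - Suc r) * x)) - k * - (k * k') * x"
    using * by (simp add: Suc_diff_Suc)
next
  fix p r :: nat and x
  assume *: "p \<le> N" "Suc r < N" "p \<noteq> Suc r" "E (N - p) * x = x"
  then have "Suc (N - Suc (Suc r)) = N - Suc r" by simp
  then show "t (N - Suc r) * (t (N - Suc (Suc r)) * (t (N - Suc r) * x))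
      = t (N - Suc (Suc r)) * (t (N - Suc r) * (t (N - Suc (Suc r)) * x))"
    using braid[of "N - p" "N - Suc (Suc r)" x] * by auto
qed

lemma y_pow_E: "p \<le> N \<Longrightarrow> r \<le> N \<Longrightarrow> E p * x = x \<Longrightarrow> E p * (y r ^ m * x) = y r ^ m * x"
  by (induction m) (auto simp: mult.assoc y_E)

lemma y_y_pow:
  assumes "p \<le> N" "r \<le> N" "s \<le> N" "E p * x = x"
  shows "y r * (y s ^ m * x) =\<^sub>\<plusminus> y s ^ m * (y r * x)"
proof (induction m)
  case (Suc m)
  have "y r * (y s ^ Suc m * x) = y r * (y s * (y s ^ m * x))" by (simp add: mult.assoc)
  also have "\<dots> =\<^sub>\<plusminus> y s * (y r * (y s ^ m * x))"
    using assms by (intro y_y[of p]) (auto simp: y_pow_E)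
  also have "\<dots> =\<^sub>\<plusminus> y s * (y s ^ m * (y r * x))"
    by (intro eqs_mult_left Suc)
  finally show ?case by (simp add: mult.assoc)
qed simp

lemma t_y_pow_far:
  assumes "p \<le> N" "r < N" "s \<le> N" "s \<noteq> r" "s \<noteq> Suc r" "E p * x = x"
  shows "t r * (y s ^ m * x) =\<^sub>\<plusminus> y s ^ m * (t r * x)"
proof (induction m)
  case (Suc m)
  have "t r * (y s ^ Suc m * x) = t r * (y s * (y s ^ m * x))" by (simp add: mult.assoc)
  also have "\<dots> =\<^sub>\<plusminus> y s * (t r * (y s ^ m * x))"
    using assms by (intro t_y_far[of p]) (auto simp: y_pow_E)
  also have "\<dots> =\<^sub>\<plusminus> y s * (y s ^ m * (t r * x))"
    by (intro eqs_mult_left Suc)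
  finally show ?case by (simp add: mult.assoc)
qed simp

section \<open>Passing dots and crossings through a row of crossings\<close>

lemma asc_E: "n < p \<or> n = 0 \<Longrightarrow> p \<le> N \<Longrightarrow> E p * x = x \<Longrightarrow> E p * (asc t n * x) = asc t n * x"
proof (induction n arbitrary: x)
  case (Suc n)
  have "E (swp n p) * (t n * x) = t n * x" using Suc.prems by (intro t_E) auto
  then have "E p * (t n * x) = t n * x" using Suc.prems by (simp add: swp_def)
  then show ?case using Suc by (simp add: mult.assoc)
qed simp

lemma t_asc_far:
  "p \<le> N \<Longrightarrow> s < N \<Longrightarrow> n < s \<Longrightarrow> E p * x = x \<Longrightarrow> t s * (asc t n * x) =\<^sub>\<plusminus> asc t n * (t s * x)"
proof (induction n arbitrary: x p)
  case (Suc n)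
  have "t s * (asc t (Suc n) * x) = t s * (asc t n * (t n * x))" by (simp add: mult.assoc)
  also have "\<dots> =\<^sub>\<plusminus> asc t n * (t s * (t n * x))"
    using Suc.prems by (intro Suc.IH[of "swp n p"] swp_le t_E) auto
  also have "\<dots> =\<^sub>\<plusminus> asc t n * (t n * (t s * x))"
    using Suc.prems by (intro eqs_mult_left t_t_far[of p]) auto
  finally show ?case by (simp add: mult.assoc)
qed simp

lemma y_asc_far:
  "p \<le> N \<Longrightarrow> s \<le> N \<Longrightarrow> n < s \<Longrightarrow> E p * x = x \<Longrightarrow> y s * (asc t n * x) =\<^sub>\<plusminus> asc t n * (y s * x)"
proof (induction n arbitrary: x p)
  case (Suc n)
  have "y s * (asc t (Suc n) * x) = y s * (asc t n * (t n * x))" by (simp add: mult.assoc)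
  also have "\<dots> =\<^sub>\<plusminus> asc t n * (y s * (t n * x))"
    using Suc.prems by (intro Suc.IH[of "swp n p"] swp_le t_E) auto
  also have "\<dots> =\<^sub>\<plusminus> asc t n * (t n * (y s * x))"
    using Suc.prems by (intro eqs_mult_left eqs_sym[OF t_y_far[of p]]) auto
  finally show ?case by (simp add: mult.assoc)
qed simp

lemma y_pow_asc_far:
  assumes "p \<le> N" "s \<le> N" "n < s" "n < p" "E p * x = x"
  shows "y s ^ m * (asc t n * x) =\<^sub>\<plusminus> asc t n * (y s ^ m * x)"
proof (induction m)
  case (Suc m)
  have "y s ^ Suc m * (asc t n * x) = y s * (y s ^ m * (asc t n * x))" by (simp add: mult.assoc)
  also have "\<dots> =\<^sub>\<plusminus> y s * (asc t n * (y s ^ m * x))"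
    by (intro eqs_mult_left Suc)
  also have "\<dots> =\<^sub>\<plusminus> asc t n * (y s * (y s ^ m * x))"
    using assms by (intro y_asc_far[of p] y_pow_E) auto
  finally show ?case by (simp add: mult.assoc)
qed simp

text \<open>The moving strand passes both strands of the crossing, which comes out one position
  higher on the left. At \<open>n = Suc r\<close> this is the braid relation, the rest is far
  commutation. The strand at position \<open>Suc r\<close> must have colour i, since otherwise the
  braid relation is deformed.\<close>

lemma t_asc_shift:
  "p \<le> N \<Longrightarrow> n \<le> N \<Longrightarrow> Suc r < n \<Longrightarrow> p \<noteq> Suc r \<Longrightarrow> E p * x = x \<Longrightarrow>
    t (Suc r) * (asc t n * x) =\<^sub>\<plusminus> asc t n * (t r * x)"
proof (induction n arbitrary: x p)
  case (Suc n)
  show ?case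
  proof (cases "n = Suc r")
    case True
    have E2: "E (swp r (swp (Suc r) p)) * (t r * (t (Suc r) * x)) = t r * (t (Suc r) * x)"
      using Suc.prems by (intro t_E swp_le) auto
    have "t (Suc r) * (asc t (Suc n) * x) = t (Suc r) * (asc t r * (t r * (t (Suc r) * x)))"
      by (simp add: True mult.assoc)
    also have "\<dots> =\<^sub>\<plusminus> asc t r * (t (Suc r) * (t r * (t (Suc r) * x)))"
      using Suc.prems E2 by (intro t_asc_far[of "swp r (swp (Suc r) p)"] swp_le) auto
    also have "t (Suc r) * (t r * (t (Suc r) * x)) = t r * (t (Suc r) * (t r * x))"
      using Suc.prems by (intro braid[symmetric, of p]) auto
    finally show ?thesis by (simp add: True mult.assoc)
  next
    case False
    have "t (Suc r) * (asc t (Suc n) * x) = t (Suc r) * (asc t n * (t n * x))"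
      by (simp add: mult.assoc)
    also have "\<dots> =\<^sub>\<plusminus> asc t n * (t r * (t n * x))"
      using Suc.prems False by (intro Suc.IH[of "swp n p"] swp_le t_E) (auto simp: swp_def)
    also have "\<dots> =\<^sub>\<plusminus> asc t n * (t n * (t r * x))"
      using Suc.prems False by (intro eqs_mult_left t_t_far[of p]) auto
    finally show ?thesis by (simp add: mult.assoc)
  qed
qed simp

lemma t_0_asc:
  "p \<le> N \<Longrightarrow> Suc n < p \<Longrightarrow> E p * x = x \<Longrightarrow> t 0 * (asc t (Suc n) * x) = 0"
proof (induction n arbitrary: x)
  case 0
  then show ?case using t_sq[of p 0 x] by simp
next
  case (Suc n)
  have "E (swp (Suc n) p) * (t (Suc n) * x) = t (Suc n) * x"
    using Suc.prems by (intro t_E) auto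
  then have "E p * (t (Suc n) * x) = t (Suc n) * x" using Suc.prems by (simp add: swp_def)
  then have "t 0 * (asc t (Suc n) * (t (Suc n) * x)) = 0" using Suc by simp
  then show ?case by (simp add: mult.assoc)
qed

section \<open>Elements annihilated by the crossings of equal strands\<close>

definition killed :: "nat \<Rightarrow> 'a \<Rightarrow> bool" where
  "killed p x \<longleftrightarrow> E p * x = x \<and> (\<forall>r<N. r \<noteq> p \<longrightarrow> Suc r \<noteq> p \<longrightarrow> t r * x = 0)"

lemma killed_E: "killed p x \<Longrightarrow> E p * x = x"
  by (simp add: killed_def)

lemma killedD: "killed p x \<Longrightarrow> r < N \<Longrightarrow> r \<noteq> p \<Longrightarrow> Suc r \<noteq> p \<Longrightarrow> t r * x = 0"
  by (simp add: killed_def)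

text \<open>A crossing beyond the row passes it, one strictly inside reaches \<open>x\<close> with
  its index lowered by one, and \<open>t 0\<close> meets the leftmost factor, where
  \<open>t 0 * t 0\<close> vanishes. Hence the rows are fixed by the idempotent on their left, which
  need not be inserted in the differential.\<close>

lemma killed_asc:
  assumes q: "q < N" and x: "killed q x"
  shows "killed (Suc q) (asc t (Suc q) * x)"
  unfolding killed_def
proof (intro conjI allI impI)
  have "E (swp q q) * (t q * x) = t q * x" using q killed_E[OF x] by (intro t_E) auto
  then have tq: "E (Suc q) * (t q * x) = t q * x" by (simp add: swp_def)
  show "E (Suc q) * (asc t (Suc q) * x) = asc t (Suc q) * x"
    using asc_E[of q "Suc q" "t q * x"] q tq by (simp add: mult.assoc)
  fix r assume r: "r < N" "r \<noteq> Suc q" "Suc r \<noteq> Suc q"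
  have "r > Suc q \<or> r = 0 \<and> q > 0 \<or> r \<noteq> 0 \<and> r < q" using r by linarith
  then consider "r > Suc q" | "r = 0" "q > 0" | r' where "r = Suc r'" "Suc r' < q"
    by (metis not0_implies_Suc)
  then show "t r * (asc t (Suc q) * x) = 0"
  proof cases
    case 1
    then have "t r * (asc t (Suc q) * x) =\<^sub>\<plusminus> asc t (Suc q) * (t r * x)"
      using r q killed_E[OF x] by (intro t_asc_far[of q]) auto
    moreover have "t r * x = 0" using 1 r by (intro killedD[OF x]) auto
    ultimately show ?thesis by simp
  next
    case 2
    then obtain n where "q = Suc n" by (cases q) auto
    then show ?thesis using t_0_asc[of "Suc q" n "t q * x"] q tq 2 by (simp add: mult.assoc)
  next
    case 3
    then have "t r * (asc t (Suc q) * x) =\<^sub>\<plusminus> asc t (Suc q) * (t r' * x)"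
      unfolding 3(1) using 3 q killed_E[OF x] by (intro t_asc_shift[of q]) (simp_all del: asc.simps)
    moreover have "t r' * x = 0" using 3 r by (intro killedD[OF x]) auto
    ultimately show ?thesis by simp
  qed
qed

text \<open>The strands at positions \<open>m\<close> and \<open>Suc m\<close> both travel to the
  front and cross each other there. Braid relations carry this crossing to the right end, where it
  is \<open>t m\<close>; only divisibility by it matters, not the cofactor \<open>w\<close>.\<close>

lemma asc_asc:
  "p \<le> N \<Longrightarrow> m < N \<Longrightarrow> p \<noteq> m \<or> m = 0 \<Longrightarrow> E p * x = x \<Longrightarrow>
    \<exists>w. asc t (Suc m) * (asc t m * x) = w * (t m * x)"
proof (induction m arbitrary: x p)
  case 0
  show ?case by (auto intro: exI[of _ 1])
next
  case (Suc m)
  let ?z = "t (Suc m) * (t m * x)" and ?p = "swp (Suc m) (swp m p)"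
  have p: "swp m p \<le> N" using Suc.prems by (intro swp_le) auto
  have Ez: "E (swp m p) * (t m * x) = t m * x" using Suc.prems by (intro t_E) auto
  obtain w where w: "asc t (Suc m) * (asc t m * ?z) = w * (t m * ?z)"
  proof -
    have "?p \<noteq> m" using Suc.prems by (auto simp: swp_def)
    moreover have "E ?p * ?z = ?z" using Suc.prems Ez p by (intro t_E) auto
    ultimately show ?thesis using Suc.IH[of ?p ?z] Suc.prems p that by (auto intro!: swp_le)
  qed
  have "asc t (Suc (Suc m)) * (asc t (Suc m) * x)
      = asc t (Suc m) * (t (Suc m) * (asc t m * (t m * x)))" by (simp add: mult.assoc)
  also have "\<dots> =\<^sub>\<plusminus> asc t (Suc m) * (asc t m * ?z)"
    using Suc.prems Ez p by (intro eqs_mult_left t_asc_far[of "swp m p"]) auto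
  also have "\<dots> = w * (t m * ?z)" by (rule w)
  also have "t m * ?z = t (Suc m) * (t m * (t (Suc m) * x))"
    using Suc.prems by (intro braid[of p]) auto
  finally have "asc t (Suc (Suc m)) * (asc t (Suc m) * x) =\<^sub>\<plusminus>
      (w * (t (Suc m) * t m)) * (t (Suc m) * x)"
    by (simp add: mult.assoc)
  then show ?case unfolding eqs_def by (metis mult_minus_left)
qed

text \<open>With the strand j at position \<open>q\<close>, the crossing \<open>t (Suc q)\<close>
  that \<open>asc_asc\<close> extracts joins two strands of colour i.\<close>

lemma asc_asc_killed:
  assumes "Suc q < N" "killed q x"
  shows "asc t (Suc (Suc q)) * (asc t (Suc q) * x) = 0"
proof -
  obtain w where "asc t (Suc (Suc q)) * (asc t (Suc q) * x) = w * (t (Suc q) * x)"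
    using asc_asc[of q "Suc q" x] assms by (auto simp: killed_def)
  moreover have "t (Suc q) * x = 0" using assms by (intro killedD[of q]) auto
  ultimately show ?thesis by simp
qed

text \<open>Each crossing lowers the degree in the dots by one, so \<open>n\<close> crossings kill
  \<open>y n ^ m\<close> for \<open>m < n\<close> and leave a constant for \<open>m = n\<close>.
  Moving one dot through \<open>t n\<close> gives \<open>y n\<close> times the crossing plus a term
  without crossing, so the induction has to treat mixed monomials in \<open>y n\<close> and
  \<open>y (Suc n)\<close>.\<close>

lemma asc_y_pow:
  assumes "p \<le> N" "n < p" "E p * z = z" "\<And>r. r < n \<Longrightarrow> t r * z = 0"
  shows "(m < n \<longrightarrow> asc t n * (y n ^ m * z) = 0) \<and> asc t n * (y n ^ n * z) =\<^sub>\<plusminus> z"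
  using assms(2-)
proof (induction n arbitrary: m z)
  case 0
  then show ?case by simp
next
  case (Suc n)
  let ?D = "\<lambda>m. t n * (y (Suc n) ^ m * z)"
  have tz: "t n * z = 0" using Suc.prems by auto
  have E': "E p * (y (Suc n) ^ m * z) = y (Suc n) ^ m * z" for m
    using assms(1) Suc.prems by (intro y_pow_E) auto
  have D_Suc: "?D (Suc m) = k * (y n * ?D m) + k' * (y (Suc n) ^ m * z)" for m
    using t_y_Suc[of p n "y (Suc n) ^ m * z"] assms(1) Suc.prems E' by (simp add: mult.assoc)
  have IH: "(a < n \<longrightarrow> asc t n * (y n ^ a * (y (Suc n) ^ m * z)) = 0)
     \<and> asc t n * (y n ^ n * (y (Suc n) ^ m * z)) =\<^sub>\<plusminus> y (Suc n) ^ m * z" for a m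
  proof (rule Suc.IH)
    fix r assume r: "r < n"
    have "t r * (y (Suc n) ^ m * z) =\<^sub>\<plusminus> y (Suc n) ^ m * (t r * z)"
      using assms(1) Suc.prems r by (intro t_y_pow_far[of p]) auto
    then show "t r * (y (Suc n) ^ m * z) = 0" using Suc.prems(3) r by simp
  qed (use Suc.prems E' in auto)
  have kc: "a * (k * b) = k * (a * b)" "a * (k' * b) = k' * (a * b)" for a b
    using k k' by auto
  have step: "asc t n * (y n ^ a * ?D (Suc m))
      = k * (asc t n * (y n ^ Suc a * ?D m)) + k' * (asc t n * (y n ^ a * (y (Suc n) ^ m * z)))"
    for a m
    unfolding D_Suc by (simp add: distrib_left kc power_Suc2 mult.assoc del: power_Suc)
  have z1: "asc t n * (y n ^ a * ?D m) = 0" if "a + m \<le> n" for a m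
    using that
  proof (induction m arbitrary: a)
    case 0
    then show ?case by (simp add: tz)
  next
    case (Suc m)
    then show ?case unfolding step using IH[of a m] by (simp del: power_Suc)
  qed
  \<comment> \<open>In the recursion the terms without crossing that have \<open>a < n\<close>
    vanish by the induction hypothesis; only the one with \<open>a = n\<close> remains, so no two
    terms of unknown sign are added.\<close>
  have z2: "asc t n * (y n ^ a * ?D (Suc m)) =\<^sub>\<plusminus> z" if "a + m = n" for a m
    using that
  proof (induction m arbitrary: a)
    case 0
    have "asc t n * (y n ^ a * ?D (Suc 0)) = k' * (asc t n * (y n ^ a * z))"
      unfolding step by (simp add: tz)
    then show ?case using k' 0 IH[of a 0] by auto
  next
    case (Suc m)
    have "asc t n * (y n ^ a * ?D (Suc (Suc m))) = k * (asc t n * (y n ^ Suc a * ?D (Suc m)))"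
      unfolding step[of _ "Suc m"] using IH[of a "Suc m"] Suc.prems by (simp del: power_Suc)
    then show ?case using k Suc.IH[of "Suc a"] Suc.prems by (auto simp del: power_Suc)
  qed
  have "asc t (Suc n) * (y (Suc n) ^ m * z) = asc t n * (y n ^ 0 * ?D m)" for m
    by (simp add: mult.assoc)
  note * = this
  show ?case unfolding * using z1[of 0 m] z2[of 0 n] by simp
qed

section \<open>The divided power idempotents and the elements they fix\<close>

definition db :: "nat \<Rightarrow> 'a" where
  "db r = - (k * k') * (t r * y r)"

primrec Db :: "nat \<Rightarrow> nat \<Rightarrow> 'a" where
  "Db l 0 = 1"
| "Db l (Suc n) = Db l n * db (l + n)"

text \<open>The divided power idempotent on the \<open>n\<close> strands starting at
  \<open>l\<close>; its longest factor stands on the left.\<close>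

primrec Dv :: "nat \<Rightarrow> nat \<Rightarrow> 'a" where
  "Dv l 0 = 1"
| "Dv l (Suc n) = Db l n * Dv l n"

lemma db_eqs: "db r * x =\<^sub>\<plusminus> t r * (y r * x)"
  using k k' by (auto simp: db_def mult.assoc)

text \<open>The sign in \<open>db\<close> is chosen for this: by \<open>t_y\<close> the product
  \<open>t r * y r\<close> acts on an element killed by \<open>t r\<close> as
  \<open>- (k * k')\<close>. For \<open>k' = 1\<close> this is the sign that distinguishes the two
  cases of \<open>dbar\<close>.\<close>

lemma db_fix:
  assumes "p \<le> N" "r < N" "p \<noteq> r" "p \<noteq> Suc r" "E p * x = x" "t r * x = 0"
  shows "db r * x = x"
  using t_y[OF assms(1-5)] assms(6) k k' by (auto simp: db_def mult.assoc)

lemma db_E: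
  assumes "p \<le> N" "r < N" "p \<noteq> r" "p \<noteq> Suc r" "E p * x = x"
  shows "E p * (db r * x) = db r * x"
proof -
  have "E (swp r p) * (t r * (y r * x)) = t r * (y r * x)"
    using assms by (intro t_E y_E) auto
  then have "E p * (t r * (y r * x)) = t r * (y r * x)"
    using assms by (simp add: swp_def)
  then show ?thesis using k k' by (auto simp: db_def mult.assoc)
qed

lemma t_db_far:
  assumes "p \<le> N" "r < N" "s < N" "Suc r < s \<or> Suc s < r" "E p * x = x"
  shows "t s * (db r * x) =\<^sub>\<plusminus> db r * (t s * x)"
proof -
  have "t s * (db r * x) =\<^sub>\<plusminus> t s * (t r * (y r * x))"
    by (intro eqs_mult_left db_eqs)
  also have "\<dots> =\<^sub>\<plusminus> t r * (t s * (y r * x))"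
    using assms by (intro t_t_far[of p] y_E) auto
  also have "\<dots> =\<^sub>\<plusminus> t r * (y r * (t s * x))"
    using assms by (intro eqs_mult_left t_y_far[of p]) auto
  also have "\<dots> =\<^sub>\<plusminus> db r * (t s * x)"
    by (intro eqs_sym[OF db_eqs])
  finally show ?thesis .
qed

text \<open>The product \<open>y\<^sub>r y\<^sub>r\<^sub>+\<^sub>1\<close> commutes with \<open>t\<^sub>r\<close> up to sign, so the shift of \<open>t\<close>'s along a braid
  extends to \<open>db\<close>'s.\<close>

lemma t_db_shift:
  assumes "p \<le> N" "Suc r < N" "p \<noteq> r" "p \<noteq> Suc r" "p \<noteq> Suc (Suc r)" "E p * x = x"
  shows "t (Suc r) * (db r * (db (Suc r) * x)) =\<^sub>\<plusminus> db r * (db (Suc r) * (t r * x))"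
proof -
  have move: "db r * (db (Suc r) * z) =\<^sub>\<plusminus> t r * (t (Suc r) * (y r * (y (Suc r) * z)))"
    if "E p * z = z" for z
  proof -
    have "db r * (db (Suc r) * z) =\<^sub>\<plusminus> db r * (t (Suc r) * (y (Suc r) * z))"
      by (intro eqs_mult_left db_eqs)
    also have "\<dots> =\<^sub>\<plusminus> t r * (y r * (t (Suc r) * (y (Suc r) * z)))"
      by (rule db_eqs)
    also have "\<dots> =\<^sub>\<plusminus> t r * (t (Suc r) * (y r * (y (Suc r) * z)))"
      using assms that by (intro eqs_mult_left eqs_sym[OF t_y_far[of p]] y_E) auto
    finally show ?thesis .
  qed
  have Et: "E p * (t r * x) = t r * x"
    using t_E[of p r x] assms by (simp add: swp_def)
  have "t r * (y r * (y (Suc r) * x))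
      = k * (y (Suc r) * (t r * (y (Suc r) * x))) - k * k' * (y (Suc r) * x)"
    using assms by (intro t_y[of p] y_E) auto
  also have "t r * (y (Suc r) * x) = k * (y r * (t r * x)) + k' * x"
    using assms by (intro t_y_Suc[of p]) auto
  also have "k * (y (Suc r) * (k * (y r * (t r * x)) + k' * x)) - k * k' * (y (Suc r) * x)
      = y (Suc r) * (y r * (t r * x))"
    using k k' by (auto simp: algebra_simps)
  finally have "t r * (y r * (y (Suc r) * x)) = y (Suc r) * (y r * (t r * x))" .
  moreover have "\<dots> =\<^sub>\<plusminus> y r * (y (Suc r) * (t r * x))"
    using assms Et by (intro y_y[of p]) auto
  ultimately have sym: "t r * (y r * (y (Suc r) * x)) =\<^sub>\<plusminus> y r * (y (Suc r) * (t r * x))" by simp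
  have "t (Suc r) * (db r * (db (Suc r) * x))
      =\<^sub>\<plusminus> t (Suc r) * (t r * (t (Suc r) * (y r * (y (Suc r) * x))))"
    using assms by (intro eqs_mult_left move)
  also have "\<dots> = t r * (t (Suc r) * (t r * (y r * (y (Suc r) * x))))"
    using assms by (intro braid[symmetric, of p] y_E) auto
  also have "\<dots> =\<^sub>\<plusminus> t r * (t (Suc r) * (y r * (y (Suc r) * (t r * x))))"
    by (intro eqs_mult_left sym)
  also have "\<dots> =\<^sub>\<plusminus> db r * (db (Suc r) * (t r * x))"
    by (intro eqs_sym[OF move] Et)
  finally show ?thesis .
qed

lemma Db_E:
  "p \<le> N \<Longrightarrow> l + n \<le> N \<Longrightarrow> p < l \<or> l + n < p \<or> n = 0 \<Longrightarrow> E p * x = x \<Longrightarrow>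
    E p * (Db l n * x) = Db l n * x"
proof (induction n arbitrary: x)
  case (Suc n)
  then have "E p * (db (l + n) * x) = db (l + n) * x" by (intro db_E) auto
  then have "E p * (Db l n * (db (l + n) * x)) = Db l n * (db (l + n) * x)"
    using Suc.prems by (intro Suc.IH) auto
  then show ?case by (simp add: mult.assoc)
qed simp

lemma t_Db_far:
  "p \<le> N \<Longrightarrow> l + n \<le> N \<Longrightarrow> p < l \<or> l + n < p \<or> n = 0 \<Longrightarrow> s < N \<Longrightarrow> Suc s < l \<or> l + n < s \<or> n = 0 \<Longrightarrow>
    E p * x = x \<Longrightarrow> t s * (Db l n * x) =\<^sub>\<plusminus> Db l n * (t s * x)"
proof (induction n arbitrary: x)
  case (Suc n)
  have "t s * (Db l (Suc n) * x) = t s * (Db l n * (db (l + n) * x))" by (simp add: mult.assoc)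
  also have "\<dots> =\<^sub>\<plusminus> Db l n * (t s * (db (l + n) * x))"
    using Suc.prems by (intro Suc.IH db_E) auto
  also have "\<dots> =\<^sub>\<plusminus> Db l n * (db (l + n) * (t s * x))"
    using Suc.prems by (intro eqs_mult_left t_db_far[of p]) auto
  finally show ?case by (simp add: mult.assoc)
qed simp

lemma t_Db_shift:
  "p \<le> N \<Longrightarrow> l + n \<le> N \<Longrightarrow> p < l \<or> l + n < p \<Longrightarrow> l \<le> r \<Longrightarrow> Suc r < l + n \<Longrightarrow>
    E p * x = x \<Longrightarrow> t (Suc r) * (Db l n * x) =\<^sub>\<plusminus> Db l n * (t r * x)"
proof (induction n arbitrary: x)
  case (Suc n)
  show ?case
  proof (cases "l + n = Suc r")
    case True
    then obtain n' where n': "n = Suc n'" "r = l + n'" using Suc.prems by (cases n) auto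
    have E2: "E p * (db r * (db (Suc r) * x)) = db r * (db (Suc r) * x)"
      using Suc.prems True by (intro db_E) auto
    have "t (Suc r) * (Db l (Suc n) * x) = t (Suc r) * (Db l n' * (db r * (db (Suc r) * x)))"
      using n' True by (simp add: mult.assoc)
    also have "\<dots> =\<^sub>\<plusminus> Db l n' * (t (Suc r) * (db r * (db (Suc r) * x)))"
      using Suc.prems n' E2 by (intro t_Db_far[of p]) auto
    also have "\<dots> =\<^sub>\<plusminus> Db l n' * (db r * (db (Suc r) * (t r * x)))"
      using Suc.prems True by (intro eqs_mult_left t_db_shift[of p]) auto
    finally show ?thesis using n' True by (simp add: mult.assoc)
  next
    case False
    have "t (Suc r) * (Db l (Suc n) * x) = t (Suc r) * (Db l n * (db (l + n) * x))"
      by (simp add: mult.assoc)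
    also have "\<dots> =\<^sub>\<plusminus> Db l n * (t r * (db (l + n) * x))"
      using Suc.prems False by (intro Suc.IH db_E) auto
    also have "\<dots> =\<^sub>\<plusminus> Db l n * (db (l + n) * (t r * x))"
      using Suc.prems False by (intro eqs_mult_left t_db_far[of p]) auto
    finally show ?thesis by (simp add: mult.assoc)
  qed
qed simp

lemma t_Db_first:
  "p \<le> N \<Longrightarrow> l + Suc n \<le> N \<Longrightarrow> p < l \<or> l + Suc n < p \<Longrightarrow> E p * x = x \<Longrightarrow>
    t l * (Db l (Suc n) * x) = 0"
proof (induction n arbitrary: x)
  case 0
  then have "t l * (t l * (y l * x)) = 0" by (intro t_sq[of p] y_E) auto
  then have "t l * (db l * x) = 0"
    using eqs_mult_left[OF db_eqs, of "t l" l x] by simp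
  then show ?case by simp
next
  case (Suc n)
  then have "t l * (Db l (Suc n) * (db (l + Suc n) * x)) = 0"
    by (intro Suc.IH db_E) auto
  then show ?case by (simp add: mult.assoc)
qed

text \<open>\<open>Db l n\<close> kills one crossing more than its argument does: crossings slide
  through with index lowered by one, and the additional \<open>t l\<close> meets its own square.
  Iteration gives \<open>t_Dv\<close>.\<close>

lemma t_Db:
  assumes "p \<le> N" "l + n \<le> N" "p < l \<or> l + n < p" "E p * x = x"
    and x: "\<And>r. l \<le> r \<Longrightarrow> Suc r < l + n \<Longrightarrow> t r * x = 0"
    and r: "l \<le> r" "r < l + n"
  shows "t r * (Db l n * x) = 0"
proof (cases "r = l")
  case True
  then obtain n' where "n = Suc n'" using r by (cases n) auto
  then show ?thesis using t_Db_first[of p l n' x] assms True by simp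
next
  case False
  then obtain r' where r': "r = Suc r'" "l \<le> r'" using r by (cases r) auto
  then have "t r * (Db l n * x) =\<^sub>\<plusminus> Db l n * (t r' * x)"
    unfolding r'(1) using assms r' by (intro t_Db_shift[of p]) auto
  then show ?thesis using x[of r'] r r' by simp
qed

lemma Dv_E:
  "p \<le> N \<Longrightarrow> l + n \<le> Suc N \<Longrightarrow> p < l \<or> l + n \<le> p \<Longrightarrow> E p * x = x \<Longrightarrow>
    E p * (Dv l n * x) = Dv l n * x"
  by (induction n arbitrary: x) (auto simp: mult.assoc intro!: Db_E)

lemma t_Dv:
  "p \<le> N \<Longrightarrow> l + n \<le> Suc N \<Longrightarrow> p < l \<or> l + n \<le> p \<Longrightarrow> E p * x = x \<Longrightarrow> l \<le> r \<Longrightarrow> Suc r < l + n \<Longrightarrow>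
    t r * (Dv l n * x) = 0"
proof (induction n arbitrary: r)
  case (Suc n)
  have "t r * (Db l n * (Dv l n * x)) = 0"
    using Suc.prems by (intro t_Db[of p] Dv_E Suc.IH) auto
  then show ?case by (simp add: mult.assoc)
qed simp

lemma t_Dv_far:
  "p \<le> N \<Longrightarrow> l + n \<le> Suc N \<Longrightarrow> p < l \<or> l + n \<le> p \<Longrightarrow> s < N \<Longrightarrow> Suc s < l \<or> l + n \<le> s \<Longrightarrow>
    E p * x = x \<Longrightarrow> t s * (Dv l n * x) =\<^sub>\<plusminus> Dv l n * (t s * x)"
proof (induction n)
  case (Suc n)
  have "t s * (Dv l (Suc n) * x) = t s * (Db l n * (Dv l n * x))" by (simp add: mult.assoc)
  also have "\<dots> =\<^sub>\<plusminus> Db l n * (t s * (Dv l n * x))"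
    using Suc.prems by (intro t_Db_far[of p] Dv_E) auto
  also have "\<dots> =\<^sub>\<plusminus> Db l n * (Dv l n * (t s * x))"
    using Suc.prems by (intro eqs_mult_left Suc.IH) auto
  finally show ?case by (simp add: mult.assoc)
qed simp

lemma Db_fix:
  "p \<le> N \<Longrightarrow> l + n \<le> N \<Longrightarrow> p < l \<or> l + n < p \<or> n = 0 \<Longrightarrow> E p * x = x \<Longrightarrow>
    (\<And>r. l \<le> r \<Longrightarrow> r < l + n \<Longrightarrow> t r * x = 0) \<Longrightarrow> Db l n * x = x"
proof (induction n)
  case (Suc n)
  have "db (l + n) * x = x" using Suc.prems by (intro db_fix[of p]) auto
  moreover have "Db l n * x = x" using Suc.prems by (intro Suc.IH) auto
  ultimately show ?case by (simp add: mult.assoc)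
qed simp

lemma Dv_fix:
  "p \<le> N \<Longrightarrow> l + n \<le> Suc N \<Longrightarrow> p < l \<or> l + n \<le> p \<Longrightarrow> E p * x = x \<Longrightarrow>
    (\<And>r. l \<le> r \<Longrightarrow> Suc r < l + n \<Longrightarrow> t r * x = 0) \<Longrightarrow> Dv l n * x = x"
proof (induction n)
  case (Suc n)
  have "Dv l n * x = x" using Suc by auto
  moreover have "Db l n * x = x" using Suc.prems by (intro Db_fix[of p]) auto
  ultimately show ?case by (simp add: mult.assoc)
qed simp

definition gidem :: "nat \<Rightarrow> 'a" where
  "gidem p = Dv 0 p * Dv (Suc p) (N - p) * E p"

lemma killed_gidem:
  assumes p: "p \<le> N" and E: "E p * E p = E p"
  shows "killed p (gidem p)"
  unfolding killed_def
proof (intro conjI allI impI)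
  let ?R = "Dv (Suc p) (N - p) * E p"
  have R: "E p * ?R = ?R" using p E by (intro Dv_E) auto
  show "E p * gidem p = gidem p"
    unfolding gidem_def mult.assoc using p E R by (intro Dv_E) auto
  fix r assume r: "r < N" "r \<noteq> p" "Suc r \<noteq> p"
  show "t r * gidem p = 0"
  proof (cases "r < p")
    case True
    then show ?thesis
      unfolding gidem_def mult.assoc using p R r by (intro t_Dv[of p]) auto
  next
    case False
    have "t r * (Dv 0 p * ?R) =\<^sub>\<plusminus> Dv 0 p * (t r * ?R)"
      using p R r False by (intro t_Dv_far[of p]) auto
    moreover have "t r * ?R = 0"
      using p E r False by (intro t_Dv[of p]) auto
    ultimately show ?thesis unfolding gidem_def mult.assoc by simp
  qed
qed

text \<open>Every factor \<open>db r\<close> acts as the identity on a killed element, by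
  \<open>db_fix\<close>.\<close>

lemma gidem_fix:
  assumes p: "p \<le> N" and x: "killed p x"
  shows "gidem p * x = x"
proof -
  have "Dv (Suc p) (N - p) * x = x"
    using p killed_E[OF x] by (intro Dv_fix[of p] killedD[OF x]) auto
  moreover have "Dv 0 p * x = x"
    using p killed_E[OF x] by (intro Dv_fix[of p] killedD[OF x]) auto
  ultimately show ?thesis by (simp add: gidem_def mult.assoc killed_E[OF x])
qed

end


section \<open>Leading terms\<close>

text \<open>The typical instance consists of the elements annihilated by a given product of
  crossings. Closure under subtraction is what the comparison of leading terms uses.\<close>

definition additive_set :: "'a::ring_1 set \<Rightarrow> bool" where
  "additive_set S \<longleftrightarrow> 0 \<in> S \<and> (\<forall>a\<in>S. \<forall>b\<in>S. a - b \<in> S)"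

lemma additive_setI:
  "0 \<in> S \<Longrightarrow> (\<And>a b. a \<in> S \<Longrightarrow> b \<in> S \<Longrightarrow> a - b \<in> S) \<Longrightarrow> additive_set S"
  by (simp add: additive_set_def)

context
  fixes S :: "'a::ring_1 set"
  assumes S: "additive_set S"
begin

lemma additive_set_0: "0 \<in> S"
  and additive_set_diff: "a \<in> S \<Longrightarrow> b \<in> S \<Longrightarrow> a - b \<in> S"
  using S by (auto simp: additive_set_def)

lemma additive_set_uminus: "a \<in> S \<Longrightarrow> - a \<in> S"
  using additive_set_diff[OF additive_set_0, of a] by simp

lemma additive_set_add: "a \<in> S \<Longrightarrow> b \<in> S \<Longrightarrow> a + b \<in> S"
  using additive_set_diff[of a "- b"] additive_set_uminus[of b] by simp

lemma additive_set_eqs: "a =\<^sub>\<plusminus> b \<Longrightarrow> b \<in> S \<Longrightarrow> a \<in> S"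
  using additive_set_uminus by (auto simp: eqs_def)

lemma additive_set_sum: "(\<And>i. i \<in> A \<Longrightarrow> f i \<in> S) \<Longrightarrow> sum f A \<in> S"
  by (induction A rule: infinite_finite_induct) (auto simp: additive_set_0 additive_set_add)

lemma additive_set_of_nat: "a \<in> S \<Longrightarrow> of_nat n * a \<in> S"
  by (induction n) (auto simp: additive_set_0 additive_set_add distrib_right)

lemma additive_set_sign: "\<kappa> = 1 \<or> \<kappa> = - 1 \<Longrightarrow> a \<in> S \<Longrightarrow> \<kappa> ^ n * a \<in> S"
  by (induction n) (auto simp: mult.assoc additive_set_uminus)

lemma additive_set_mult_vimage: "additive_set {a. c * a \<in> S}"
  by (intro additive_setI) (auto simp: right_diff_distrib additive_set_0 additive_set_diff)

end

lemma binomial_commuting: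
  fixes a b :: "'a::ring_1"
  assumes "a * b = b * a"
  shows "(a + b) ^ m = (\<Sum>n\<le>m. of_nat (m choose n) * (a ^ n * b ^ (m - n)))"
proof (induction m)
  case (Suc m)
  let ?f = "\<lambda>m n. of_nat (m choose n) * (a ^ n * b ^ (m - n))"
  have c: "b * a ^ n = a ^ n * b" for n
    using assms by (metis power_commuting_commutes)
  have a: "a * ?f m n = of_nat (m choose n) * (a ^ Suc n * b ^ (m - n))" for n
  proof -
    have "a * ?f m n = of_nat (m choose n) * (a * (a ^ n * b ^ (m - n)))"
      by (metis mult.assoc mult_of_nat_commute)
    then show ?thesis by (simp add: mult.assoc)
  qed
  have b: "b * ?f m n = of_nat (m choose n) * (a ^ n * b ^ Suc (m - n))" for n
  proof -
    have "b * ?f m n = of_nat (m choose n) * ((b * a ^ n) * b ^ (m - n))"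
      by (metis mult.assoc mult_of_nat_commute)
    then show ?thesis by (simp add: c mult.assoc)
  qed
  have "(a + b) ^ Suc m = a * (\<Sum>n\<le>m. ?f m n) + b * (\<Sum>n\<le>m. ?f m n)"
    by (simp add: Suc distrib_right)
  also have "a * (\<Sum>n\<le>m. ?f m n) = (\<Sum>n\<le>m. of_nat (m choose n) * (a ^ Suc n * b ^ (m - n)))"
    by (simp only: sum_distrib_left a)
  also have "b * (\<Sum>n\<le>m. ?f m n) = (\<Sum>n\<le>m. of_nat (m choose n) * (a ^ n * b ^ Suc (m - n)))"
    by (simp only: sum_distrib_left b)
  also have "\<dots> = (\<Sum>n\<le>Suc m. of_nat (m choose n) * (a ^ n * b ^ (Suc m - n)))"
    by (simp add: Suc_diff_le binomial_eq_0)
  also have "\<dots> = b ^ Suc m + (\<Sum>n\<le>m. of_nat (m choose Suc n) * (a ^ Suc n * b ^ (m - n)))"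
    by (subst sum.atMost_Suc_shift) simp
  also have "(\<Sum>n\<le>m. of_nat (m choose n) * (a ^ Suc n * b ^ (m - n))) + \<dots>
      = b ^ Suc m + (\<Sum>n\<le>m. of_nat (Suc m choose Suc n) * (a ^ Suc n * b ^ (m - n)))"
    by (simp add: sum.distrib distrib_right del: power_Suc)
  also have "\<dots> = (\<Sum>n\<le>Suc m. ?f (Suc m) n)"
    by (subst sum.atMost_Suc_shift) simp
  finally show ?case .
qed simp

lemma power_diff_commuting:
  fixes a b :: "'a::ring_1"
  assumes "a * b = b * a"
  shows "(a - b) * (\<Sum>s<k. a ^ s * b ^ (k - 1 - s)) = a ^ k - b ^ k"
proof (induction k)
  case (Suc k)
  have "(\<Sum>s<k. a ^ s * b ^ (k - s)) = (\<Sum>s<k. a ^ s * b ^ (k - 1 - s)) * b"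
    unfolding sum_distrib_right
  proof (rule sum.cong)
    fix s assume "s \<in> {..<k}"
    then have "k - s = Suc (k - 1 - s)" by auto
    then show "a ^ s * b ^ (k - s) = a ^ s * b ^ (k - 1 - s) * b"
      by (simp only: power_Suc2 mult.assoc)
  qed simp
  then have "(a - b) * (\<Sum>s<Suc k. a ^ s * b ^ (Suc k - 1 - s)) = (a ^ k - b ^ k) * b + (a - b) * a ^ k"
    by (simp add: distrib_left Suc[simplified] mult.assoc[symmetric])
  also have "b * a ^ k = a ^ k * b"
    using assms by (metis power_commuting_commutes)
  then have "(a ^ k - b ^ k) * b + (a - b) * a ^ k = a ^ Suc k - b ^ Suc k"
    by (simp add: algebra_simps power_Suc2[symmetric] del: power_Suc) (simp add: power_Suc2)
  finally show ?case .
qed simp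

text \<open>The quotient of \<open>(u\<^sup>g\<^sup>p + \<kappa> v\<^sup>q)\<^sup>m - (w\<^sup>g\<^sup>p + \<kappa> v\<^sup>q)\<^sup>m\<close> by \<open>u\<^sup>g - w\<^sup>g\<close>.\<close>

definition qdiff :: "nat \<Rightarrow> nat \<Rightarrow> nat \<Rightarrow> nat \<Rightarrow> 'a::ring_1 \<Rightarrow> 'a \<Rightarrow> 'a \<Rightarrow> 'a \<Rightarrow> 'a" where
  "qdiff g p q m \<kappa> u w v = (\<Sum>n\<le>m. of_nat (m choose n) * (\<kappa> ^ (m - n) *
     ((\<Sum>s<p * n. u ^ (g * s) * w ^ (g * (p * n - 1 - s))) * v ^ (q * (m - n)))))"

text \<open>The binomial expansion leaves differences \<open>u ^ (g * k) - w ^ (g * k)\<close>, to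
  which the geometric sum applies. It is the powers \<open>u ^ g\<close>, \<open>w ^ g\<close> and
  \<open>v ^ q\<close> that have to commute, which for \<open>g = 2\<close> covers anticommuting
  variables.\<close>

lemma qdiff_mult:
  fixes u w v :: "'a::ring_1"
  assumes \<kappa>: "\<kappa> = 1 \<or> \<kappa> = - 1"
    and uw: "u ^ g * w ^ g = w ^ g * u ^ g"
    and uv: "u ^ g * v ^ q = v ^ q * u ^ g" and wv: "w ^ g * v ^ q = v ^ q * w ^ g"
  shows "(u ^ g - w ^ g) * qdiff g p q m \<kappa> u w v
    = (u ^ (g * p) + \<kappa> * v ^ q) ^ m - (w ^ (g * p) + \<kappa> * v ^ q) ^ m"
proof -
  have cm: "x * (\<kappa> ^ n * z) = \<kappa> ^ n * (x * z)" for x z n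
    using \<kappa> by (induction n) (auto simp: mult.assoc)
  have pw: "(\<kappa> * v ^ q) ^ n = \<kappa> ^ n * v ^ (q * n)" for n
    by (induction n) (simp_all add: power_add mult.assoc cm)
  have ex: "(x ^ (g * p) + \<kappa> * v ^ q) ^ m
      = (\<Sum>n\<le>m. of_nat (m choose n) * (\<kappa> ^ (m - n) * (x ^ (g * (p * n)) * v ^ (q * (m - n)))))"
    if "x ^ g * v ^ q = v ^ q * x ^ g" for x
  proof -
    have "x ^ (g * p) * v ^ q = v ^ q * x ^ (g * p)"
      using that by (metis power_mult power_commuting_commutes)
    then have "x ^ (g * p) * (\<kappa> * v ^ q) = (\<kappa> * v ^ q) * x ^ (g * p)"
      using cm[of _ 1] by (simp add: mult.assoc)
    then show ?thesis
      by (subst binomial_commuting) (simp_all add: pw cm power_mult[symmetric] mult.assoc)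
  qed
  have tel: "(u ^ g - w ^ g) * (\<Sum>s<k. u ^ (g * s) * w ^ (g * (k - 1 - s))) = u ^ (g * k) - w ^ (g * k)"
    for k
    using power_diff_commuting[OF uw, of k] by (simp add: power_mult)
  have tel': "(u ^ g - w ^ g) * ((\<Sum>s<k. u ^ (g * s) * w ^ (g * (k - 1 - s))) * z)
      = u ^ (g * k) * z - w ^ (g * k) * z" for k z
    by (simp only: mult.assoc[symmetric] tel) (simp only: left_diff_distrib)
  have cn: "x * (of_nat l * z) = of_nat l * (x * z)" for x z :: 'a and l
    by (metis mult.assoc mult_of_nat_commute)
  show ?thesis
    unfolding qdiff_def sum_distrib_left cn[of "u ^ g - w ^ g"] cm[of "u ^ g - w ^ g"] ex[OF uv] ex[OF wv] sum_subtractf[symmetric]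
    by (intro sum.cong refl) (simp only: tel' right_diff_distrib)
qed

text \<open>The summands with \<open>n < m\<close> have too small a degree in \<open>u\<close> and
  \<open>w\<close>; the one with \<open>n = m\<close> has coefficient one and contains each monomial
  of top degree once. A value of \<open>s0\<close> that is at least \<open>p * m\<close> expresses
  that no monomial survives.\<close>

lemma qdiff_lead:
  fixes u w v :: "'a::ring_1"
  assumes S: "additive_set S" and \<kappa>: "\<kappa> = 1 \<or> \<kappa> = - 1" and p: "0 < p"
    and low: "\<And>s t r. s + t + 1 < p * m \<Longrightarrow> u ^ (g * s) * (w ^ (g * t) * v ^ r) \<in> S"
    and top: "\<And>s t. s + t + 1 = p * m \<Longrightarrow> s \<noteq> s0 \<Longrightarrow> u ^ (g * s) * w ^ (g * t) \<in> S"
  shows "qdiff g p q m \<kappa> u w v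
      - (if s0 < p * m then u ^ (g * s0) * w ^ (g * (p * m - 1 - s0)) else 0) \<in> S"
proof -
  let ?f = "\<lambda>n. of_nat (m choose n) * (\<kappa> ^ (m - n) *
     ((\<Sum>s<p * n. u ^ (g * s) * w ^ (g * (p * n - 1 - s))) * v ^ (q * (m - n))))"
  let ?h = "\<lambda>s. u ^ (g * s) * w ^ (g * (p * m - 1 - s))"
  have "?f n \<in> S" if "n < m" for n
  proof (intro additive_set_of_nat additive_set_sign S \<kappa>, unfold sum_distrib_right,
      intro additive_set_sum S)
    fix s assume s: "s \<in> {..<p * n}"
    have "p * n < p * m" using that p by simp
    then have "s + (p * n - 1 - s) + 1 < p * m" using s unfolding lessThan_iff by linarith
    then show "u ^ (g * s) * w ^ (g * (p * n - 1 - s)) * v ^ (q * (m - n)) \<in> S"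
      using low by (simp add: mult.assoc)
  qed
  then have 1: "(\<Sum>n<m. ?f n) \<in> S" by (intro additive_set_sum S) auto
  have "?h s \<in> S" if "s \<in> {..<p * m} - {s0}" for s
    using that by (intro top) auto
  then have 2: "(\<Sum>s\<in>{..<p * m} - {s0}. ?h s) \<in> S" by (intro additive_set_sum S)
  have 3: "?f m = (\<Sum>s<p * m. ?h s)" by simp
  have 4: "(\<Sum>s<p * m. ?h s) - (if s0 < p * m then ?h s0 else 0) = (\<Sum>s\<in>{..<p * m} - {s0}. ?h s)"
    by (cases "s0 < p * m") (simp_all add: sum_diff1)
  have "qdiff g p q m \<kappa> u w v - (if s0 < p * m then ?h s0 else 0)
     = (\<Sum>n<m. ?f n) + (?f m - (if s0 < p * m then ?h s0 else 0))"
    unfolding qdiff_def lessThan_Suc_atMost[symmetric] sum.lessThan_Suc by (simp add: algebra_simps)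
  also have "\<dots> = (\<Sum>n<m. ?f n) + (\<Sum>s\<in>{..<p * m} - {s0}. ?h s)"
    by (simp only: 3 4)
  finally show ?thesis using additive_set_add[OF S 1 2] by simp
qed

section \<open>Leading powers when the variables commute only up to sign\<close>

inductive_set lowspan :: "'a::ring_1 \<Rightarrow> 'a \<Rightarrow> 'a \<Rightarrow> nat \<Rightarrow> 'a set" for u v x d where
  zero: "0 \<in> lowspan u v x d"
| diff: "a \<in> lowspan u v x d \<Longrightarrow> b \<in> lowspan u v x d \<Longrightarrow> a - b \<in> lowspan u v x d"
| mono: "s < d \<Longrightarrow> u ^ s * (v ^ r * x) \<in> lowspan u v x d"

lemma additive_lowspan: "additive_set (lowspan u v x d)"
  by (intro additive_setI lowspan.zero lowspan.diff)

lemma lowspan_mult_left: "a \<in> lowspan u v x d \<Longrightarrow> u ^ p * a \<in> lowspan u v x (p + d)"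
proof (induction rule: lowspan.induct)
  case (mono s r)
  then have "u ^ (p + s) * (v ^ r * x) \<in> lowspan u v x (p + d)" by (intro lowspan.mono) simp
  then show ?case by (simp add: power_add mult.assoc)
qed (auto simp: right_diff_distrib intro: lowspan.zero lowspan.diff)

lemma lowspan_mult_right:
  assumes "\<And>s r. v * (u ^ s * (v ^ r * x)) =\<^sub>\<plusminus> u ^ s * (v ^ Suc r * x)"
  shows "a \<in> lowspan u v x d \<Longrightarrow> v ^ q * a \<in> lowspan u v x d"
proof (induction q)
  case (Suc q)
  have "v * b \<in> lowspan u v x d" if "b \<in> lowspan u v x d" for b
    using that
  proof (induction rule: lowspan.induct)
    case (mono s r)
    then show ?case
      by (intro additive_set_eqs[OF additive_lowspan assms] lowspan.mono)
  qed (auto simp: right_diff_distrib intro: lowspan.zero lowspan.diff)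
  then show ?case using Suc by (simp add: mult.assoc)
qed simp

lemma lowspan_le: "a \<in> lowspan u v x d \<Longrightarrow> d \<le> d' \<Longrightarrow> a \<in> lowspan u v x d'"
  by (induction rule: lowspan.induct) (auto intro: lowspan.intros)

lemma lowspan_subset:
  assumes "additive_set S" "\<And>s r. s < d \<Longrightarrow> u ^ s * (v ^ r * x) \<in> S" "a \<in> lowspan u v x d"
  shows "a \<in> S"
  using assms(3)
  by (induction rule: lowspan.induct) (auto intro: assms additive_set_diff additive_set_0)

text \<open>The signs in \<open>comm\<close> may vary with the monomial, so no binomial formula is
  available; it is enough that all terms but \<open>u ^ (p * m) * x\<close> have a smaller power of
  \<open>u\<close>.\<close>

lemma power_diff_lead:
  assumes comm: "\<And>s r. v * (u ^ s * (v ^ r * x)) =\<^sub>\<plusminus> u ^ s * (v ^ Suc r * x)" and p: "0 < p"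
  shows "(u ^ p - v ^ q) ^ m * x - u ^ (p * m) * x \<in> lowspan u v x (p * m)"
proof (induction m)
  case 0
  then show ?case by (simp add: lowspan.zero)
next
  case (Suc m)
  let ?L = "lowspan u v x (p * Suc m)" and ?a = "(u ^ p - v ^ q) ^ m * x - u ^ (p * m) * x"
  have 1: "u ^ p * ?a \<in> ?L" using lowspan_mult_left[OF Suc] by simp
  have 2: "v ^ q * ?a \<in> ?L" using lowspan_le[OF lowspan_mult_right[OF comm Suc]] by simp
  have "u ^ (p * m) * (v ^ 0 * x) \<in> ?L" using p by (intro lowspan.mono) simp
  then have 3: "v ^ q * (u ^ (p * m) * (v ^ 0 * x)) \<in> ?L" by (rule lowspan_mult_right[OF comm])
  have "(u ^ p - v ^ q) ^ Suc m * x - u ^ (p * Suc m) * x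
      = u ^ p * ?a - v ^ q * ?a - v ^ q * (u ^ (p * m) * (v ^ 0 * x))"
    by (simp add: algebra_simps power_add)
  then show ?case using lowspan.diff[OF lowspan.diff[OF 1 2] 3] by simp
qed


section \<open>The homotopy\<close>

text \<open>The row \<open>t (N - 1) * ... * t (N - n)\<close>, written as \<open>asc\<close> for
  the strands numbered from the other end, so that the facts about \<open>asc\<close> transfer by
  \<open>reversed\<close>.\<close>

abbreviation desc :: "nat \<Rightarrow> (nat \<Rightarrow> 'a::ring_1) \<Rightarrow> nat \<Rightarrow> 'a" where
  "desc N t \<equiv> asc (\<lambda>r. t (N - Suc r))"

context strands
begin

interpretation R: strands N "\<lambda>r. y (N - r)" "\<lambda>r. t (N - Suc r)" "\<lambda>p. E (N - p)" k "- (k * k')"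
  by (rule reversed)

lemma killed_reversed: "p \<le> N \<Longrightarrow> R.killed (N - p) x \<longleftrightarrow> killed p x"
  unfolding killed_def R.killed_def
proof (intro conj_cong)
  assume p: "p \<le> N"
  show "(\<forall>r<N. r \<noteq> N - p \<longrightarrow> Suc r \<noteq> N - p \<longrightarrow> t (N - Suc r) * x = 0) \<longleftrightarrow>
      (\<forall>r<N. r \<noteq> p \<longrightarrow> Suc r \<noteq> p \<longrightarrow> t r * x = 0)" (is "?l \<longleftrightarrow> ?r")
  proof
    assume ?l
    show ?r
    proof (intro allI impI)
      fix r assume "r < N" "r \<noteq> p" "Suc r \<noteq> p"
      then show "t r * x = 0" using \<open>?l\<close>[rule_format, of "N - Suc r"] p by auto
    qed
  next
    assume ?r
    show ?l
    proof (intro allI impI)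
      fix r assume "r < N" "r \<noteq> N - p" "Suc r \<noteq> N - p"
      then show "t (N - Suc r) * x = 0" using \<open>?r\<close>[rule_format, of "N - Suc r"] p by auto
    qed
  qed
qed simp

lemma killed_desc:
  assumes "0 < p" "p \<le> N" "killed p x"
  shows "killed (p - 1) (desc N t (Suc (N - p)) * x)"
proof -
  have "R.killed (Suc (N - p)) (desc N t (Suc (N - p)) * x)"
    using assms by (intro R.killed_asc) (auto simp: killed_reversed)
  moreover have "N - (p - 1) = Suc (N - p)" using assms by simp
  ultimately show ?thesis using assms killed_reversed[of "p - 1"] by (simp del: asc.simps)
qed

lemma t_desc_far:
  assumes "p \<le> N" "Suc s + n < N" "E p * x = x"
  shows "t s * (desc N t n * x) =\<^sub>\<plusminus> desc N t n * (t s * x)"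
  using R.t_asc_far[of "N - p" "N - Suc s" n x] assms by simp

lemma asc_desc:
  "p \<le> N \<Longrightarrow> n + m < N \<Longrightarrow> E p * x = x \<Longrightarrow> asc t n * (desc N t m * x) =\<^sub>\<plusminus> desc N t m * (asc t n * x)"
proof (induction n arbitrary: x p)
  case (Suc n)
  have "asc t (Suc n) * (desc N t m * x) = asc t n * (t n * (desc N t m * x))"
    by (simp add: mult.assoc)
  also have "\<dots> =\<^sub>\<plusminus> asc t n * (desc N t m * (t n * x))"
    using Suc.prems by (intro eqs_mult_left t_desc_far[of p]) auto
  also have "\<dots> =\<^sub>\<plusminus> desc N t m * (asc t n * (t n * x))"
    using Suc.prems by (intro Suc.IH[of "swp n p"] swp_le t_E) auto
  finally show ?case by (simp add: mult.assoc)
qed simp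

lemma killed_y_pow:
  assumes "p \<le> N" "killed p x"
  shows "killed p (y p ^ m * x)"
  unfolding killed_def
proof (intro conjI allI impI)
  show "E p * (y p ^ m * x) = y p ^ m * x"
    using assms killed_E by (intro y_pow_E) auto
  fix r assume r: "r < N" "r \<noteq> p" "Suc r \<noteq> p"
  have "t r * (y p ^ m * x) =\<^sub>\<plusminus> y p ^ m * (t r * x)"
    using assms r killed_E[OF assms(2)] by (intro t_y_pow_far[of p]) auto
  then show "t r * (y p ^ m * x) = 0" using killedD[OF assms(2) r] by simp
qed

text \<open>The two rows are the crossings left over when the middle ones have been used up in the
  braid relation. Calculating modulo this set amounts to reading off one coefficient of
  \<open>g\<close>.\<close>

definition annih :: "nat \<Rightarrow> 'a \<Rightarrow> 'a set" where
  "annih b x = {g. asc t (b - 1) * (desc N t (N - b - 1) * (g * x)) = 0}"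

lemma additive_annih: "additive_set (annih b x)"
  by (intro additive_setI) (auto simp: annih_def left_diff_distrib right_diff_distrib)

context
  fixes b x assumes b: "0 < b" "b < N" and x: "killed b x"
begin

section \<open>Monomials in the dots under the two rows of crossings\<close>

lemma desc_y_pow:
  fixes z s assumes z: "killed b z"
  defines "w \<equiv> y (b - 1) ^ s * z"
  shows "m < N - b - 1 \<Longrightarrow> desc N t (N - b - 1) * (y (Suc b) ^ m * w) = 0"
    and "desc N t (N - b - 1) * (y (Suc b) ^ (N - b - 1) * w) =\<^sub>\<plusminus> w"
proof -
  have E: "E b * w = w"
    unfolding w_def using b killed_E[OF z] by (intro y_pow_E) auto
  have "t (N - Suc r) * w = 0" if r: "r < N - b - 1" for r
  proof -
    have "t (N - Suc r) * w =\<^sub>\<plusminus> y (b - 1) ^ s * (t (N - Suc r) * z)"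
      unfolding w_def using b r killed_E[OF z] by (intro t_y_pow_far[of b]) auto
    moreover have "t (N - Suc r) * z = 0" using r b by (intro killedD[OF z]) auto
    ultimately show ?thesis by simp
  qed
  then have "(m < N - b - 1 \<longrightarrow> desc N t (N - b - 1) * (y (N - (N - b - 1)) ^ m * w) = 0) \<and>
      desc N t (N - b - 1) * (y (N - (N - b - 1)) ^ (N - b - 1) * w) =\<^sub>\<plusminus> w"
    using b E by (intro R.asc_y_pow[of "N - b"]) auto
  moreover have "N - (N - b - 1) = Suc b" using b by simp
  ultimately show "m < N - b - 1 \<Longrightarrow> desc N t (N - b - 1) * (y (Suc b) ^ m * w) = 0"
    "desc N t (N - b - 1) * (y (Suc b) ^ (N - b - 1) * w) =\<^sub>\<plusminus> w" by simp_all
qed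

lemma asc_y_pow':
  assumes z: "killed b z"
  shows "m < b - 1 \<Longrightarrow> asc t (b - 1) * (y (b - 1) ^ m * z) = 0"
    and "asc t (b - 1) * (y (b - 1) ^ (b - 1) * z) =\<^sub>\<plusminus> z"
  using asc_y_pow[of b "b - 1" z m] b killed_E[OF z] killedD[OF z] by auto

lemma monomial_lead:
  "asc t (b - 1) * (desc N t (N - b - 1) * (y (Suc b) ^ (N - b - 1) * (y (b - 1) ^ (b - 1) * x))) =\<^sub>\<plusminus> x"
proof -
  have "asc t (b - 1) * (desc N t (N - b - 1) * (y (Suc b) ^ (N - b - 1) * (y (b - 1) ^ (b - 1) * x)))
      =\<^sub>\<plusminus> asc t (b - 1) * (y (b - 1) ^ (b - 1) * x)"
    by (intro eqs_mult_left desc_y_pow x)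
  also have "\<dots> =\<^sub>\<plusminus> x" by (intro asc_y_pow' x)
  finally show ?thesis .
qed

text \<open>The rows consist of \<open>N - b - 1\<close> and \<open>b - 1\<close> crossings,
  \<open>N - 2\<close> in all; a monomial of at most this degree that does not match the split has
  too small a power on one side. If this is the side of \<open>asc\<close>, the rows are
  interchanged first. The powers of \<open>y b\<close>, the dot on the strand j, pass through the
  crossings.\<close>

lemma monomial_annih:
  assumes "s + q < N - 1" "s \<noteq> N - b - 1 \<or> q \<noteq> b - 1"
  shows "y (Suc b) ^ s * (y (b - 1) ^ q * y b ^ r) \<in> annih b x"
proof -
  let ?z = "y b ^ r * x"
  have z: "killed b ?z" using b x by (intro killed_y_pow) auto
  consider "s < N - b - 1" | "q < b - 1" using assms b by linarith
  then have "asc t (b - 1) * (desc N t (N - b - 1) * (y (Suc b) ^ s * (y (b - 1) ^ q * ?z))) = 0"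
  proof cases
    case 1
    then show ?thesis using desc_y_pow(1)[OF z] by simp
  next
    case 2
    have E: "E b * (y (b - 1) ^ q * ?z) = y (b - 1) ^ q * ?z"
      using b killed_E[OF x] by (intro y_pow_E) auto
    have "asc t (b - 1) * (desc N t (N - b - 1) * (y (Suc b) ^ s * (y (b - 1) ^ q * ?z)))
       =\<^sub>\<plusminus> desc N t (N - b - 1) * (asc t (b - 1) * (y (Suc b) ^ s * (y (b - 1) ^ q * ?z)))"
      using b E killed_E[OF x] by (intro asc_desc[of b] y_pow_E) auto
    also have "\<dots> =\<^sub>\<plusminus> desc N t (N - b - 1) * (y (Suc b) ^ s * (asc t (b - 1) * (y (b - 1) ^ q * ?z)))"
      using b E killed_E[OF x] by (intro eqs_mult_left eqs_sym[OF y_pow_asc_far[of b]]) auto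
    also have "\<dots> = 0" using asc_y_pow'(1)[OF z 2] by simp
    finally show ?thesis by simp
  qed
  then show ?thesis by (simp add: annih_def mult.assoc)
qed

lemma y_commute_even:
  assumes "E b * z = z"
  shows "y (b - 1) * (y (Suc b) ^ (2 * s) * z) = y (Suc b) ^ (2 * s) * (y (b - 1) * z)"
proof (induction s)
  case (Suc s)
  have 1: "y (b - 1) * (y (Suc b) * (y (Suc b) * w)) = y (Suc b) * (y (Suc b) * (y (b - 1) * w))"
    if w: "E b * w = w" for w
  proof -
    have c: "y (b - 1) * (y (Suc b) * v) = k * (y (Suc b) * (y (b - 1) * v))" if "E b * v = v" for v
      using b that by (intro y_y_same[of b]) auto
    have "E b * (y (Suc b) * w) = y (Suc b) * w" using b w by (intro y_E) auto
    from c[OF this] c[OF w] show ?thesis using k by auto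
  qed
  have "E b * (y (Suc b) ^ (2 * s) * z) = y (Suc b) ^ (2 * s) * z"
    using b assms by (intro y_pow_E) auto
  from 1[OF this] Suc show ?case by (simp add: mult.assoc)
qed simp

text \<open>The quotient has degree \<open>p * m - 1\<close>, that is \<open>N - 2\<close>, in the
  two outer dots, so exactly one of its monomials, with exponents \<open>N - b - 1\<close> and
  \<open>b - 1\<close>, is not annihilated.\<close>

lemma homotopy_even:
  assumes m: "0 < p" "p * m = N - 1"
  shows "asc t (b - 1) * (desc N t (N - b - 1) *
    (qdiff 1 p q m (- 1) (y (Suc b)) (y (b - 1)) (y b) * x)) =\<^sub>\<plusminus> x"
proof -
  let ?S = "annih b x" and ?G = "qdiff 1 p q m (- 1) (y (Suc b)) (y (b - 1)) (y b)"
  have "?G - (if N - b - 1 < p * m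
      then y (Suc b) ^ (1 * (N - b - 1)) * y (b - 1) ^ (1 * (p * m - 1 - (N - b - 1))) else 0) \<in> ?S"
  proof (rule qdiff_lead)
    fix s t r assume st: "s + t + 1 < p * m"
    then have "s \<noteq> N - b - 1 \<or> t \<noteq> b - 1" using b m by linarith
    then show "y (Suc b) ^ (1 * s) * (y (b - 1) ^ (1 * t) * y b ^ r) \<in> ?S"
      using monomial_annih[of s t r] st b m by simp
  next
    fix s t assume "s + t + 1 = p * m" "s \<noteq> N - b - 1"
    then show "y (Suc b) ^ (1 * s) * y (b - 1) ^ (1 * t) \<in> ?S"
      using monomial_annih[of s t 0] b m by simp
  qed (use m in \<open>simp_all add: additive_annih\<close>)
  moreover have "N - b - 1 < p * m" "p * m - 1 - (N - b - 1) = b - 1" using b m by auto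
  ultimately have "?G - y (Suc b) ^ (N - b - 1) * y (b - 1) ^ (b - 1) \<in> ?S" by simp
  then have "asc t (b - 1) * (desc N t (N - b - 1) * (?G * x))
      = asc t (b - 1) * (desc N t (N - b - 1) * (y (Suc b) ^ (N - b - 1) * (y (b - 1) ^ (b - 1) * x)))"
    by (simp add: annih_def left_diff_distrib right_diff_distrib mult.assoc)
  then show ?thesis using monomial_lead by simp
qed

text \<open>The outer dots have even exponents in the quotient, whereas \<open>N - 2\<close> is odd,
  so exactly one of \<open>N - b - 1\<close> and \<open>b - 1\<close> is odd. Hence the surviving
  monomial occurs in only one of the two products: in \<open>?u * ?G\<close> if
  \<open>N - b - 1\<close> is odd, in \<open>?w * ?G\<close> if it is even. Nothing can
  cancel.\<close>

lemma homotopy_odd: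
  assumes m: "0 < p" "2 * p * m = N - 1" and \<kappa>: "\<kappa> = 1 \<or> \<kappa> = - 1"
  shows "asc t (b - 1) * (desc N t (N - b - 1) *
    ((y (Suc b) - y (b - 1)) * qdiff 2 p q m \<kappa> (y (Suc b)) (y (b - 1)) (y b) * x)) =\<^sub>\<plusminus> x"
proof -
  let ?S = "annih b x" and ?G = "qdiff 2 p q m \<kappa> (y (Suc b)) (y (b - 1)) (y b)"
  let ?u = "y (Suc b)" and ?w = "y (b - 1)"
  \<comment> \<open>The factor \<open>?w\<close> has to pass an even power of \<open>?u\<close>,
    which it does without a sign.\<close>
  have w_move: "?w * (?u ^ (2 * s) * (?w ^ (2 * t) * y b ^ r)) \<in> ?S \<longleftrightarrow>
      ?u ^ (2 * s) * (?w ^ Suc (2 * t) * y b ^ r) \<in> ?S" for s t r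
  proof -
    have "E b * (?w ^ (2 * t) * (y b ^ r * x)) = ?w ^ (2 * t) * (y b ^ r * x)"
      using b killed_E[OF x] by (intro y_pow_E) auto
    from y_commute_even[OF this] show ?thesis by (simp add: annih_def mult.assoc)
  qed
  \<comment> \<open>Here \<open>s0\<close> will be the index with
    \<open>Suc (2 * s0) = N - b - 1\<close>, or \<open>p * m\<close> if there is none.\<close>
  have uS: "?u * ?G - ?u * (if s0 < p * m then ?u ^ (2 * s0) * ?w ^ (2 * (p * m - 1 - s0)) else 0) \<in> ?S"
    if s0: "\<And>s. s < p * m \<Longrightarrow> s \<noteq> s0 \<Longrightarrow> Suc (2 * s) \<noteq> N - b - 1" for s0
  proof -
    have "?G - (if s0 < p * m then ?u ^ (2 * s0) * ?w ^ (2 * (p * m - 1 - s0)) else 0) \<in> {f. ?u * f \<in> ?S}"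
    proof (rule qdiff_lead)
      fix s t r assume "s + t + 1 < p * m"
      then have "?u ^ Suc (2 * s) * (?w ^ (2 * t) * y b ^ r) \<in> ?S"
        using b m by (intro monomial_annih) auto
      then show "?u ^ (2 * s) * (?w ^ (2 * t) * y b ^ r) \<in> {f. ?u * f \<in> ?S}"
        by (simp add: mult.assoc)
    next
      fix s t assume st: "s + t + 1 = p * m" "s \<noteq> s0"
      then have "?u ^ Suc (2 * s) * (?w ^ (2 * t) * y b ^ 0) \<in> ?S"
        using b m s0[of s] by (intro monomial_annih) auto
      then show "?u ^ (2 * s) * ?w ^ (2 * t) \<in> {f. ?u * f \<in> ?S}"
        by (simp add: mult.assoc)
    qed (use m \<kappa> in \<open>simp_all add: additive_annih additive_set_mult_vimage\<close>)
    then show ?thesis by (simp add: right_diff_distrib)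
  qed
  have wS: "?w * ?G - ?w * (if s0 < p * m then ?u ^ (2 * s0) * ?w ^ (2 * (p * m - 1 - s0)) else 0) \<in> ?S"
    if s0: "\<And>s. s < p * m \<Longrightarrow> s \<noteq> s0 \<Longrightarrow> 2 * s \<noteq> N - b - 1" for s0
  proof -
    have "?G - (if s0 < p * m then ?u ^ (2 * s0) * ?w ^ (2 * (p * m - 1 - s0)) else 0) \<in> {f. ?w * f \<in> ?S}"
    proof (rule qdiff_lead)
      fix s t r assume "s + t + 1 < p * m"
      then have "?u ^ (2 * s) * (?w ^ Suc (2 * t) * y b ^ r) \<in> ?S"
        using b m by (intro monomial_annih) auto
      then show "?u ^ (2 * s) * (?w ^ (2 * t) * y b ^ r) \<in> {f. ?w * f \<in> ?S}"
        using w_move[of s t r] by (simp del: power_Suc)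
    next
      fix s t assume st: "s + t + 1 = p * m" "s \<noteq> s0"
      then have "?u ^ (2 * s) * (?w ^ Suc (2 * t) * y b ^ 0) \<in> ?S"
        using b m s0[of s] by (intro monomial_annih) auto
      then show "?u ^ (2 * s) * ?w ^ (2 * t) \<in> {f. ?w * f \<in> ?S}"
        using w_move[of s t 0] by (simp del: power_Suc)
    qed (use m \<kappa> in \<open>simp_all add: additive_annih additive_set_mult_vimage\<close>)
    then show ?thesis by (simp add: right_diff_distrib)
  qed
  let ?M = "?u ^ (N - b - 1) * (?w ^ (b - 1) * y b ^ 0)"
  have "?M + (?u - ?w) * ?G \<in> ?S \<or> - ?M + (?u - ?w) * ?G \<in> ?S"
  proof (cases "even (N - b - 1)")
    case True
    then obtain s0 where s0: "N - b - 1 = 2 * s0" by blast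
    then have e: "b - 1 = Suc (2 * (p * m - 1 - s0))" "s0 < p * m" using b m by auto
    let ?M' = "?w * (?u ^ (2 * s0) * (?w ^ (2 * (p * m - 1 - s0)) * y b ^ 0))"
    have 1: "?M' - ?M \<in> ?S"
    proof -
      let ?z = "?w ^ (2 * (p * m - 1 - s0)) * x"
      have "E b * ?z = ?z" using b killed_E[OF x] by (intro y_pow_E) auto
      from y_commute_even[OF this] show ?thesis
        unfolding s0 e(1) by (simp add: annih_def mult.assoc left_diff_distrib)
    qed
    have 2: "?w * ?G - ?M' \<in> ?S"
      using wS[of s0] s0 e(2) by simp
    have "Suc (2 * s) \<noteq> N - b - 1" for s unfolding s0 by presburger
    then have 3: "?u * ?G \<in> ?S" using uS[of "p * m"] by simp
    note d = additive_set_diff[OF additive_annih[of b x]]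
    have "?M + (?u - ?w) * ?G = ?u * ?G - (?w * ?G - ?M') - (?M' - ?M)"
      by (simp only: left_diff_distrib) simp
    then show ?thesis using d[OF d[OF 3 2] 1] by (simp only: simp_thms)
  next
    case False
    then obtain s0 where s0: "N - b - 1 = Suc (2 * s0)" by (metis oddE Suc_eq_plus1)
    then have e: "b - 1 = 2 * (p * m - 1 - s0)" "s0 < p * m" using b m by auto
    have 1: "?u * ?G - ?M \<in> ?S"
      using uS[of s0] e(2) unfolding s0 e(1) by (simp add: mult.assoc)
    have "2 * s \<noteq> N - b - 1" for s unfolding s0 by presburger
    then have 2: "?w * ?G \<in> ?S" using wS[of "p * m"] by simp
    have "- ?M + (?u - ?w) * ?G = ?u * ?G - ?M - ?w * ?G"
      by (simp only: left_diff_distrib) simp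
    then show ?thesis
      using additive_set_diff[OF additive_annih 1 2] by (simp only: simp_thms)
  qed
  then have "asc t (b - 1) * (desc N t (N - b - 1) * (((?u - ?w) * ?G) * x))
      =\<^sub>\<plusminus> asc t (b - 1) * (desc N t (N - b - 1) * (?M * x))"
  proof
    assume "?M + (?u - ?w) * ?G \<in> ?S"
    then have "asc t (b - 1) * (desc N t (N - b - 1) * (?M * x))
        + asc t (b - 1) * (desc N t (N - b - 1) * (((?u - ?w) * ?G) * x)) = 0"
      by (simp only: annih_def mem_Collect_eq distrib_right distrib_left)
    then show ?thesis unfolding eqs_def add_eq_0_iff by blast
  next
    assume "- ?M + (?u - ?w) * ?G \<in> ?S"
    then have "- (asc t (b - 1) * (desc N t (N - b - 1) * (?M * x)))
        + asc t (b - 1) * (desc N t (N - b - 1) * (((?u - ?w) * ?G) * x)) = 0"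
      by (simp only: annih_def mem_Collect_eq distrib_right distrib_left mult_minus_left mult_minus_right)
    then show ?thesis unfolding eqs_def by (simp only: neg_eq_iff_add_eq_0[symmetric] minus_minus simp_thms)
  qed
  also have "\<dots> =\<^sub>\<plusminus> x" using monomial_lead by (simp add: mult.assoc)
  finally show ?thesis .
qed

text \<open>The inner crossings of the two composites are the two sides of the braid relation at
  \<open>b - 1\<close>, and up to sign the outer ones can be gathered to the left of them in the
  same order. So a signed sum of the composites is the deformation term, which \<open>lead\<close>
  evaluates.\<close>

lemma homotopy_mid:
  assumes G: "t (b - 1) * (t b * (t (b - 1) * x)) - t b * (t (b - 1) * (t b * x)) = G * x"
    and lead: "asc t (b - 1) * (desc N t (N - b - 1) * (G * x)) =\<^sub>\<plusminus> x"
  shows "\<exists>\<alpha> \<beta>. (\<alpha> = 1 \<or> \<alpha> = - 1) \<and> (\<beta> = 1 \<or> \<beta> = - 1) \<and>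
    x = \<alpha> * (asc t b * (desc N t (Suc (N - b)) * x)) + \<beta> * (desc N t (N - b) * (asc t (Suc b) * x))"
proof -
  let ?L = "asc t (b - 1)" and ?T = "desc N t (N - b - 1)"
  have sb: "asc t b = ?L * t (b - 1)" using b by (cases b) auto
  have sT: "desc N t (N - b) = ?T * t b"
  proof -
    have "N - b = Suc (N - b - 1)" using b by simp
    then have "desc N t (N - b) = ?T * t (N - Suc (N - b - 1))" by (metis asc.simps(2))
    moreover have "N - Suc (N - b - 1) = b" using b by simp
    ultimately show ?thesis by simp
  qed
  have sT': "desc N t (Suc (N - b)) = ?T * t b * t (b - 1)"
    using b by (simp add: sT)
  have Ex: "E b * x = x" by (rule killed_E[OF x])
  have E1: "E (swp (b - 1) b) * (t (b - 1) * x) = t (b - 1) * x"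
    and E2: "E (swp b b) * (t b * x) = t b * x"
    using b Ex by (auto intro!: t_E)
  have E3: "E (swp b (swp (b - 1) b)) * (t b * (t (b - 1) * x)) = t b * (t (b - 1) * x)"
    and E4: "E (swp (b - 1) (swp b b)) * (t (b - 1) * (t b * x)) = t (b - 1) * (t b * x)"
    using b E1 E2 by (auto intro!: t_E swp_le)
  have E5: "E (swp b (swp (b - 1) (swp b b))) * (t b * (t (b - 1) * (t b * x)))
      = t b * (t (b - 1) * (t b * x))"
    using b E4 by (auto intro!: t_E swp_le)
  have "asc t b * (desc N t (Suc (N - b)) * x)
      = ?L * (t (b - 1) * (?T * (t b * (t (b - 1) * x))))"
    by (simp only: sb sT' mult.assoc)
  also have "\<dots> =\<^sub>\<plusminus> ?L * (?T * (t (b - 1) * (t b * (t (b - 1) * x))))"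
    using b E3 by (intro eqs_mult_left t_desc_far[of "swp b (swp (b - 1) b)"] swp_le) auto
  finally have A: "?L * (?T * (t (b - 1) * (t b * (t (b - 1) * x))))
      =\<^sub>\<plusminus> asc t b * (desc N t (Suc (N - b)) * x)" by (rule eqs_sym)
  have "desc N t (N - b) * (asc t (Suc b) * x) = ?T * (t b * (?L * (t (b - 1) * (t b * x))))"
    by (simp only: sT asc.simps sb mult.assoc)
  also have "\<dots> =\<^sub>\<plusminus> ?T * (?L * (t b * (t (b - 1) * (t b * x))))"
    using b E4 by (intro eqs_mult_left t_asc_far[of "swp (b - 1) (swp b b)"] swp_le) auto
  also have "\<dots> =\<^sub>\<plusminus> ?L * (?T * (t b * (t (b - 1) * (t b * x))))"
    using b E5 by (intro eqs_sym[OF asc_desc[of "swp b (swp (b - 1) (swp b b))"]] swp_le) auto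
  finally have B: "?L * (?T * (t b * (t (b - 1) * (t b * x))))
      =\<^sub>\<plusminus> desc N t (N - b) * (asc t (Suc b) * x)" by (rule eqs_sym)
  have "?L * (?T * (t (b - 1) * (t b * (t (b - 1) * x)))) - ?L * (?T * (t b * (t (b - 1) * (t b * x))))
      = ?L * (?T * (G * x))"
    by (simp only: G[symmetric] right_diff_distrib)
  then have "?L * (?T * (t (b - 1) * (t b * (t (b - 1) * x)))) - ?L * (?T * (t b * (t (b - 1) * (t b * x))))
      =\<^sub>\<plusminus> x" using lead by simp
  from eqs_diff_cases[OF this A B] show ?thesis .
qed

end

text \<open>At this end of the complex only one composite exists, and the quadratic relation takes
  the place of the braid relation. Now \<open>N - 1\<close> crossings are left for a polynomial of
  degree \<open>p * m = N - 1\<close> in \<open>y (N - 1)\<close>; the powers of \<open>y N\<close>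
  pass through.\<close>

lemma homotopy_last:
  assumes N: "0 < N" and x: "killed N x" and p: "0 < p" "p * m = N - 1"
    and Q: "t (N - 1) * (t (N - 1) * x) =\<^sub>\<plusminus> (y (N - 1) ^ p - y N ^ q) ^ m * x"
  shows "asc t N * (desc N t 1 * x) =\<^sub>\<plusminus> x"
proof -
  let ?L = "asc t (N - 1)" and ?u = "y (N - 1)" and ?v = "y N"
  let ?S = "{a. ?L * a = 0}"
  have S: "additive_set ?S" by (intro additive_setI) (auto simp: right_diff_distrib)
  have Ex: "E N * x = x" by (rule killed_E[OF x])
  have lead: "(m < N - 1 \<longrightarrow> ?L * (?u ^ m * (?v ^ r * x)) = 0)
      \<and> ?L * (?u ^ (N - 1) * (?v ^ r * x)) =\<^sub>\<plusminus> ?v ^ r * x" for m r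
  proof -
    have z: "killed N (?v ^ r * x)" using x by (intro killed_y_pow) auto
    show ?thesis using N killed_E[OF z] by (intro asc_y_pow[of N] killedD[OF z]) auto
  qed
  have "(?u ^ p - ?v ^ q) ^ m * x - ?u ^ (p * m) * x \<in> lowspan ?u ?v x (p * m)"
  proof (rule power_diff_lead)
    fix s r
    have "?v * (?u ^ s * (?v ^ r * x)) =\<^sub>\<plusminus> ?u ^ s * (?v * (?v ^ r * x))"
      using Ex by (intro y_y_pow[of N] y_pow_E) auto
    then show "?v * (?u ^ s * (?v ^ r * x)) =\<^sub>\<plusminus> ?u ^ s * (?v ^ Suc r * x)"
      by (simp add: mult.assoc)
  qed (rule p)
  from lowspan_subset[OF S _ this]
  have "(?u ^ p - ?v ^ q) ^ m * x - ?u ^ (p * m) * x \<in> ?S"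
    using lead p by simp
  then have *: "?L * ((?u ^ p - ?v ^ q) ^ m * x) = ?L * (?u ^ (N - 1) * x)"
    using p by (simp add: right_diff_distrib)
  have "asc t N = ?L * t (N - 1)" using N by (cases N) auto
  then have "asc t N * (desc N t 1 * x) = ?L * (t (N - 1) * (t (N - 1) * x))"
    by (simp add: mult.assoc)
  also have "\<dots> =\<^sub>\<plusminus> ?L * ((?u ^ p - ?v ^ q) ^ m * x)" by (intro eqs_mult_left Q)
  also have "\<dots> = ?L * (?u ^ (N - 1) * (?v ^ 0 * x))" using * by simp
  also have "\<dots> =\<^sub>\<plusminus> x" using lead[of _ 0] by simp
  finally show ?thesis .
qed

end

lemma (in strands) homotopy_first:
  assumes N: "0 < N" and x: "killed 0 x" and p: "0 < p" "p * m = N - 1"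
    and Q: "t 0 * (t 0 * x) =\<^sub>\<plusminus> (y 1 ^ p - y 0 ^ q) ^ m * x"
  shows "desc N t N * (asc t 1 * x) =\<^sub>\<plusminus> x"
proof -
  interpret R: strands N "\<lambda>r. y (N - r)" "\<lambda>r. t (N - Suc r)" "\<lambda>p. E (N - p)" k "- (k * k')"
    by (rule reversed)
  have "desc N t N * (desc N (\<lambda>r. t (N - Suc r)) 1 * x) =\<^sub>\<plusminus> x"
    using N p Q x killed_reversed[of 0] by (intro R.homotopy_last[of _ p m q]) auto
  then show ?thesis using N by simp
qed


section \<open>Contractible complexes of left ideals\<close>

text \<open>\<open>e k\<close> generates the \<open>k\<close>-th left ideal, right multiplication by \<open>X k\<close> and \<open>S k\<close> gives the
  differential and the contracting homotopy.\<close>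

locale contractible = ring R for R (structure) +
  fixes hg :: "int \<Rightarrow> bit \<Rightarrow> 'a \<Rightarrow> bool" and e X S :: "nat \<Rightarrow> 'a"
    and dg :: "nat \<Rightarrow> int" and pr :: "nat \<Rightarrow> bit"
  assumes hg_zero: "hg d \<epsilon> \<zero>"
    and hg_add: "hg d \<epsilon> x \<Longrightarrow> hg d \<epsilon> y \<Longrightarrow> hg d \<epsilon> (x \<oplus> y)"
    and hg_mult: "hg d \<epsilon> x \<Longrightarrow> hg d' \<epsilon>' y \<Longrightarrow> hg (d + d') (\<epsilon> + \<epsilon>') (x \<otimes> y)"
    and e_closed [simp]: "e k \<in> carrier R" and X_closed [simp]: "X k \<in> carrier R"
    and S_closed [simp]: "S k \<in> carrier R"
    and X_e: "X k \<otimes> e (Suc k) = X k" and S_e: "S k \<otimes> e k = S k"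
    and e_X: "e k \<otimes> X k = X k" and e_S: "e (Suc k) \<otimes> S k = S k"
    and X_X: "X k \<otimes> X (Suc k) = \<zero>" and S_S: "S (Suc k) \<otimes> S k = \<zero>"
    and homotopy_0: "X 0 \<otimes> S 0 = e 0"
    and homotopy_Suc: "X (Suc k) \<otimes> S (Suc k) \<oplus> S k \<otimes> X k = e (Suc k)"
    and hg_X: "hg (dg (Suc k) - dg k) (pr (Suc k) + pr k) (X k)"
    and hg_S: "hg (dg k - dg (Suc k)) (pr (Suc k) + pr k) (S k)"
begin

text \<open>Shifts change only the grading of a left ideal, which is recorded by \<open>dg k\<close>
  and \<open>pr k\<close>. The operations are compared on the carrier only; this admits left ideals
  as well as the one-point module that stands for a negative exponent.\<close>

definition represents :: "('a, 'a) graded_module \<Rightarrow> nat \<Rightarrow> bool" where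
  "represents M k \<longleftrightarrow> carrier M = {h \<otimes> e k |h. h \<in> carrier R} \<and> \<zero>\<^bsub>M\<^esub> = \<zero> \<and>
     (\<forall>x\<in>carrier M. \<forall>y\<in>carrier M. x \<oplus>\<^bsub>M\<^esub> y = x \<oplus> y) \<and>
     (\<forall>a\<in>carrier R. \<forall>x\<in>carrier M. a \<odot>\<^bsub>M\<^esub> x = a \<otimes> x) \<and>
     (\<forall>d \<epsilon>. component M d \<epsilon> = {x \<in> carrier M. hg (d + dg k) (\<epsilon> + pr k) x})"

text \<open>By the homotopy identity \<open>e k\<close> is a sum of products each of which is fixed
  by \<open>e k\<close> from the left.\<close>

lemma e_e: "e k \<otimes> e k = e k"
proof (cases k)
  case 0
  have "e 0 \<otimes> (X 0 \<otimes> S 0) = X 0 \<otimes> S 0"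
    by (simp add: m_assoc[symmetric] e_X)
  then show ?thesis by (simp add: 0 homotopy_0)
next
  case (Suc l)
  have "e k \<otimes> (X k \<otimes> S k \<oplus> S l \<otimes> X l) = X k \<otimes> S k \<oplus> S l \<otimes> X l"
    by (simp add: r_distr m_assoc[symmetric] e_X Suc e_S)
  then show ?thesis by (simp add: Suc homotopy_Suc)
qed

context
  fixes M k assumes M: "represents M k"
begin

lemma carrier_eq: "carrier M = {x \<in> carrier R. x \<otimes> e k = x}"
  using M unfolding represents_def by (auto simp: m_assoc e_e)

lemma in_carrierI: "x \<in> carrier R \<Longrightarrow> x \<otimes> e k = x \<Longrightarrow> x \<in> carrier M"
  by (simp add: carrier_eq)

lemma in_carrierD: "x \<in> carrier M \<Longrightarrow> x \<in> carrier R" "x \<in> carrier M \<Longrightarrow> x \<otimes> e k = x"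
  by (simp_all add: carrier_eq)

lemma module_zero: "\<zero>\<^bsub>M\<^esub> = \<zero>"
  and module_add: "x \<in> carrier M \<Longrightarrow> y \<in> carrier M \<Longrightarrow> x \<oplus>\<^bsub>M\<^esub> y = x \<oplus> y"
  and module_smult: "a \<in> carrier R \<Longrightarrow> x \<in> carrier M \<Longrightarrow> a \<odot>\<^bsub>M\<^esub> x = a \<otimes> x"
  and module_component: "component M d \<epsilon> = {x \<in> carrier M. hg (d + dg k) (\<epsilon> + pr k) x}"
  using M by (simp_all add: represents_def)

lemma zero_in_carrier: "\<zero> \<in> carrier M"
  by (simp add: carrier_eq)

lemma add_in_carrier: "x \<in> carrier M \<Longrightarrow> y \<in> carrier M \<Longrightarrow> x \<oplus> y \<in> carrier M"
  by (auto simp: carrier_eq l_distr)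

end

section \<open>Right multiplications as graded morphisms\<close>

definition transports :: "'a \<Rightarrow> nat \<Rightarrow> nat \<Rightarrow> bool" where
  "transports c k l \<longleftrightarrow> c \<in> carrier R \<and> c \<otimes> e l = c \<and> hg (dg l - dg k) (pr l + pr k) c"

lemma transports_X: "transports (X k) k (Suc k)"
  and transports_S: "transports (S k) (Suc k) k"
  unfolding transports_def using X_e S_e hg_X[of k] hg_S[of k] by (simp_all only: add.commute) simp_all

context
  fixes c k l M L assumes c: "transports c k l" and M: "represents M k" and L: "represents L l"
begin

lemma transports_carrier: "x \<in> carrier M \<Longrightarrow> x \<otimes> c \<in> carrier L"
  using c in_carrierD[OF M] by (intro in_carrierI[OF L]) (auto simp: transports_def m_assoc)

lemma transports_component: "x \<in> component M d \<epsilon> \<Longrightarrow> x \<otimes> c \<in> component L d \<epsilon>"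
proof -
  assume x: "x \<in> component M d \<epsilon>"
  then have "hg ((d + dg k) + (dg l - dg k)) ((\<epsilon> + pr k) + (pr l + pr k)) (x \<otimes> c)"
    using c by (intro hg_mult) (auto simp: transports_def module_component[OF M])
  moreover have "(\<epsilon> + pr k) + (pr l + pr k) = \<epsilon> + pr l"
    by (cases "pr k"; cases "pr l"; cases \<epsilon>) simp_all
  ultimately show ?thesis
    using x transports_carrier by (simp add: module_component[OF M] module_component[OF L])
qed

lemma transports_hom: "(\<lambda>x. x \<otimes> c) \<in> graded_hom R M L"
  using c in_carrierD[OF M] transports_carrier transports_component
  by (auto simp: graded_hom_def module_add[OF M] module_add[OF L] module_smult[OF M]
      module_smult[OF L] l_distr m_assoc transports_def)

end

text \<open>The homotopy identity gives \<open>X k \<otimes> S k \<otimes> X k = X k\<close>, and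
  \<open>x = x \<otimes> S l \<otimes> X l\<close> for \<open>x\<close> in the kernel of the next
  map. The condition on \<open>X n\<close> lets the last module be treated as a kernel too.\<close>

lemma split_exact:
  assumes M: "\<And>k. k \<le> n \<Longrightarrow> represents (M k) k" and X: "X n = \<zero>"
  shows "split_exact_seq R n M (\<lambda>k x. x \<otimes> X k)"
  unfolding split_exact_seq_def exact_seq_def
proof (intro conjI allI impI exI[of _ "\<lambda>k x. x \<otimes> S k"] ballI)
  fix k assume k: "k < n"
  show "(\<lambda>x. x \<otimes> X k) \<in> graded_hom R (M k) (M (Suc k))"
    using k by (intro transports_hom[OF transports_X] M) auto
  show "(\<lambda>x. x \<otimes> S k) \<in> graded_hom R (M (Suc k)) (M k)"
    using k by (intro transports_hom[OF transports_S] M) auto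
  fix x assume "x \<in> carrier (M k)"
  then have x: "x \<in> carrier R" using in_carrierD(1)[OF M, of k] k by simp
  have "X k \<otimes> S k \<otimes> X k = X k"
  proof (cases k)
    case 0
    then show ?thesis using e_X[of 0] by (simp add: homotopy_0)
  next
    case (Suc l)
    have "(X k \<otimes> S k \<oplus> S l \<otimes> X l) \<otimes> X k = X k"
      unfolding Suc homotopy_Suc by (rule e_X)
    then show ?thesis
      by (simp add: l_distr m_assoc Suc X_X)
  qed
  then show "x \<otimes> X k \<otimes> S k \<otimes> X k = x \<otimes> X k"
    using x by (simp add: m_assoc)
next
  fix k assume k: "k \<le> n"
  note Mk = M[OF k]
  have "(if k < n then {x \<in> carrier (M k). x \<otimes> X k = \<zero>\<^bsub>M (Suc k)\<^esub>} else carrier (M n))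
      = {x \<in> carrier (M k). x \<otimes> X k = \<zero>}"
    using k X in_carrierD[OF Mk] by (auto simp: module_zero[OF M])
  moreover have "(if k = 0 then {\<zero>\<^bsub>M 0\<^esub>} else (\<lambda>x. x \<otimes> X (k - 1)) ` carrier (M (k - 1)))
      = {x \<in> carrier (M k). x \<otimes> X k = \<zero>}"
  proof (cases k)
    case 0
    have "x = \<zero>" if "x \<in> carrier (M 0)" "x \<otimes> X 0 = \<zero>" for x
    proof -
      have "x = x \<otimes> (X 0 \<otimes> S 0)" using in_carrierD[OF M] that by (simp add: homotopy_0)
      also have "\<dots> = \<zero>"
        using that in_carrierD(1)[OF M[OF le0]] by (simp add: m_assoc[symmetric])
      finally show ?thesis .
    qed
    then show ?thesis
      using 0 k zero_in_carrier[OF M] by (auto simp: module_zero[OF M])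
  next
    case (Suc l)
    have Ml: "represents (M l) l" using k Suc by (intro M) auto
    have "x \<in> (\<lambda>x. x \<otimes> X l) ` carrier (M l)" if "x \<in> carrier (M k)" "x \<otimes> X k = \<zero>" for x
    proof -
      have x: "x \<in> carrier R" using in_carrierD[OF Mk] that by auto
      have "x = x \<otimes> (X k \<otimes> S k \<oplus> S l \<otimes> X l)"
        using in_carrierD[OF Mk] that unfolding Suc homotopy_Suc by simp
      also have "\<dots> = x \<otimes> S l \<otimes> X l"
        using x that by (simp add: r_distr m_assoc[symmetric])
      finally show ?thesis
        using transports_carrier[OF transports_S Mk[unfolded Suc] Ml] that Suc by blast
    qed
    moreover have "x \<otimes> X l \<in> carrier (M k)" "x \<otimes> X l \<otimes> X k = \<zero>" if "x \<in> carrier (M l)" for x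
      using that transports_carrier[OF transports_X Ml Mk[unfolded Suc]] in_carrierD[OF Ml]
      by (simp_all add: Suc m_assoc X_X)
    ultimately show ?thesis using Suc by auto
  qed
  ultimately show "(if k = 0 then {\<zero>\<^bsub>M 0\<^esub>} else (\<lambda>x. x \<otimes> X (k - 1)) ` carrier (M (k - 1)))
      = (if k < n then {x \<in> carrier (M k). x \<otimes> X k = \<zero>\<^bsub>M (Suc k)\<^esub>} else carrier (M n))"
    by simp
qed

text \<open>Each component of the target receives one or two terms, as for a map of the form X + S;
  \<open>P\<close> marks the components with two.\<close>

lemma graded_hom_direct_sum:
  assumes M: "\<And>a. a \<in> I \<Longrightarrow> represents (M a) (m a)" and L: "\<And>b. b \<in> J \<Longrightarrow> represents (L b) (l b)"
    and f: "\<And>b. b \<in> J \<Longrightarrow> f1 b \<in> I \<and> transports (c1 b) (m (f1 b)) (l b)"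
    and g: "\<And>b. b \<in> J \<Longrightarrow> P b \<Longrightarrow> f2 b \<in> I \<and> transports (c2 b) (m (f2 b)) (l b)"
  shows "(\<lambda>x. \<lambda>b\<in>J. x (f1 b) \<otimes> c1 b \<oplus> (if P b then x (f2 b) \<otimes> c2 b else \<zero>))
    \<in> graded_hom R (gdirect_sum I M) (gdirect_sum J L)" (is "?F \<in> _")
proof -
  have t1: "x (f1 b) \<otimes> c1 b \<in> carrier (L b)" if "x \<in> (\<Pi>\<^sub>E a\<in>I. carrier (M a))" "b \<in> J" for x b
    using f that M L by (intro transports_carrier[of _ "m (f1 b)" "l b" "M (f1 b)"]) (auto intro: PiE_mem)
  have t2: "x (f2 b) \<otimes> c2 b \<in> carrier (L b)" if "x \<in> (\<Pi>\<^sub>E a\<in>I. carrier (M a))" "b \<in> J" "P b" for x b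
    using g that M L by (intro transports_carrier[of _ "m (f2 b)" "l b" "M (f2 b)"]) (auto intro: PiE_mem)
  have cl: "x (f1 b) \<in> carrier R" "P b \<Longrightarrow> x (f2 b) \<in> carrier R"
    "x (f1 b) \<in> carrier (M (f1 b))" "P b \<Longrightarrow> x (f2 b) \<in> carrier (M (f2 b))"
    "c1 b \<in> carrier R" "P b \<Longrightarrow> c2 b \<in> carrier R"
    if x: "x \<in> (\<Pi>\<^sub>E a\<in>I. carrier (M a))" and b: "b \<in> J" for x b
    using f[OF b] g[OF b] in_carrierD(1)[OF M] PiE_mem[OF x] by (auto simp: transports_def)
  have inL: "?F x b \<in> carrier (L b)" if "x \<in> (\<Pi>\<^sub>E a\<in>I. carrier (M a))" "b \<in> J" for x b
    using that t1 t2 add_in_carrier[OF L] zero_in_carrier[OF L] by simp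
  show ?thesis
    unfolding graded_hom_def mem_Collect_eq
  proof (intro conjI ballI allI subsetI)
    show "?F \<in> carrier (gdirect_sum I M) \<rightarrow> carrier (gdirect_sum J L)"
      using inL by (auto simp: gdirect_sum_def)
  next
    fix x y assume xy: "x \<in> carrier (gdirect_sum I M)" "y \<in> carrier (gdirect_sum I M)"
    then have xy': "x \<in> (\<Pi>\<^sub>E a\<in>I. carrier (M a))" "y \<in> (\<Pi>\<^sub>E a\<in>I. carrier (M a))"
      by (auto simp: gdirect_sum_def)
    show "?F (x \<oplus>\<^bsub>gdirect_sum I M\<^esub> y) = ?F x \<oplus>\<^bsub>gdirect_sum J L\<^esub> ?F y"
      unfolding gdirect_sum_def ring.simps partial_object.simps monoid.simps
    proof (rule restrict_ext)
      fix b assume b: "b \<in> J"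
      note cx = cl[OF xy'(1) b] and cy = cl[OF xy'(2) b]
      have 1: "(\<lambda>k\<in>I. x k \<oplus>\<^bsub>M k\<^esub> y k) (f1 b) = x (f1 b) \<oplus> y (f1 b)"
        using f[OF b] module_add[OF M cx(3) cy(3)] by simp
      have 2: "(\<lambda>k\<in>I. x k \<oplus>\<^bsub>M k\<^esub> y k) (f2 b) = x (f2 b) \<oplus> y (f2 b)" if "P b"
        using g[OF b that] module_add[OF M cx(4) cy(4)] that by simp
      have "?F x b \<oplus>\<^bsub>L b\<^esub> ?F y b = ?F x b \<oplus> ?F y b"
        using inL xy' b by (intro module_add[OF L]) auto
      then show "(\<lambda>k\<in>I. x k \<oplus>\<^bsub>M k\<^esub> y k) (f1 b) \<otimes> c1 b \<oplus>
          (if P b then (\<lambda>k\<in>I. x k \<oplus>\<^bsub>M k\<^esub> y k) (f2 b) \<otimes> c2 b else \<zero>) = ?F x b \<oplus>\<^bsub>L b\<^esub> ?F y b"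
        using 1 2 cx cy b by (auto simp: l_distr a_ac)
    qed
  next
    fix a x assume a: "a \<in> carrier R" and x: "x \<in> carrier (gdirect_sum I M)"
    then have x': "x \<in> (\<Pi>\<^sub>E a\<in>I. carrier (M a))" by (auto simp: gdirect_sum_def)
    show "?F (a \<odot>\<^bsub>gdirect_sum I M\<^esub> x) = a \<odot>\<^bsub>gdirect_sum J L\<^esub> ?F x"
      unfolding gdirect_sum_def module.simps
    proof (rule restrict_ext)
      fix b assume b: "b \<in> J"
      note cx = cl[OF x' b]
      have 1: "(\<lambda>k\<in>I. a \<odot>\<^bsub>M k\<^esub> x k) (f1 b) = a \<otimes> x (f1 b)"
        using f[OF b] module_smult[OF M a cx(3)] by simp
      have 2: "(\<lambda>k\<in>I. a \<odot>\<^bsub>M k\<^esub> x k) (f2 b) = a \<otimes> x (f2 b)" if "P b"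
        using g[OF b that] module_smult[OF M a cx(4)] that by simp
      have "a \<odot>\<^bsub>L b\<^esub> ?F x b = a \<otimes> ?F x b"
        using inL x' b a by (intro module_smult[OF L]) auto
      then show "(\<lambda>k\<in>I. a \<odot>\<^bsub>M k\<^esub> x k) (f1 b) \<otimes> c1 b \<oplus>
          (if P b then (\<lambda>k\<in>I. a \<odot>\<^bsub>M k\<^esub> x k) (f2 b) \<otimes> c2 b else \<zero>) = a \<odot>\<^bsub>L b\<^esub> ?F x b"
        using 1 2 cx b a by (auto simp: r_distr m_assoc)
    qed
  next
    fix d \<epsilon> z assume "z \<in> ?F ` component (gdirect_sum I M) d \<epsilon>"
    then obtain x where z: "z = ?F x" and x: "x \<in> (\<Pi>\<^sub>E a\<in>I. component (M a) d \<epsilon>)"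
      by (auto simp: gdirect_sum_def)
    have "?F x b \<in> component (L b) d \<epsilon>" if b: "b \<in> J" for b
    proof -
      have "x (f1 b) \<otimes> c1 b \<in> component (L b) d \<epsilon>"
        using f[OF b] x M L b by (intro transports_component[of _ "m (f1 b)" "l b" "M (f1 b)"]) auto
      moreover have "x (f2 b) \<otimes> c2 b \<in> component (L b) d \<epsilon>" if "P b"
        using g[OF b that] x M L b by (intro transports_component[of _ "m (f2 b)" "l b" "M (f2 b)"]) auto
      ultimately show ?thesis
        using b add_in_carrier[OF L[OF b]] zero_in_carrier[OF L[OF b]]
        by (auto simp: module_component[OF L] hg_zero intro!: hg_add)
    qed
    then show "z \<in> component (gdirect_sum J L) d \<epsilon>"
      by (auto simp: z gdirect_sum_def)
  qed
qed

text \<open>Both directions are X + S, on the even and on the odd terms. The composites are X S + S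
  X, the identity, because X X and S S vanish. For either parity of \<open>n\<close> one of the two
  sums reaches the index \<open>n + 1\<close>, past the end of the complex, where X and S are
  zero.\<close>

lemma even_odd_iso:
  assumes M: "\<And>k. k \<in> {0..(n + 1) div 2} \<Longrightarrow> represents (M k) (2 * k)"
    and L: "\<And>k. k \<in> {0..n div 2} \<Longrightarrow> represents (L k) (2 * k + 1)"
    and X: "\<And>k. n \<le> k \<Longrightarrow> X k = \<zero>" and S: "\<And>k. n \<le> k \<Longrightarrow> S k = \<zero>"
  shows "graded_iso R (gdirect_sum {0..(n + 1) div 2} M) (gdirect_sum {0..n div 2} L)"
proof -
  let ?I = "{0..(n + 1) div 2}" and ?J = "{0..n div 2}"
  let ?F = "\<lambda>x. \<lambda>b\<in>?J. x b \<otimes> X (2 * b) \<oplus> (if Suc b \<in> ?I then x (Suc b) \<otimes> S (2 * b + 1) else \<zero>)"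
  \<comment> \<open>The first term must always be present in \<open>graded_hom_direct_sum\<close>:
    if \<open>a\<close> is not an index on the odd side, it is the term coming from
    \<open>a - 1\<close>.\<close>
  let ?G = "\<lambda>y. \<lambda>a\<in>?I. y (if a \<in> ?J then a else a - 1) \<otimes> (if a \<in> ?J then S (2 * a) else X (2 * a - 1))
    \<oplus> (if a \<in> ?J \<and> a \<noteq> 0 then y (a - 1) \<otimes> X (2 * a - 1) else \<zero>)"
  have F: "?F \<in> graded_hom R (gdirect_sum ?I M) (gdirect_sum ?J L)"
  proof (rule graded_hom_direct_sum[where m = "\<lambda>k. 2 * k" and l = "\<lambda>k. 2 * k + 1"])
    fix b assume "b \<in> ?J"
    then show "b \<in> ?I \<and> transports (X (2 * b)) (2 * b) (2 * b + 1)"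
      using transports_X[of "2 * b"] by auto
    show "Suc b \<in> ?I \<and> transports (S (2 * b + 1)) (2 * Suc b) (2 * b + 1)" if "Suc b \<in> ?I"
      using that transports_S[of "2 * b + 1"] by simp
  qed (use M L in auto)
  have G: "?G \<in> graded_hom R (gdirect_sum ?J L) (gdirect_sum ?I M)"
  proof (rule graded_hom_direct_sum[where m = "\<lambda>k. 2 * k + 1" and l = "\<lambda>k. 2 * k"])
    fix a assume a: "a \<in> ?I"
    have "a - 1 \<in> ?J" using a by auto
    moreover have "transports (X (2 * a - 1)) (2 * (a - 1) + 1) (2 * a)" if "a \<noteq> 0"
      using transports_X[of "2 * a - 1"] that by (cases a) auto
    ultimately show "(if a \<in> ?J then a else a - 1) \<in> ?J \<and>
        transports (if a \<in> ?J then S (2 * a) else X (2 * a - 1)) (2 * (if a \<in> ?J then a else a - 1) + 1) (2 * a)"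
      using transports_S[of "2 * a"] by (cases "a = 0") auto
    show "a - 1 \<in> ?J \<and> transports (X (2 * a - 1)) (2 * (a - 1) + 1) (2 * a)" if "a \<in> ?J \<and> a \<noteq> 0"
      using transports_X[of "2 * a - 1"] that by (cases a) auto
  qed (use M L in auto)
  have GF: "?G (?F x) = x" if x: "x \<in> carrier (gdirect_sum ?I M)" for x
  proof
    fix a
    have xe: "x \<in> extensional ?I" and xM: "\<And>a. a \<in> ?I \<Longrightarrow> x a \<in> carrier (M a)"
      using x by (auto simp: gdirect_sum_def PiE_def)
    have xR: "x a \<in> carrier R" and xid: "x a \<otimes> e (2 * a) = x a" if "a \<in> ?I" for a
      using in_carrierD[OF M[OF that]] xM[OF that] by auto
    show "?G (?F x) a = x a"
    proof (cases "a \<in> ?I")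
      case a: True
      have XS: "?F x a \<otimes> S (2 * a) = x a \<otimes> (X (2 * a) \<otimes> S (2 * a))" if "a \<in> ?J"
        using xR a that S_S[of "2 * a"] by (auto simp: l_distr m_assoc)
      have SX: "?F x b \<otimes> X (2 * a - 1) = x a \<otimes> (S (2 * b + 1) \<otimes> X (2 * b + 1))" if "a = Suc b" for b
      proof -
        have "b \<in> ?J" "b \<in> ?I" using a that by auto
        then show ?thesis
          using xR a that X_X[of "2 * b"] by (auto simp: l_distr m_assoc)
      qed
      have hom: "(X (2 * a) \<otimes> S (2 * a)) \<oplus> (S (2 * b + 1) \<otimes> X (2 * b + 1)) = e (2 * a)" if "a = Suc b" for b
        using homotopy_Suc[of "2 * b + 1"] that by simp
      consider "a \<in> ?J" "a = 0" | b where "a \<in> ?J" "a = Suc b" | b where "a \<notin> ?J" "a = Suc b"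
        by (cases a) auto
      then show ?thesis
      proof cases
        case 1
        then have "?G (?F x) a = ?F x a \<otimes> S (2 * a) \<oplus> \<zero>" using a by simp
        also have "\<dots> = x a \<otimes> e (2 * a)"
          unfolding XS[OF 1(1)] using 1 xR[OF a] homotopy_0 by simp
        finally show ?thesis using xid[OF a] by simp
      next
        case 2
        then have "?G (?F x) a = ?F x a \<otimes> S (2 * a) \<oplus> ?F x b \<otimes> X (2 * a - 1)" using a by simp
        also have "\<dots> = x a \<otimes> e (2 * a)"
          unfolding XS[OF 2(1)] SX[OF 2(2)] hom[OF 2(2), symmetric]
          using xR[OF a] by (simp add: r_distr)
        finally show ?thesis using xid[OF a] by simp
      next
        case 3
        then have "X (2 * a) = \<zero>" using a by (intro X) auto
        then have "S (2 * b + 1) \<otimes> X (2 * b + 1) = e (2 * a)"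
          using hom[OF 3(2)] by simp
        moreover have "?G (?F x) a = ?F x b \<otimes> X (2 * a - 1)" 
          using a 3 xR by auto
        ultimately show ?thesis
          unfolding SX[OF 3(2)] using xid[OF a] by simp
      qed
    next
      case False
      then show ?thesis using extensional_arb[OF xe False] by auto
    qed
  qed
  have FG: "?F (?G y) = y" if y: "y \<in> carrier (gdirect_sum ?J L)" for y
  proof
    fix b
    have ye: "y \<in> extensional ?J" and yL: "\<And>b. b \<in> ?J \<Longrightarrow> y b \<in> carrier (L b)"
      using y by (auto simp: gdirect_sum_def PiE_def)
    have yR: "y b \<in> carrier R" and yid: "y b \<otimes> e (2 * b + 1) = y b" if "b \<in> ?J" for b
      using in_carrierD[OF L[OF that]] yL[OF that] by auto
    show "?F (?G y) b = y b"
    proof (cases "b \<in> ?J")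
      case b: True
      then have bI: "b \<in> ?I" by auto
      have SX: "?G y b \<otimes> X (2 * b) = y b \<otimes> (S (2 * b) \<otimes> X (2 * b))"
      proof (cases b)
        case 0
        then show ?thesis using b bI yR by (simp add: l_distr m_assoc)
      next
        case (Suc a)
        then have "a \<in> ?J" using b by auto
        then show ?thesis
          using b bI yR Suc X_X[of "2 * a + 1"] by (simp add: l_distr m_assoc)
      qed
      have XS: "?G y (Suc b) \<otimes> S (2 * b + 1) = y b \<otimes> (X (2 * b + 1) \<otimes> S (2 * b + 1))" if "Suc b \<in> ?I"
        using b that yR S_S[of "2 * b + 1"] by (auto simp: l_distr m_assoc)
      have hom: "S (2 * b) \<otimes> X (2 * b) \<oplus> X (2 * b + 1) \<otimes> S (2 * b + 1) = e (2 * b + 1)"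
        using homotopy_Suc[of "2 * b"] by (simp add: a_comm)
      show ?thesis
      proof (cases "Suc b \<in> ?I")
        case True
        then have "?F (?G y) b = ?G y b \<otimes> X (2 * b) \<oplus> ?G y (Suc b) \<otimes> S (2 * b + 1)"
          using b by simp
        also have "\<dots> = y b \<otimes> e (2 * b + 1)"
          unfolding SX XS[OF True] hom[symmetric] using yR[OF b] by (simp add: r_distr)
        finally show ?thesis using yid[OF b] by simp
      next
        case False
        then have "X (2 * b + 1) = \<zero>" using b by (intro X) auto
        then have "S (2 * b) \<otimes> X (2 * b) = e (2 * b + 1)"
          using hom by simp
        moreover have "?F (?G y) b = ?G y b \<otimes> X (2 * b) \<oplus> \<zero>" using b False by simp
        ultimately show ?thesis unfolding SX using yid[OF b] yR[OF b] by simp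
      qed
    next
      case False
      then show ?thesis using extensional_arb[OF ye False] by auto
    qed
  qed
  show ?thesis
    unfolding graded_iso_def
    by (rule bexI[OF _ F], rule bexI[OF _ G]) (use GF FG in blast)
qed

end


section \<open>The product of all quotients of a ring\<close>

text \<open>A quotient ring by an ideal that depends on parameters is not a type. The product of all
  quotients of a ring is one, and the quotient by \<open>I\<close> is cut out of it by the central idempotent
  \<open>component_unit I\<close>; thus relations modulo \<open>I\<close> become equations between elements of a type of class
  \<^class>\<open>ring_1\<close>.\<close>

definition two_sided :: "'a::ring_1 set \<Rightarrow> bool" where
  "two_sided J \<longleftrightarrow> 0 \<in> J \<and> (\<forall>a\<in>J. \<forall>b\<in>J. a - b \<in> J) \<and> (\<forall>a\<in>J. \<forall>r. r * a \<in> J \<and> a * r \<in> J)"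

context
  fixes J :: "'a::ring_1 set" assumes J: "two_sided J"
begin

lemma two_sided_zero: "0 \<in> J"
  and two_sided_diff: "a \<in> J \<Longrightarrow> b \<in> J \<Longrightarrow> a - b \<in> J"
  and two_sided_mult_left: "a \<in> J \<Longrightarrow> r * a \<in> J"
  and two_sided_mult_right: "a \<in> J \<Longrightarrow> a * r \<in> J"
  using J by (auto simp: two_sided_def)

lemma two_sided_uminus: "a \<in> J \<Longrightarrow> - a \<in> J"
  using two_sided_diff[OF two_sided_zero] by force

lemma two_sided_add: "a \<in> J \<Longrightarrow> b \<in> J \<Longrightarrow> a + b \<in> J"
  using two_sided_diff[of a "- b"] two_sided_uminus by force

lemma two_sided_diff_diff: "a - a' \<in> J \<Longrightarrow> b - b' \<in> J \<Longrightarrow> (a - b) - (a' - b') \<in> J"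
  using two_sided_diff[of "a - a'" "b - b'"] by (simp add: algebra_simps)

lemma two_sided_add_diff: "a - a' \<in> J \<Longrightarrow> b - b' \<in> J \<Longrightarrow> (a + b) - (a' + b') \<in> J"
  using two_sided_add[of "a - a'" "b - b'"] by (simp add: algebra_simps)

lemma two_sided_mult_diff: "a - a' \<in> J \<Longrightarrow> b - b' \<in> J \<Longrightarrow> a * b - a' * b' \<in> J"
  using two_sided_add[OF two_sided_mult_right[of "a - a'" b] two_sided_mult_left[of "b - b'" a']]
  by (simp add: algebra_simps)

end

quotient_type (overloaded) 'a allquot = "'a::ring_1 set \<Rightarrow> 'a" /
  "\<lambda>f g. \<forall>J. two_sided J \<longrightarrow> f J - g J \<in> J"
proof (rule equivpI)
  show "reflp (\<lambda>f g :: 'a set \<Rightarrow> 'a. \<forall>J. two_sided J \<longrightarrow> f J - g J \<in> J)"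
    by (auto simp: reflp_def two_sided_zero)
  show "symp (\<lambda>f g :: 'a set \<Rightarrow> 'a. \<forall>J. two_sided J \<longrightarrow> f J - g J \<in> J)"
    by (auto simp: symp_def) (metis minus_diff_eq two_sided_uminus)
  show "transp (\<lambda>f g :: 'a set \<Rightarrow> 'a. \<forall>J. two_sided J \<longrightarrow> f J - g J \<in> J)"
    by (auto simp: transp_def) (metis diff_add_cancel add_diff_eq two_sided_add)
qed

instantiation allquot :: (ring_1) ring_1
begin

lift_definition zero_allquot :: "'a allquot" is "\<lambda>_. 0" .
lift_definition one_allquot :: "'a allquot" is "\<lambda>_. 1" .

lift_definition plus_allquot :: "'a allquot \<Rightarrow> 'a allquot \<Rightarrow> 'a allquot" is "\<lambda>f g J. f J + g J"
  by (simp add: two_sided_add_diff)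

lift_definition minus_allquot :: "'a allquot \<Rightarrow> 'a allquot \<Rightarrow> 'a allquot" is "\<lambda>f g J. f J - g J"
  by (simp add: two_sided_diff_diff)

lift_definition uminus_allquot :: "'a allquot \<Rightarrow> 'a allquot" is "\<lambda>f J. - f J"
  by (metis minus_diff_minus two_sided_uminus)

lift_definition times_allquot :: "'a allquot \<Rightarrow> 'a allquot \<Rightarrow> 'a allquot" is "\<lambda>f g J. f J * g J"
  by (simp add: two_sided_mult_diff)

instance
proof
  show "(0 :: 'a allquot) \<noteq> 1"
  proof transfer
    \<comment> \<open>At the zero ideal the component is the ring itself. A single quotient may be
      the zero ring, which the class \<open>ring_1\<close> excludes; the product of all of them
      never is.\<close>
    have "two_sided {0 :: 'a}" by (simp add: two_sided_def)
    then show "\<not> (\<forall>J :: 'a set. two_sided J \<longrightarrow> 0 - 1 \<in> J)" by force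
  qed
qed (transfer, simp add: algebra_simps two_sided_zero)+

end

lift_definition incl :: "'a::ring_1 \<Rightarrow> 'a allquot" is "\<lambda>x _. x" .

lift_definition component_unit :: "'a::ring_1 set \<Rightarrow> 'a allquot" is
  "\<lambda>I J. if J = I then 1 else 0" .

lemma incl_0 [simp]: "incl 0 = 0"
  by transfer (simp add: two_sided_zero)

lemma incl_1 [simp]: "incl 1 = 1"
  by transfer (simp add: two_sided_zero)

lemma incl_add [simp]: "incl (x + y) = incl x + incl y"
  by transfer (simp add: two_sided_zero)

lemma incl_diff [simp]: "incl (x - y) = incl x - incl y"
  by transfer (simp add: two_sided_zero)

lemma incl_uminus [simp]: "incl (- x) = - incl x"
  by transfer (simp add: two_sided_zero)

lemma incl_mult [simp]: "incl (x * y) = incl x * incl y"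
  by transfer (simp add: two_sided_zero)

lemma incl_power [simp]: "incl (x ^ n) = incl x ^ n"
  by (induction n) simp_all

lemma incl_of_nat [simp]: "incl (of_nat n) = of_nat n"
  by (induction n) simp_all

lemma incl_sum [simp]: "incl (sum f A) = (\<Sum>a\<in>A. incl (f a))"
  by (induction A rule: infinite_finite_induct) simp_all

lemma component_unit_commute: "component_unit I * a = a * component_unit I"
  by transfer (auto simp: two_sided_zero)

lemma component_unit_idem: "component_unit I * component_unit I = component_unit I"
  by transfer (auto simp: two_sided_zero)

lemma component_unit_eq_0: "two_sided I \<Longrightarrow> component_unit I * incl x = 0 \<longleftrightarrow> x \<in> I"
  by transfer (auto simp: two_sided_zero)


section \<open>Quotients of free algebras\<close>

text \<open>The retraction onto the span of the words over \<open>A\<close>; it makes membership in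
  the subalgebra an equation.\<close>

lift_definition restr :: "'g set \<Rightarrow> ('g, 'k::field) ncpoly \<Rightarrow> ('g, 'k) ncpoly" is
  "\<lambda>A f w. if w \<in> lists A then f w else 0"
  by (rule finite_subset) auto

lemma restr_add: "restr A (f + g) = restr A f + restr A g"
  by (rule poly_mapping_eqI) (transfer, simp add: lookup_add)

lemma restr_diff: "restr A (f - g) = restr A f - restr A g"
  by (rule poly_mapping_eqI) (transfer, simp add: lookup_minus)

lemma restr_0: "restr A 0 = 0"
  by (rule poly_mapping_eqI) (transfer, simp)

text \<open>A concatenation is a word over \<open>A\<close> exactly if both parts are, so the
  remaining words span a two-sided ideal, the kernel.\<close>

lemma restr_mult: "restr A (f * g) = restr A f * restr A g"
proof (rule poly_mapping_eqI)
  fix k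
  have "poly_mapping.lookup (restr A f) l * (\<Sum>q. poly_mapping.lookup (restr A g) q when k = l + q)
      = (if k \<in> lists A then poly_mapping.lookup f l * (\<Sum>q. poly_mapping.lookup g q when k = l + q) else 0)" for l
  proof (cases "k \<in> lists A \<and> l \<in> lists A")
    case True
    then have "(poly_mapping.lookup (restr A g) q when k = l + q) = (poly_mapping.lookup g q when k = l + q)" for q
      by (auto simp: restr.rep_eq when_def plus_list_def)
    then show ?thesis using True by (simp add: restr.rep_eq)
  next
    case False
    then have "k \<noteq> l + q" if "k \<in> lists A" for q
      using that by (auto simp: plus_list_def)
    moreover have "poly_mapping.lookup (restr A f) l * (\<Sum>q. poly_mapping.lookup (restr A g) q when k = l + q) = 0"
    proof (cases "l \<in> lists A")
      case True
      then have "(poly_mapping.lookup (restr A g) q when k = l + q) = 0" for q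
        using False by (auto simp: restr.rep_eq when_def plus_list_def)
      then show ?thesis by simp
    qed (simp add: restr.rep_eq)
    ultimately show ?thesis by auto
  qed
  then show "poly_mapping.lookup (restr A (f * g)) k = poly_mapping.lookup (restr A f * restr A g) k"
    by (simp add: lookup_mult restr.rep_eq[of A "f * g"])
qed

lemma free_alg_simps [simp]:
  "mult (free_alg A) = (*)" "one (free_alg A) = 1" "zero (free_alg A) = 0" "add (free_alg A) = (+)"
  by (simp_all add: free_alg_def)

lemma carrier_free_alg: "x \<in> carrier (free_alg A) \<longleftrightarrow> restr A x = x"
proof -
  have "restr A x = x \<longleftrightarrow> (\<forall>w. w \<notin> lists A \<longrightarrow> poly_mapping.lookup x w = 0)"
    by (auto simp: poly_mapping_eq_iff fun_eq_iff restr.rep_eq)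
  then show ?thesis by (auto simp: free_alg_def in_keys_iff)
qed

lemma restr_in_carrier: "restr A x \<in> carrier (free_alg A)"
  by (auto simp: free_alg_def in_keys_iff restr.rep_eq split: if_splits)

context
  fixes A :: "'g set"
begin

lemma free_alg_closed [simp, intro]:
  fixes x y :: "('g, 'k::field) ncpoly"
  shows "x \<in> carrier (free_alg A) \<Longrightarrow> y \<in> carrier (free_alg A) \<Longrightarrow> x + y \<in> carrier (free_alg A)"
    and "x \<in> carrier (free_alg A) \<Longrightarrow> y \<in> carrier (free_alg A) \<Longrightarrow> x - y \<in> carrier (free_alg A)"
    and "x \<in> carrier (free_alg A) \<Longrightarrow> y \<in> carrier (free_alg A) \<Longrightarrow> x * y \<in> carrier (free_alg A)"
    and "0 \<in> carrier (free_alg A)"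
  by (simp_all add: carrier_free_alg restr_add restr_diff restr_mult restr_0)

lemma free_alg_closed' [simp, intro]:
  fixes x y :: "('g, 'k::field) ncpoly"
  shows "1 \<in> carrier (free_alg A)"
    and "g \<in> A \<Longrightarrow> letter g \<in> carrier (free_alg A)"
    and "scalar c \<in> carrier (free_alg A)"
  by (auto simp: free_alg_def letter_def scalar_def zero_list_def)

lemma free_alg_uminus_closed [simp, intro]:
  fixes x :: "('g, 'k::field) ncpoly"
  shows "x \<in> carrier (free_alg A) \<Longrightarrow> - x \<in> carrier (free_alg A)"
  using free_alg_closed(2)[OF free_alg_closed(4), of x] by simp

lemma free_alg_power_closed [simp, intro]:
  fixes x :: "('g, 'k::field) ncpoly"
  shows "x \<in> carrier (free_alg A) \<Longrightarrow> x ^ n \<in> carrier (free_alg A)"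
  by (induction n) auto

lemma free_alg_sum_closed [simp, intro]:
  fixes f :: "'i \<Rightarrow> ('g, 'k::field) ncpoly"
  shows "(\<And>i. i \<in> I \<Longrightarrow> f i \<in> carrier (free_alg A)) \<Longrightarrow> sum f I \<in> carrier (free_alg A)"
  by (induction I rule: infinite_finite_induct) auto

lemma free_alg_of_nat_closed [simp, intro]:
  "(of_nat n :: ('g, 'k::field) ncpoly) \<in> carrier (free_alg A)"
  by (induction n) auto

lemma ring_free_alg: "ring (free_alg A :: (('g, 'k::field) ncpoly) ring)"
proof (intro ringI abelian_groupI monoidI)
  fix x :: "('g, 'k) ncpoly" assume "x \<in> carrier (free_alg A)"
  then show "\<exists>y\<in>carrier (free_alg A). y \<oplus>\<^bsub>free_alg A\<^esub> x = \<zero>\<^bsub>free_alg A\<^esub>"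
    by (intro bexI[of _ "- x"]) auto
qed (auto simp: algebra_simps)

end

lemma free_alg_mono: "A \<subseteq> B \<Longrightarrow> x \<in> carrier (free_alg A) \<Longrightarrow> x \<in> carrier (free_alg B)"
  using lists_mono[of A B] by (auto simp: free_alg_def)

text \<open>The preimage of \<open>I\<close> under the retraction: a two-sided ideal of the whole
  type that meets the subalgebra in \<open>I\<close>, which gives access to
  \<open>component_unit\<close>.\<close>

definition extended_ideal :: "'g set \<Rightarrow> ('g, 'k::field) ncpoly set \<Rightarrow> ('g, 'k) ncpoly set" where
  "extended_ideal A I = {x. restr A x \<in> I}"

context
  fixes A :: "'g set" and I :: "('g, 'k::field) ncpoly set"
  assumes I: "ideal I (free_alg A)"
begin

lemma ideal_free_alg:
  shows "0 \<in> I" and "x \<in> I \<Longrightarrow> y \<in> I \<Longrightarrow> x - y \<in> I"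
    and "x \<in> I \<Longrightarrow> r \<in> carrier (free_alg A) \<Longrightarrow> r * x \<in> I"
    and "x \<in> I \<Longrightarrow> r \<in> carrier (free_alg A) \<Longrightarrow> x * r \<in> I"
proof -
  interpret ideal I "free_alg A" by (rule I)
  show "0 \<in> I" using additive_subgroup.zero_closed[OF is_additive_subgroup] by simp
  show l: "r * x \<in> I" if "x \<in> I" "r \<in> carrier (free_alg A)" for x r
    using I_l_closed[OF that] by simp
  show "x * r \<in> I" if "x \<in> I" "r \<in> carrier (free_alg A)" for x r
    using I_r_closed[OF that] by simp
  show "x - y \<in> I" if "x \<in> I" "y \<in> I" for x y
  proof -
    have "(- 1) * y \<in> I" using that by (intro l) auto
    then show ?thesis using additive_subgroup.a_closed[OF is_additive_subgroup, of x "- y"] that by simp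
  qed
qed

lemma two_sided_extended_ideal: "two_sided (extended_ideal A I)"
  using ideal_free_alg(1,2) ideal_free_alg(3,4)[OF _ restr_in_carrier]
  by (auto simp: two_sided_def extended_ideal_def restr_0 restr_diff restr_mult)

lemma component_unit_ideal:
  "x \<in> carrier (free_alg A) \<Longrightarrow>
    component_unit (extended_ideal A I) * incl x = 0 \<longleftrightarrow> x \<in> I"
  using component_unit_eq_0[OF two_sided_extended_ideal, of x]
  by (simp add: extended_ideal_def carrier_free_alg)

lemma coset_eq_iff:
  assumes "x \<in> carrier (free_alg A)" "y \<in> carrier (free_alg A)"
  shows "I +>\<^bsub>free_alg A\<^esub> x = I +>\<^bsub>free_alg A\<^esub> y \<longleftrightarrow>
    component_unit (extended_ideal A I) * incl x = component_unit (extended_ideal A I) * incl y"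
proof -
  interpret ideal I "free_alg A" by (rule I)
  have "x \<ominus>\<^bsub>free_alg A\<^esub> y = x - y"
  proof -
    have "\<ominus>\<^bsub>free_alg A\<^esub> y = - y"
      using assms minus_equality[of "- y" y] by simp
    then show ?thesis by (simp add: a_minus_def)
  qed
  then have "I +>\<^bsub>free_alg A\<^esub> x = I +>\<^bsub>free_alg A\<^esub> y \<longleftrightarrow> x - y \<in> I"
    using quotient_eq_iff_same_a_r_cos[OF I assms] by simp
  also have "\<dots> \<longleftrightarrow> component_unit (extended_ideal A I) * incl (x - y) = 0"
    using assms by (subst component_unit_ideal) auto
  finally show ?thesis by (simp add: right_diff_distrib)
qed

end


section \<open>Root data\<close>

context spin_datum
begin

lemma aut_verts_in: "v \<in> verts (quiver D) \<Longrightarrow> aut_verts D v \<in> verts (quiver D)"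
  using bij_betwE[OF bij_verts] by blast

lemma finite_verts: "finite (verts (quiver D))" and finite_arcs: "finite (arcs (quiver D))"
  using fin_digraph.finite_verts[OF fin_quiver] fin_digraph.finite_arcs[OF fin_quiver] by simp_all

lemma vorb_subset: "v \<in> verts (quiver D) \<Longrightarrow> vorb D v \<subseteq> verts (quiver D)"
proof
  fix u assume v: "v \<in> verts (quiver D)" and "u \<in> vorb D v"
  from this(2) show "u \<in> verts (quiver D)"
    unfolding vorb_def by induction (auto simp: v aut_verts_in)
qed

text \<open>An \<open>orbit\<close> starts at the image of its point, so the point itself belongs to
  it only because a permutation of a finite set has finite order. The automorphism is extended by
  the identity to become such a permutation.\<close>

lemma self_in_vorb: "v \<in> verts (quiver D) \<Longrightarrow> v \<in> vorb D v"
proof -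
  assume v: "v \<in> verts (quiver D)"
  let ?g = "\<lambda>x. if x \<in> verts (quiver D) then aut_verts D x else x"
  have "bij_betw ?g (verts (quiver D)) (verts (quiver D))"
    by (rule iffD2[OF bij_betw_cong bij_verts]) simp
  then have "?g permutes verts (quiver D)"
    by (rule bij_imp_permutes) simp
  then have "permutation ?g" by (rule permutes_imp_permutation[OF finite_verts])
  then have "v \<in> orbit ?g v" by (rule permutation_self_in_orbit)
  moreover have "u \<in> verts (quiver D) \<and> u \<in> vorb D v" if "u \<in> orbit ?g v" for u
    using that by induction (auto simp: v vorb_def aut_verts_in intro: orbit.intros)
  ultimately show ?thesis by simp
qed

lemma finite_vorb: "v \<in> verts (quiver D) \<Longrightarrow> finite (vorb D v)"
  by (rule finite_subset[OF vorb_subset finite_verts])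

lemma orbsize_pos: "v \<in> verts (quiver D) \<Longrightarrow> 0 < orbsize D v"
  using self_in_vorb finite_vorb by (auto simp: orbsize_def card_gt_0_iff)

lemma vorb_disjoint:
  assumes "i \<in> reps D" "j \<in> reps D" "i \<noteq> j"
  shows "vorb D i \<inter> vorb D j = {}"
proof (rule ccontr)
  assume "vorb D i \<inter> vorb D j \<noteq> {}"
  then obtain v where v: "v \<in> vorb D i" "v \<in> vorb D j" by blast
  then have "v \<in> verts (quiver D)" using assms reps_subset vorb_subset by blast
  then show False using reps_unique[of v] v assms by blast
qed

definition joining :: "'v \<Rightarrow> 'v \<Rightarrow> 'e set" where
  "joining i j = {h \<in> arcs (quiver D).
     (tail (quiver D) h \<in> vorb D i \<and> head (quiver D) h \<in> vorb D j) \<or>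
     (tail (quiver D) h \<in> vorb D j \<and> head (quiver D) h \<in> vorb D i)}"

lemma joining_commute: "joining i j = joining j i"
  by (auto simp: joining_def)

lemma finite_joining: "finite (joining i j)"
  using finite_arcs by (auto simp: joining_def)

text \<open>The two orbits are disjoint, so each edge has exactly one endpoint in the orbit of i;
  the automorphism makes the fibres over these endpoints equally large.\<close>

lemma orbsize_dvd_joining:
  assumes ij: "i \<in> reps D" "j \<in> reps D" "i \<noteq> j"
  shows "orbsize D i dvd card (joining i j)"
proof -
  let ?T = "tail (quiver D)" and ?H = "head (quiver D)"
  define fib where "fib v = {h \<in> joining i j. ?T h = v \<or> ?H h = v}" for v
  have disj: "vorb D i \<inter> vorb D j = {}" by (rule vorb_disjoint[OF ij])
  have i: "i \<in> verts (quiver D)" using ij reps_subset by auto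
  have fin: "finite (fib v)" for v unfolding fib_def using finite_joining by simp
  \<comment> \<open>Injectivity gives an inequality for one step; going once around the orbit turns
    it into an equality.\<close>
  have step: "card (fib v) \<le> card (fib (aut_verts D v))" for v
  proof (rule card_inj_on_le[of "aut_arcs D"])
    show "inj_on (aut_arcs D) (fib v)"
      using bij_arcs by (rule inj_on_subset[OF bij_betw_imp_inj_on]) (auto simp: fib_def joining_def)
    have "aut_arcs D h \<in> arcs (quiver D)" if "h \<in> arcs (quiver D)" for h
      using bij_betwE[OF bij_arcs] that by blast
    then show "aut_arcs D ` fib v \<subseteq> fib (aut_verts D v)"
      by (auto simp: fib_def joining_def aut_tail aut_head vorb_def intro: orbit.step)
  qed (rule fin)
  have le: "card (fib v) \<le> card (fib u)" if "u \<in> vorb D v" for u v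
    using that unfolding vorb_def by induction (auto intro: step order_trans)
  have eq: "card (fib v) = card (fib i)" if "v \<in> vorb D i" for v
  proof -
    have "i \<in> vorb D v"
      using orbit_swap[of i "aut_verts D" v] self_in_vorb[OF i] that by (simp add: vorb_def)
    then show ?thesis using le that by (simp add: le_antisym)
  qed
  have "joining i j = (\<Union>v\<in>vorb D i. fib v)"
    by (auto simp: fib_def joining_def)
  also have "card \<dots> = (\<Sum>v\<in>vorb D i. card (fib v))"
    using disj by (intro card_UN_disjoint finite_vorb i ballI fin) (auto simp: fib_def joining_def)
  also have "\<dots> = orbsize D i * card (fib i)"
    by (simp add: eq orbsize_def)
  finally show ?thesis by simp
qed

lemma form_joining: "i \<noteq> j \<Longrightarrow> form D i j = - int (card (joining i j))"
  by (simp add: form_def joining_def)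

lemma form_self: "form D i i = 2 * int (orbsize D i)"
  by (simp add: form_def)

lemma form_commute: "form D i j = form D j i"
  by (cases "i = j") (simp_all add: form_joining joining_commute)

lemma mlcm_commute: "mlcm D i j = mlcm D j i"
  by (simp add: mlcm_def lcm.commute)

section \<open>The exponents in \<Q> and the Cartan integers\<close>

definition qexp :: "'v \<Rightarrow> 'v \<Rightarrow> nat" where
  "qexp i j = nat (mlcm D i j div form D i i)"

definition mexp :: "'v \<Rightarrow> 'v \<Rightarrow> nat" where
  "mexp i j = nat (- 2 * form D i j div mlcm D i j)"

lemma mexp_commute: "mexp i j = mexp j i"
  by (simp add: mexp_def form_commute[of i j] mlcm_commute[of i j])

lemma QQ_eq:
  fixes u v :: "'a::ring_1"
  shows "i \<noteq> j \<Longrightarrow> QQ D i j u v = (- 1) ^ dnum D i j * (u ^ qexp i j - v ^ qexp j i) ^ mexp i j"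
  by (simp add: QQ_def qexp_def mexp_def mlcm_commute[of j i])

context
  fixes i j assumes ij: "i \<in> reps D" "j \<in> reps D" "i \<noteq> j"
begin

lemma orbsizes_pos: "0 < orbsize D i" "0 < orbsize D j"
  using ij reps_subset by (auto intro: orbsize_pos)

lemma orbsize_qexp: "2 * int (orbsize D i) * int (qexp i j) = mlcm D i j"
proof -
  have "form D i i dvd mlcm D i j" "0 < form D i i" "0 \<le> mlcm D i j"
    using orbsizes_pos by (simp_all add: mlcm_def form_self)
  then show ?thesis by (simp add: qexp_def form_self pos_imp_zdiv_nonneg_iff)
qed

lemma mlcm_pos: "0 < mlcm D i j"
proof -
  have "mlcm D i j \<noteq> 0" using orbsizes_pos by (simp add: mlcm_def form_self)
  moreover have "0 \<le> mlcm D i j" by (simp add: mlcm_def)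
  ultimately show ?thesis by linarith
qed

lemma qexp_pos: "0 < qexp i j"
  using orbsize_qexp mlcm_pos by (cases "qexp i j") auto

lemma mlcm_mexp: "mlcm D i j * int (mexp i j) = 2 * int (card (joining i j))"
proof -
  have "mlcm D i j dvd 2 * int (card (joining i j))"
    unfolding mlcm_def form_self
    using orbsize_dvd_joining[OF ij] orbsize_dvd_joining[OF ij(2,1)] ij(3)
    by (intro lcm_least mult_dvd_mono) (auto simp: joining_commute[of j i])
  then show ?thesis
    using mlcm_pos ij(3) by (simp add: mexp_def form_joining pos_imp_zdiv_nonneg_iff)
qed

lemma orbsize_qexp_mexp: "orbsize D i * (qexp i j * mexp i j) = card (joining i j)"
proof -
  have "2 * int (card (joining i j)) = 2 * int (orbsize D i) * int (qexp i j) * int (mexp i j)"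
    by (simp only: mlcm_mexp[symmetric] orbsize_qexp[symmetric])
  then have "int (orbsize D i * (qexp i j * mexp i j)) = int (card (joining i j))"
    by (simp add: mult.assoc)
  then show ?thesis by (simp only: of_nat_eq_iff)
qed

text \<open>This is the degree of \<Q> in its first variable, up to sign, and links the length of
  the complex to the number of dots.\<close>

lemma cartan_eq: "cartan D i j = - int (qexp i j * mexp i j)"
proof -
  have "form D i j = int (orbsize D i) * - int (qexp i j * mexp i j)"
    unfolding form_joining[OF ij(3)] orbsize_qexp_mexp[symmetric] by simp
  then show ?thesis
    unfolding cartan_def using orbsizes_pos by (simp only: nonzero_mult_div_cancel_left of_nat_eq_0_iff)
qed

text \<open>\<open>orbsize D i * qexp i j\<close> is half of the least common multiple, hence
  symmetric in i and j; if it is odd, both factors on the side of j are odd. The Cartan integer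
  being even, \<open>mexp i j\<close> must then be even.\<close>

lemma odd_orbsize:
  assumes "odd (orbsize D i)"
  shows "even (qexp i j * mexp i j)"
    and "odd (qexp i j) \<Longrightarrow> even (mexp i j) \<and> odd (orbsize D j) \<and> odd (qexp j i)"
proof -
  show *: "even (qexp i j * mexp i j)"
    using odd_row[OF ij(1,2) assms] unfolding cartan_eq by simp
  assume q: "odd (qexp i j)"
  have "2 * int (orbsize D j) * int (qexp j i) = mlcm D j i"
  proof -
    have "form D j j dvd mlcm D j i" "0 < form D j j" "0 \<le> mlcm D j i"
      using orbsizes_pos by (simp_all add: mlcm_def form_self)
    then show ?thesis by (simp add: qexp_def form_self pos_imp_zdiv_nonneg_iff)
  qed
  then have "2 * (int (orbsize D i) * int (qexp i j)) = 2 * (int (orbsize D j) * int (qexp j i))"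
    using orbsize_qexp mlcm_commute[of i j] by simp
  then have "int (orbsize D i * qexp i j) = int (orbsize D j * qexp j i)"
    by simp
  then have "orbsize D i * qexp i j = orbsize D j * qexp j i"
    by (simp only: of_nat_eq_iff)
  moreover have "odd (orbsize D i * qexp i j)" using assms q by simp
  ultimately show "even (mexp i j) \<and> odd (orbsize D j) \<and> odd (qexp j i)"
    using * q by auto
qed

end

end


section \<open>The quotient in the deformed braid relation\<close>

lemma skew_power:
  fixes u v :: "'a::ring_1"
  assumes uv: "u * v = \<sigma> * (v * u)" and \<sigma>: "\<sigma> = 1 \<or> \<sigma> = - 1"
  shows "u ^ m * v ^ n = \<sigma> ^ (m * n) * (v ^ n * u ^ m)"
proof -
  have cm: "a * (\<sigma> ^ l * b) = \<sigma> ^ l * (a * b)" for a b l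
    using \<sigma> by (induction l) (auto simp: mult.assoc)
  have 1: "u * v ^ n = \<sigma> ^ n * (v ^ n * u)" for n
  proof (induction n)
    case (Suc n)
    have "u * v ^ Suc n = u * v * v ^ n" by (simp only: power_Suc mult.assoc)
    also have "\<dots> = \<sigma> * (v * (u * v ^ n))" by (simp only: uv mult.assoc)
    also have "\<dots> = \<sigma> * (\<sigma> ^ n * (v * (v ^ n * u)))" by (simp only: Suc cm)
    finally show ?case by (simp only: power_Suc mult.assoc)
  qed simp
  show ?thesis
  proof (induction m)
    case (Suc m)
    have "u ^ Suc m * v ^ n = u * (u ^ m * v ^ n)" by (simp only: power_Suc mult.assoc)
    also have "\<dots> = \<sigma> ^ (m * n) * (u * v ^ n * u ^ m)" by (simp only: Suc cm mult.assoc)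
    also have "\<dots> = \<sigma> ^ (m * n) * (\<sigma> ^ n * (v ^ n * u ^ Suc m))"
      by (simp only: 1 power_Suc mult.assoc)
    also have "\<dots> = \<sigma> ^ (m * n + n) * (v ^ n * u ^ Suc m)"
      by (simp only: power_add mult.assoc)
    finally show ?case by (simp only: mult_Suc add.commute)
  qed simp
qed

text \<open>For odd \<open>p\<close> the powers \<open>u ^ p\<close> and \<open>v ^ q\<close>
  anticommute, so the mixed terms of the square of their difference cancel. In both cases only even
  powers of \<open>u\<close> remain, as a division by a difference of squares requires.\<close>

lemma skew_normal_form:
  fixes u v :: "'a::ring_1"
  assumes uv: "u * v = \<sigma> * (v * u)"
    and c: "even p \<or> even m \<and> odd q \<and> \<sigma> = - 1"
  shows "(u ^ p - v ^ q) ^ m = (u ^ (2 * (if even p then p div 2 else p)) + (if even p then - 1 else 1) *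
    v ^ (if even p then q else 2 * q)) ^ (if even p then m else m div 2)"
proof (cases "even p")
  case False
  then have c': "even m" "odd q" "\<sigma> = - 1" using c by auto
  have "u ^ p * v ^ q = \<sigma> ^ (p * q) * (v ^ q * u ^ p)"
    using c' by (intro skew_power[OF uv]) auto
  then have "u ^ p * v ^ q = - (v ^ q * u ^ p)" using c' False by simp
  then have "(u ^ p - v ^ q) ^ 2 = u ^ (2 * p) + v ^ (2 * q)"
    by (simp add: power2_eq_square algebra_simps power_add[symmetric] mult_2_right)
  moreover have "(u ^ p - v ^ q) ^ m = ((u ^ p - v ^ q) ^ 2) ^ (m div 2)"
    using c' by (simp add: power_mult[symmetric])
  ultimately show ?thesis using False by simp
qed simp

lemma incl_qdiff: "incl (qdiff g p q m \<kappa> u w v) = qdiff g p q m (incl \<kappa>) (incl u) (incl w) (incl v)"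
  by (simp add: qdiff_def)

lemma incl_QQ: "incl (QQ D i j u v) = QQ D i j (incl u) (incl v)"
  by (simp add: QQ_def)

context
  fixes c :: "'a::ring_1"
  assumes central: "\<And>a. c * a = a * c" and idem: "c * c = c"
begin

lemma corner_hom: "(c * x) * (c * z) = c * (x * z)"
proof -
  have "(c * x) * (c * z) = c * (x * c) * z" by (simp only: mult.assoc)
  also have "\<dots> = c * c * (x * z)" by (simp only: central[of x, symmetric] mult.assoc)
  finally show ?thesis by (simp only: idem)
qed

text \<open>The unit \<open>c\<close> of the corner is not the unit of the type, so an equation in
  the corner reads \<open>c * a = c * a'\<close>; such congruences are compatible with the ring
  operations.\<close>

lemma corner_mult: "c * a = c * a' \<Longrightarrow> c * b = c * b' \<Longrightarrow> c * (a * b) = c * (a' * b')"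
  by (simp add: corner_hom[symmetric])

lemma corner_power: "c * a = c * a' \<Longrightarrow> c * a ^ n = c * a' ^ n"
  by (induction n) (auto intro: corner_mult)

lemma corner_diff: "c * a = c * a' \<Longrightarrow> c * b = c * b' \<Longrightarrow> c * (a - b) = c * (a' - b')"
  by (simp add: right_diff_distrib)

lemma corner_sum: "(\<And>i. i \<in> A \<Longrightarrow> c * f i = c * g i) \<Longrightarrow> c * sum f A = c * sum g A"
  by (simp add: sum_distrib_left)

lemma corner_self: "c * (c * a) = c * a"
  by (simp add: mult.assoc[symmetric] idem)

lemma corner_qdiff:
  "c * a = c * a' \<Longrightarrow> c * b = c * b' \<Longrightarrow> c * d = c * d' \<Longrightarrow>
    c * qdiff g p q m \<kappa> a b d = c * qdiff g p q m \<kappa> a' b' d'"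
  unfolding qdiff_def by (intro corner_sum corner_mult corner_power refl)

end

context spin_datum
begin

definition dot_power :: "'v \<Rightarrow> nat" where
  "dot_power i = (if par D i = 0 then 1 else 2)"

text \<open>For odd i the parameters are those of \<open>skew_normal_form\<close>, and the outer
  variables enter through their squares.\<close>

definition braid_quotient :: "'v \<Rightarrow> 'v \<Rightarrow> 'a::ring_1 \<Rightarrow> 'a \<Rightarrow> 'a \<Rightarrow> 'a" where
  "braid_quotient i j u w v = (- 1) ^ dnum D i j *
     (let p = qexp i j; q = qexp j i; m = mexp i j in
      if par D i = 0 then qdiff 1 p q m (- 1) u w v
      else qdiff 2 (if even p then p div 2 else p) (if even p then q else 2 * q)
        (if even p then m else m div 2) (if even p then - 1 else 1) u w v)"

lemma par_cases: "par D i = 0 \<and> even (orbsize D i) \<or> par D i = 1 \<and> odd (orbsize D i)"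
  by (auto simp: par_def)

lemma braid_quotient_mult:
  fixes u v w :: "'a::ring_1"
  assumes ij: "i \<in> reps D" "j \<in> reps D" "i \<noteq> j"
    and uw: "u * w = (- 1) ^ (par D i * par D i) * (w * u)"
    and uv: "u * v = (- 1) ^ (par D i * par D j) * (v * u)"
    and wv: "w * v = (- 1) ^ (par D i * par D j) * (v * w)"
  shows "(u ^ dot_power i - w ^ dot_power i) * braid_quotient i j u w v
    = QQ D i j u v - QQ D i j w v"
proof -
  let ?p = "qexp i j" and ?q = "qexp j i" and ?m = "mexp i j" and ?\<delta> = "(- 1 :: 'a) ^ dnum D i j"
  have \<delta>: "a * (?\<delta> * b) = ?\<delta> * (a * b)" for a b
    by (cases "even (dnum D i j)") auto
  show ?thesis
  proof (cases "par D i = 0")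
    case True
    have "(u ^ 1 - w ^ 1) * qdiff 1 ?p ?q ?m (- 1) u w v
        = (u ^ (1 * ?p) + (- 1) * v ^ ?q) ^ ?m - (w ^ (1 * ?p) + (- 1) * v ^ ?q) ^ ?m"
      using skew_power[OF uv, of 1 ?q] skew_power[OF wv, of 1 ?q] uw True
      by (intro qdiff_mult) auto
    then show ?thesis
      using True by (simp add: dot_power_def braid_quotient_def Let_def \<delta> QQ_eq[OF ij(3)] right_diff_distrib)
  next
    case False
    then have odd: "par D i = 1" "odd (orbsize D i)" using par_cases[of i] by auto
    let ?p' = "if even ?p then ?p div 2 else ?p" and ?q' = "if even ?p then ?q else 2 * ?q"
      and ?m' = "if even ?p then ?m else ?m div 2" and ?\<kappa> = "if even ?p then - 1 else 1 :: 'a"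
      and ?\<sigma> = "(- 1 :: 'a) ^ (par D i * par D j)"
    have \<sigma>: "?\<sigma> = 1 \<or> ?\<sigma> = - 1" by (cases "even (par D i * par D j)") auto
    have c: "even ?p \<or> even ?m \<and> odd ?q \<and> ?\<sigma> = - 1"
      using odd_orbsize(2)[OF ij odd(2)] odd par_cases[of j] by auto
    have even2: "x ^ 2 * z ^ n = z ^ n * x ^ 2" if "x * z = \<tau> * (z * x)" "\<tau> = 1 \<or> \<tau> = - 1" for x z \<tau> :: 'a and n
      using skew_power[OF that, of 2 n] that(2) by (auto simp: power_mult)
    have "(u ^ 2 - w ^ 2) * qdiff 2 ?p' ?q' ?m' ?\<kappa> u w v
        = (u ^ (2 * ?p') + ?\<kappa> * v ^ ?q') ^ ?m' - (w ^ (2 * ?p') + ?\<kappa> * v ^ ?q') ^ ?m'"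
    proof (rule qdiff_mult)
      show "?\<kappa> = 1 \<or> ?\<kappa> = - 1" by simp
      show "u ^ 2 * w ^ 2 = w ^ 2 * u ^ 2"
        using odd by (intro even2[OF uw]) auto
      show "u ^ 2 * v ^ ?q' = v ^ ?q' * u ^ 2" by (rule even2[OF uv \<sigma>])
      show "w ^ 2 * v ^ ?q' = v ^ ?q' * w ^ 2" by (rule even2[OF wv \<sigma>])
    qed
    also have "\<dots> = (u ^ ?p - v ^ ?q) ^ ?m - (w ^ ?p - v ^ ?q) ^ ?m"
      unfolding skew_normal_form[OF uv c] skew_normal_form[OF wv c] ..
    finally have "(u ^ 2 - w ^ 2) * (?\<delta> * qdiff 2 ?p' ?q' ?m' ?\<kappa> u w v)
        = ?\<delta> * (u ^ ?p - v ^ ?q) ^ ?m - ?\<delta> * (w ^ ?p - v ^ ?q) ^ ?m"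
      by (simp only: \<delta> right_diff_distrib)
    then show ?thesis
      using odd by (simp only: dot_power_def braid_quotient_def Let_def QQ_eq[OF ij(3)]) simp
  qed
qed

lemma incl_braid_quotient:
  "incl (braid_quotient i j u w v) = braid_quotient i j (incl u) (incl w) (incl v)"
  by (simp add: braid_quotient_def Let_def incl_qdiff)

lemma corner_braid_quotient:
  assumes "\<And>a. c * a = a * c" "c * c = c" "c * a = c * a'" "c * b = c * b'" "c * d = c * d'"
  shows "c * braid_quotient i j a b d = c * braid_quotient i j a' b' d'"
proof (cases "par D i = 0")
  case True
  then show ?thesis
    unfolding braid_quotient_def Let_def if_P[OF True]
    by (intro corner_mult[OF assms(1,2)] corner_qdiff[OF assms(1,2)] refl assms(3-))
next
  case False
  then show ?thesis
    unfolding braid_quotient_def Let_def if_not_P[OF False]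
    by (intro corner_mult[OF assms(1,2)] corner_qdiff[OF assms(1,2)] refl assms(3-))
qed

lemma corner_QQ:
  assumes "i \<noteq> j" "\<And>a. c * a = a * c" "c * c = c" "c * a = c * a'" "c * b = c * b'"
  shows "c * QQ D i j a b = c * QQ D i j a' b'"
  using assms(4,5) unfolding QQ_eq[OF assms(1)]
  by (intro corner_mult[OF assms(2,3)] corner_power[OF assms(2,3)] corner_diff[OF assms(2,3)] refl)

lemma QQ_closed:
  "u \<in> carrier (free_alg A) \<Longrightarrow> v \<in> carrier (free_alg A) \<Longrightarrow> QQ D i j u v \<in> carrier (free_alg A)"
  unfolding QQ_def by (simp split: if_split)

lemma braid_quotient_closed:
  "u \<in> carrier (free_alg A) \<Longrightarrow> v \<in> carrier (free_alg A) \<Longrightarrow> w \<in> carrier (free_alg A) \<Longrightarrow>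
    braid_quotient i j u w v \<in> carrier (free_alg A)"
  unfolding braid_quotient_def Let_def qdiff_def by (simp split: if_split)

text \<open>The deformed braid relation is imposed for every quotient \<open>F\<close>, so one
  explicit \<open>F\<close> is enough. The identity is verified modulo \<open>skew_ideal\<close>,
  where the dots commute up to the prescribed signs.\<close>

lemma skew_quotient_braid:
  assumes ij: "i \<in> reps D" "j \<in> reps D" "i \<noteq> j"
    and r: "r + 2 < length is" "is ! r = i" "is ! Suc r = j" "is ! (r + 2) = i"
  shows "skew_quotient D is (QQ_diff D is r) (yy (r + 2) ^ dot_power i - yy r ^ dot_power i)
    (braid_quotient i j (yy (r + 2)) (yy r) (yy (Suc r)) :: ('v gen, 'k::field) ncpoly)"
proof -
  let ?A = "Dot ` {r. r < length is} :: 'v gen set" and ?I = "skew_ideal D is :: ('v gen, 'k) ncpoly set"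
  let ?rel = "\<lambda>a b. yy a * yy b - (- 1) ^ (par D (is ! a) * par D (is ! b)) * (yy b * yy a)
    :: ('v gen, 'k) ncpoly"
  let ?S = "{?rel a b |a b. a < length is \<and> b < length is \<and> a \<noteq> b}"
  have S: "?S \<subseteq> carrier (free_alg ?A)" by auto
  have I: "ideal ?I (free_alg ?A)"
    unfolding skew_ideal_def by (rule ring.genideal_ideal[OF ring_free_alg S])
  define c where "c = component_unit (extended_ideal ?A ?I)"
  note cc = component_unit_commute[of "extended_ideal ?A ?I", folded c_def]
    component_unit_idem[of "extended_ideal ?A ?I", folded c_def]
  note corner = corner_mult[OF cc] corner_power[OF cc] corner_diff[OF cc]
    corner_QQ[OF ij(3) cc] corner_braid_quotient[OF cc] corner_self[OF cc]
  \<comment> \<open>The factor \<open>c\<close> turns the relations of the skew polynomial ring into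
    equations between the \<open>U a\<close>.\<close>
  define U where "U a = c * incl (yy a :: ('v gen, 'k) ncpoly)" for a
  have cU: "c * U a = c * incl (yy a)" for a unfolding U_def by (rule corner_self[OF cc])
  have U: "U a * U b = (- 1) ^ (par D (is ! a) * par D (is ! b)) * (U b * U a)"
    if "a < length is" "b < length is" "a \<noteq> b" for a b
  proof -
    have "?rel a b \<in> ?I"
      unfolding skew_ideal_def using that ring.genideal_self[OF ring_free_alg S] by blast
    then have "c * incl (?rel a b) = 0"
      unfolding c_def using S that by (subst component_unit_ideal[OF I]) auto
    then have 0: "c * (incl (yy a) * incl (yy b))
        = c * ((- 1) ^ (par D (is ! a) * par D (is ! b)) * (incl (yy b) * incl (yy a)))"
      by (simp add: right_diff_distrib)
    have 1: "U a * U b = c * (incl (yy a) * incl (yy b))" for a b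
      unfolding U_def by (rule corner_hom[OF cc])
    show ?thesis unfolding 1 0
      by (cases "even (par D (is ! a) * par D (is ! b))") simp_all
  qed
  let ?F = "braid_quotient i j (yy (r + 2)) (yy r) (yy (Suc r)) :: ('v gen, 'k) ncpoly"
  let ?B = "yy (r + 2) ^ dot_power i - yy r ^ dot_power i :: ('v gen, 'k) ncpoly"
  have yc: "(yy a :: ('v gen, 'k) ncpoly) \<in> carrier (free_alg ?A)" if "a < length is" for a
    using that by auto
  have F: "?F \<in> carrier (free_alg ?A)"
    using r by (intro braid_quotient_closed yc) auto
  have A: "QQ_diff D is r \<in> carrier (free_alg ?A)"
    unfolding QQ_diff_def using r by (intro free_alg_closed QQ_closed yc) auto
  have "c * incl (?B * ?F) = c * ((U (r + 2) ^ dot_power i - U r ^ dot_power i)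
      * braid_quotient i j (U (r + 2)) (U r) (U (Suc r)))"
    unfolding incl_mult incl_diff incl_power incl_braid_quotient
    by (intro corner cU[symmetric])
  also have "(U (r + 2) ^ dot_power i - U r ^ dot_power i)
      * braid_quotient i j (U (r + 2)) (U r) (U (Suc r))
      = QQ D i j (U (r + 2)) (U (Suc r)) - QQ D i j (U r) (U (Suc r))"
    using r U[of "r + 2" r] U[of "r + 2" "Suc r"] U[of r "Suc r"]
    by (intro braid_quotient_mult[OF ij]) auto
  also have "c * \<dots> = c * incl (QQ_diff D is r)"
    unfolding QQ_diff_def incl_diff incl_QQ r(2,3) by (intro corner cU)
  finally have "c * incl (?B * ?F - QQ_diff D is r) = 0" by (simp add: right_diff_distrib)
  moreover have "?B * ?F - QQ_diff D is r \<in> carrier (free_alg ?A)"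
    using r by (intro free_alg_closed free_alg_power_closed F A yc) auto
  ultimately have "?B * ?F - QQ_diff D is r \<in> ?I"
    unfolding c_def by (subst (asm) component_unit_ideal[OF I])
  then show ?thesis using F by (simp add: skew_quotient_def)
qed

end


section \<open>Strands in the spin quiver Hecke algebra\<close>

lemma size_serre_weight [simp]: "size (serre_weight i j n) = Suc n"
  by (simp add: serre_weight_def)

lemma swap_at_seqs: "is \<in> seqs \<nu> \<Longrightarrow> Suc r < size \<nu> \<Longrightarrow> swap_at r is \<in> seqs \<nu>"
  by (auto simp: seqs_def swap_at_def mset_swap)

lemma (in spin_datum) klr_rels_carrier:
  "x \<in> klr_rels D \<nu> \<Longrightarrow> x \<in> carrier (free_alg (gens \<nu>) :: (('v gen, 'k::field) ncpoly) ring)"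
proof -
  have e: "ee is \<in> carrier (free_alg (gens \<nu>))" if "is \<in> seqs \<nu>" for "is"
    using that by (intro free_alg_closed') (simp add: gens_def)
  have y: "yy r \<in> carrier (free_alg (gens \<nu>))" if "r < size \<nu>" for r
    using that by (intro free_alg_closed') (simp add: gens_def)
  have t: "tt r \<in> carrier (free_alg (gens \<nu>))" if "Suc r < size \<nu>" for r
    using that by (intro free_alg_closed') (simp add: gens_def)
  have F: "f \<in> carrier (free_alg (gens \<nu>))"
    if "skew_quotient D is a b f" "is \<in> seqs \<nu>" for "is" and a b f :: "('v gen, 'k) ncpoly"
  proof -
    have "f \<in> carrier (free_alg (Dot ` {r. r < length is}))"
      using that by (simp add: skew_quotient_def)
    moreover have "length is = size \<nu>" using that by (auto simp: seqs_def)
    ultimately show ?thesis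
      by (elim free_alg_mono[rotated]) (auto simp: gens_def)
  qed
  assume "x \<in> klr_rels D \<nu>"
  then show ?thesis
    by cases (simp_all add: e y t F swap_at_seqs QQ_closed split: if_split)
qed

lemma (in spin_datum) ideal_klr_ideal:
  "ideal (klr_ideal D \<nu>) (free_alg (gens \<nu>) :: (('v gen, 'k::field) ncpoly) ring)"
  unfolding klr_ideal_def
  using klr_rels_carrier by (intro ring.genideal_ideal[OF ring_free_alg]) auto

lemma (in spin_datum) klr_rels_subset: "klr_rels D \<nu> \<subseteq> klr_ideal D \<nu>"
  unfolding klr_ideal_def
  using klr_rels_carrier by (intro ring.genideal_self[OF ring_free_alg]) auto

text \<open>The argument \<open>K\<close> names the coefficient field, which does not occur in the
  root data.\<close>

locale serre_setting = spin_datum D for D :: "('v, 'e) quiver_datum" +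
  fixes i j :: 'v and N :: nat and K :: "'k::field itself"
  assumes i: "i \<in> reps D" and j: "j \<in> reps D" and ij: "i \<noteq> j"
    and N: "int N = 1 - cartan D i j"
begin

lemmas reps_ij = i j ij

lemma N_pos: "0 < N" and exponents: "qexp i j * mexp i j = N - 1"
proof -
  have "int N = int (1 + qexp i j * mexp i j)"
    using N unfolding cartan_eq[OF reps_ij] by simp
  then have "N = 1 + qexp i j * mexp i j" by (simp only: of_nat_eq_iff)
  then show "0 < N" "qexp i j * mexp i j = N - 1" by simp_all
qed

abbreviation \<nu> :: "'v multiset" where
  "\<nu> \<equiv> serre_weight i j N"

definition unit :: "('v gen, 'k) ncpoly allquot" where
  "unit = component_unit (extended_ideal (gens \<nu>) (klr_ideal D \<nu>))"

definition img :: "('v gen, 'k) ncpoly \<Rightarrow> ('v gen, 'k) ncpoly allquot" where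
  "img x = unit * incl x"

definition sq :: "nat \<Rightarrow> 'v list" where
  "sq p = replicate p i @ [j] @ replicate (N - p) i"

abbreviation Y :: "nat \<Rightarrow> ('v gen, 'k) ncpoly allquot" where
  "Y r \<equiv> incl (yy r)"

abbreviation T :: "nat \<Rightarrow> ('v gen, 'k) ncpoly allquot" where
  "T r \<equiv> incl (tt r)"

definition E :: "nat \<Rightarrow> ('v gen, 'k) ncpoly allquot" where
  "E p = img (ee (sq p))"

lemma unit_commute: "unit * a = a * unit"
  and unit_idem: "unit * unit = unit"
  unfolding unit_def by (rule component_unit_commute, rule component_unit_idem)

lemmas img_hom = corner_hom[OF unit_commute unit_idem]

text \<open>A central idempotent is only needed in one factor. So dots and crossings may stay
  outside the corner, as \<open>Y\<close> and \<open>T\<close>; every element fixed by some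
  \<open>E p\<close> lies in it anyway.\<close>

lemma img_mult: "img (x * z) = incl x * img z"
proof -
  have "incl x * img z = incl x * unit * incl z" by (simp only: img_def mult.assoc)
  then show ?thesis by (simp only: img_def incl_mult unit_commute[of "incl x", symmetric] mult.assoc)
qed

lemma img_mult_img: "img x * img z = img (x * z)"
  by (simp add: img_def img_hom)

lemma sq_length [simp]: "p \<le> N \<Longrightarrow> length (sq p) = Suc N"
  by (simp add: sq_def)

lemma sq_seqs: "p \<le> N \<Longrightarrow> sq p \<in> seqs \<nu>"
  unfolding seqs_def mem_Collect_eq by (rule multiset_eqI) (simp add: sq_def serre_weight_def)

lemma sq_nth: "p \<le> N \<Longrightarrow> r \<le> N \<Longrightarrow> sq p ! r = (if r = p then j else i)"
  by (auto simp: sq_def nth_append nth_Cons')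

lemma swap_at_sq:
  assumes "p \<le> N" "r < N"
  shows "swap_at r (sq p) = sq (swp r p)"
proof (rule nth_equalityI)
  have "swp r p \<le> N" using assms by (auto simp: swp_def)
  then show "length (swap_at r (sq p)) = length (sq (swp r p))"
    using assms by (simp add: swap_at_def)
  fix s assume "s < length (swap_at r (sq p))"
  then have "s \<le> N" using assms by (simp add: swap_at_def)
  then show "swap_at r (sq p) ! s = sq (swp r p) ! s"
    using assms \<open>swp r p \<le> N\<close>
    by (auto simp: swap_at_def nth_list_update sq_nth) (auto simp: swp_def split: if_splits)
qed

lemma relation:
  assumes "a - b \<in> klr_rels D \<nu>"
  shows "img a = img b"
proof -
  have "a - b \<in> klr_ideal D \<nu>" using assms klr_rels_subset by auto
  then have "unit * incl (a - b) = 0"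
    unfolding unit_def using klr_rels_carrier[OF assms]
    by (subst component_unit_ideal[OF ideal_klr_ideal])
  then show ?thesis by (simp add: img_def right_diff_distrib)
qed

text \<open>The signs in a relation depend on the colours, which \<open>sq p\<close> fixes.
  Multiplication by \<open>x\<close> on the right gives the form in which \<open>strands\<close>
  states the relations.\<close>

lemma relation_E:
  assumes "a * ee (sq p) - b * ee (sq p) \<in> klr_rels D \<nu>"
  shows "E p * x = x \<Longrightarrow> incl a * x = incl b * x"
proof -
  assume x: "E p * x = x"
  have "incl a * E p = incl b * E p"
    using relation[OF assms] by (simp only: img_mult E_def)
  then have "incl a * (E p * x) = incl b * (E p * x)" by (simp only: mult.assoc[symmetric])
  then show ?thesis by (simp only: x)
qed

lemma E_idem: "p \<le> N \<Longrightarrow> E p * E p = E p"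
  using relation[of "ee (sq p) * ee (sq p)" "ee (sq p)"]
    klr_rels.idem_idem[of "sq p" \<nu> "sq p" D] sq_seqs[of p]
  by (simp add: E_def img_mult_img)

lemma par_par: "(- 1) ^ (par D i * par D i) = ((- 1) ^ par D i :: 'a::ring_1)"
  using par_cases[of i] by auto

sublocale strands N Y T E "(- 1) ^ par D i" 1
proof
  show "(- 1) ^ par D i = (1 :: ('v gen, 'k) ncpoly allquot) \<or> (- 1) ^ par D i = (- 1 :: ('v gen, 'k) ncpoly allquot)"
    using par_cases[of i] by auto
  show "(1 :: ('v gen, 'k) ncpoly allquot) = 1 \<or> (1 :: ('v gen, 'k) ncpoly allquot) = - 1" by simp
next
  fix p r x assume p: "p \<le> N" "r \<le> N" and x: "E p * x = x"
  have "img (yy r * ee (sq p)) = img (ee (sq p) * yy r)"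
    by (rule relation, rule klr_rels.dot_idem) (use p sq_seqs in auto)
  then have "Y r * E p = incl (ee (sq p)) * (unit * Y r)"
    by (simp only: img_mult E_def img_def[of "yy r"])
  also have "\<dots> = E p * Y r"
    by (simp only: E_def img_def mult.assoc[symmetric] unit_commute[of "incl (ee (sq p))"])
  finally have *: "Y r * E p = E p * Y r" .
  have "E p * (Y r * x) = Y r * (E p * x)"
    by (simp only: mult.assoc[symmetric] *)
  then show "E p * (Y r * x) = Y r * x" by (simp only: x)
next
  fix p r x assume p: "p \<le> N" "r < N" and x: "E p * x = x"
  have "img (tt r * ee (sq p)) = img (ee (sq (swp r p)) * tt r)"
    unfolding swap_at_sq[OF p, symmetric]
    by (rule relation, rule klr_rels.cross_idem) (use p sq_seqs in auto)
  then have "T r * E p = incl (ee (sq (swp r p))) * (unit * T r)"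
    by (simp only: img_mult E_def img_def[of "tt r"])
  also have "\<dots> = E (swp r p) * T r"
    by (simp only: E_def img_def mult.assoc[symmetric] unit_commute[of "incl (ee (sq (swp r p)))"])
  finally have *: "T r * E p = E (swp r p) * T r" .
  have "E (swp r p) * (T r * x) = T r * (E p * x)"
    by (simp only: mult.assoc[symmetric] *)
  then show "E (swp r p) * (T r * x) = T r * x" by (simp only: x)
next
  fix p r s x assume p: "p \<le> N" "r \<le> N" "s \<le> N" and x: "E p * x = x"
  have "Y r * (Y s * x) = (- 1) ^ (par D (sq p ! r) * par D (sq p ! s)) * (Y s * (Y r * x))" if "r \<noteq> s"
    using relation_E[OF _ x, of "yy r * yy s"
        "(- 1) ^ (par D (sq p ! r) * par D (sq p ! s)) * (yy s * yy r)"]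
      klr_rels.dot_dot[of "sq p" \<nu> r s D] p sq_seqs[of p] that
    by (simp add: mult.assoc)
  note 1 = this
  show "Y r * (Y s * x) =\<^sub>\<plusminus> Y s * (Y r * x)"
    by (cases "r = s") (simp_all add: 1 eqs_sign_mult)
  show "Y r * (Y s * x) = (- 1) ^ par D i * (Y s * (Y r * x))" if "r \<noteq> s" "r \<noteq> p" "s \<noteq> p"
    using 1 that p by (simp add: sq_nth par_par)
next
  fix p r s x assume p: "p \<le> N" "r < N" "s \<le> N" "s \<noteq> r" "s \<noteq> Suc r" and x: "E p * x = x"
  have "T r * (Y s * x) = (- 1) ^ (par D (sq p ! r) * par D (sq p ! Suc r) * par D (sq p ! s)) * (Y s * (T r * x))"
    using relation_E[OF _ x, of "tt r * yy s"
        "(- 1) ^ (par D (sq p ! r) * par D (sq p ! Suc r) * par D (sq p ! s)) * (yy s * tt r)"]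
      klr_rels.cross_dot_far[of "sq p" \<nu> r s D] p sq_seqs[of p]
    by (simp add: mult.assoc)
  then show "T r * (Y s * x) =\<^sub>\<plusminus> Y s * (T r * x)" by (simp add: eqs_sign_mult)
next
  fix p r s x assume p: "p \<le> N" "r < N" "s < N" "Suc r < s \<or> Suc s < r" and x: "E p * x = x"
  let ?n = "par D (sq p ! r) * par D (sq p ! Suc r) * par D (sq p ! s) * par D (sq p ! Suc s)"
  have "T r * (T s * x) = (- 1) ^ ?n * (T s * (T r * x))"
    using relation_E[OF _ x, of "tt r * tt s" "(- 1) ^ ?n * (tt s * tt r)"]
      klr_rels.cross_cross_far[of "sq p" \<nu> r s D] p sq_seqs[of p]
    by (simp add: mult.assoc)
  then show "T r * (T s * x) =\<^sub>\<plusminus> T s * (T r * x)" by (simp add: eqs_sign_mult)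
next
  fix p r x assume p: "p \<le> N" "r < N" "p \<noteq> r" "p \<noteq> Suc r" and x: "E p * x = x"
  show "T r * (T r * x) = 0"
    using relation_E[OF _ x, of "tt r * tt r" 0] klr_rels.cross_sq[of "sq p" \<nu> r D] p sq_seqs[of p]
    by (simp add: mult.assoc sq_nth QQ_def)
  show "T r * (Y (Suc r) * x) = (- 1) ^ par D i * (Y r * (T r * x)) + 1 * x"
    using relation_E[OF _ x, of "tt r * yy (Suc r)" "(- 1) ^ par D i * (yy r * tt r) + 1"]
      klr_rels.cross_dot[of "sq p" \<nu> r D] p sq_seqs[of p]
    by (simp add: mult.assoc sq_nth par_par distrib_right)
  have "Y (Suc r) * (T r * x) = (- 1) ^ par D i * (T r * (Y r * x)) + x"
    using relation_E[OF _ x, of "yy (Suc r) * tt r" "(- 1) ^ par D i * (tt r * yy r) + 1"]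
      klr_rels.dot_cross[of "sq p" \<nu> r D] p sq_seqs[of p]
    by (simp add: mult.assoc sq_nth par_par distrib_right)
  then show "T r * (Y r * x) = (- 1) ^ par D i * (Y (Suc r) * (T r * x)) - (- 1) ^ par D i * 1 * x"
    using par_cases[of i] by auto
next
  fix p r x assume p: "p \<le> N" "Suc r < N" "p \<noteq> Suc r" and x: "E p * x = x"
  have z: "T r * (T (Suc r) * (T r * x)) - T (Suc r) * (T r * (T (Suc r) * x)) = 0"
    if "braid_diff r * ee (sq p) - (0 :: ('v gen, 'k) ncpoly) * ee (sq p) \<in> klr_rels D \<nu>"
    using relation_E[OF that x] by (simp add: mult.assoc left_diff_distrib)
  have "braid_diff r * ee (sq p) - (0 :: ('v gen, 'k) ncpoly) * ee (sq p) \<in> klr_rels D \<nu>"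
  proof (cases "p = r \<or> p = r + 2")
    case True
    then show ?thesis
      using klr_rels.braid[of "sq p" \<nu> r D] p sq_seqs[of p] ij by (auto simp: sq_nth)
  next
    case False
    \<comment> \<open>All three strands have colour i and \<open>QQ D i i\<close> is zero, so
      \<open>F = 0\<close> is a legitimate quotient.\<close>
    have 0: "QQ_diff D (sq p) r = 0"
      using p False by (simp add: QQ_diff_def QQ_def sq_nth)
    have "0 \<in> skew_ideal D (sq p)"
    proof -
      have "ideal (skew_ideal D (sq p)) (free_alg (Dot ` {r. r < length (sq p)}))"
        unfolding skew_ideal_def by (rule ring.genideal_ideal[OF ring_free_alg]) auto
      then show ?thesis by (rule ideal_free_alg)
    qed
    then have "skew_quotient D (sq p) (QQ_diff D (sq p) r) b 0" for b
      by (simp add: skew_quotient_def 0)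
    then show ?thesis
      using klr_rels.braid_even[of "sq p" \<nu> r D 0] klr_rels.braid_odd[of "sq p" \<nu> r D 0]
        par_cases[of i] p False sq_seqs[of p] by (auto simp: sq_nth)
  qed
  then show "T r * (T (Suc r) * (T r * x)) = T (Suc r) * (T r * (T (Suc r) * x))"
    using z by simp
qed

lemma incl_dbar: "incl (dbar D i r) = db r"
  using par_cases[of i] by (auto simp: dbar_def db_def)

lemma incl_Db: "incl (prod_list (map (\<lambda>r. dbar D i (l + r)) [0..<n])) = Db l n"
  by (induction n) (simp_all add: incl_dbar)

lemma divpow_Suc:
  "divpow D i l (Suc n) = prod_list (map (\<lambda>r. dbar D i (l + r)) [0..<n]) * divpow D i l n"
proof (cases n)
  case (Suc m)
  then have "rev [1..<Suc n] = n # rev [1..<n]" by simp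
  then show ?thesis by (simp only: divpow_def list.map prod_list.Cons)
qed (simp add: divpow_def)

lemma incl_divpow: "incl (divpow D i l n) = Dv l n"
proof (induction n)
  case (Suc n)
  then show ?case by (simp only: divpow_Suc incl_mult incl_Db Dv.simps)
qed (simp add: divpow_def)

lemma img_serre_idem: "p \<le> N \<Longrightarrow> img (serre_idem D i j p (N - p)) = gidem p"
  by (simp add: serre_idem_def gidem_def img_mult E_def sq_def incl_divpow)

lemma eqs_power_sign_mult: "a =\<^sub>\<plusminus> b \<Longrightarrow> (- 1) ^ n * a =\<^sub>\<plusminus> b"
  using eqs_sign_mult eqs_trans by blast

section \<open>The homotopy identity at the two ends and in the middle\<close>

lemma homotopy_E_last:
  assumes "killed N x"
  shows "asc T N * (desc N T 1 * x) =\<^sub>\<plusminus> x"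
proof (rule homotopy_last)
  let ?Q = "QQ D i j (yy (N - 1)) (yy N) :: ('v gen, 'k) ncpoly"
  have "sq N ! (N - 1) = i" "sq N ! Suc (N - 1) = j" using N_pos by (auto simp: sq_nth)
  then have "T (N - 1) * (T (N - 1) * x) = incl ?Q * x"
    using relation_E[OF _ killed_E[OF assms], of "tt (N - 1) * tt (N - 1)" ?Q]
      klr_rels.cross_sq[of "sq N" \<nu> "N - 1" D] sq_seqs[of N] N_pos
    by (simp add: mult.assoc)
  also have "\<dots> =\<^sub>\<plusminus> (Y (N - 1) ^ qexp i j - Y N ^ qexp j i) ^ mexp i j * x"
    by (simp add: incl_QQ QQ_eq[OF ij] mult.assoc eqs_sign_mult)
  finally show "T (N - 1) * (T (N - 1) * x) =\<^sub>\<plusminus> (Y (N - 1) ^ qexp i j - Y N ^ qexp j i) ^ mexp i j * x" .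
qed (use assms N_pos exponents qexp_pos[OF reps_ij] in auto)

lemma homotopy_E_first:
  assumes "killed 0 x"
  shows "desc N T N * (asc T 1 * x) =\<^sub>\<plusminus> x"
proof (rule homotopy_first)
  let ?Q = "QQ D j i (yy 0) (yy 1) :: ('v gen, 'k) ncpoly"
  have "T 0 * (T 0 * x) = incl ?Q * x"
    using relation_E[OF _ killed_E[OF assms], of "tt 0 * tt 0" ?Q]
      klr_rels.cross_sq[of "sq 0" \<nu> 0 D] sq_seqs[of 0] N_pos
    by (simp add: mult.assoc sq_nth)
  also have "\<dots> =\<^sub>\<plusminus> (Y 0 ^ qexp j i - Y 1 ^ qexp i j) ^ mexp i j * x"
    using mexp_commute[of i j] by (simp add: incl_QQ QQ_eq[OF ij[symmetric]] mult.assoc eqs_sign_mult)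
  also have "(Y 0 ^ qexp j i - Y 1 ^ qexp i j) = - (Y 1 ^ qexp i j - Y 0 ^ qexp j i)"
    by simp
  also have "(- (Y 1 ^ qexp i j - Y 0 ^ qexp j i)) ^ mexp i j * x
      =\<^sub>\<plusminus> (Y 1 ^ qexp i j - Y 0 ^ qexp j i) ^ mexp i j * x"
    by (subst power_minus) (simp only: mult.assoc eqs_sign_mult)
  finally show "T 0 * (T 0 * x) =\<^sub>\<plusminus> (Y 1 ^ qexp i j - Y 0 ^ qexp j i) ^ mexp i j * x" .
qed (use assms N_pos exponents qexp_pos[OF reps_ij] in auto)

lemma homotopy_E_mid:
  assumes b: "0 < b" "b < N" and x: "killed b x"
  shows "\<exists>\<alpha> \<beta>. (\<alpha> = 1 \<or> \<alpha> = - 1) \<and> (\<beta> = 1 \<or> \<beta> = - 1) \<and>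
    x = \<alpha> * (asc T b * (desc N T (Suc (N - b)) * x)) + \<beta> * (desc N T (N - b) * (asc T (Suc b) * x))"
proof -
  let ?r = "b - 1" and ?q = "braid_quotient i j :: ('v gen, 'k) ncpoly \<Rightarrow> _ \<Rightarrow> _ \<Rightarrow> _"
  let ?F = "?q (yy (Suc b)) (yy (b - 1)) (yy b)"
  let ?G = "if par D i = 0 then ?F else (- 1) ^ par D j * ((yy (Suc b) - yy (b - 1)) * ?F)"
  have r: "Suc ?r = b" "?r + 2 = Suc b" using b by auto
  have sq: "sq b ! ?r = i" "sq b ! Suc ?r = j" "sq b ! (?r + 2) = i" "?r + 2 < length (sq b)"
    using b by (auto simp: sq_nth)
  note F = skew_quotient_braid[OF reps_ij sq(4,1,2,3), unfolded r]
  have "braid_diff ?r * ee (sq b) - ?G * ee (sq b) \<in> klr_rels D \<nu>"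
  proof (cases "par D i = 0")
    case True
    then show ?thesis
      using klr_rels.braid_even[of "sq b" \<nu> ?r D ?F] F sq b sq_seqs[of b]
      by (simp add: dot_power_def r)
  next
    case False
    then have "par D i = 1" using par_cases[of i] by auto
    then show ?thesis
      using klr_rels.braid_odd[of "sq b" \<nu> ?r D ?F] F sq b sq_seqs[of b]
      by (simp add: dot_power_def r mult.assoc)
  qed
  from relation_E[OF this killed_E[OF x]]
  have G: "T (b - 1) * (T b * (T (b - 1) * x)) - T b * (T (b - 1) * (T b * x)) = incl ?G * x"
    by (simp only: r incl_diff incl_mult left_diff_distrib mult.assoc)
  have "asc T (b - 1) * (desc N T (N - b - 1) * (incl ?G * x)) =\<^sub>\<plusminus> x"
  proof (cases "par D i = 0")
    case True
    have "incl ?G * x =\<^sub>\<plusminus> qdiff 1 (qexp i j) (qexp j i) (mexp i j) (- 1) (Y (Suc b)) (Y (b - 1)) (Y b) * x"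
      using True by (simp add: incl_braid_quotient) (simp add: braid_quotient_def Let_def mult.assoc eqs_sign_mult)
    then have "asc T (b - 1) * (desc N T (N - b - 1) * (incl ?G * x)) =\<^sub>\<plusminus>
        asc T (b - 1) * (desc N T (N - b - 1) *
          (qdiff 1 (qexp i j) (qexp j i) (mexp i j) (- 1) (Y (Suc b)) (Y (b - 1)) (Y b) * x))"
      by (intro eqs_mult_left)
    also have "\<dots> =\<^sub>\<plusminus> x"
      using b x exponents qexp_pos[OF reps_ij] by (intro homotopy_even)
    finally show ?thesis .
  next
    case False
    then have odd: "odd (orbsize D i)" using par_cases[of i] by auto
    let ?p = "qexp i j" and ?m = "mexp i j"
    let ?p' = "if even ?p then ?p div 2 else ?p" and ?q' = "if even ?p then qexp j i else 2 * qexp j i"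
      and ?m' = "if even ?p then ?m else ?m div 2"
      and ?\<kappa> = "if even ?p then - 1 else 1 :: ('v gen, 'k) ncpoly allquot"
    let ?H = "(Y (Suc b) - Y (b - 1)) * qdiff 2 ?p' ?q' ?m' ?\<kappa> (Y (Suc b)) (Y (b - 1)) (Y b)"
    have p': "0 < ?p'" using qexp_pos[OF reps_ij] by (auto elim: evenE)
    \<comment> \<open>If \<open>?p\<close> is odd, \<open>?m\<close> is even by
      \<open>odd_orbsize\<close>, so halving it is exact.\<close>
    have "2 * ?p' * ?m' = ?p * ?m"
      using odd_orbsize(2)[OF reps_ij odd] by auto
    then have pm: "2 * ?p' * ?m' = N - 1" using exponents by simp
    have "incl ?G * x =\<^sub>\<plusminus> ?H * x"
    proof -
      have s: "a * ((- 1) ^ n * c) = (- 1) ^ n * (a * c)" for a c :: "('v gen, 'k) ncpoly allquot" and n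
        by (cases "even n") auto
      have "incl ?G = (- 1) ^ par D j * ((- 1) ^ dnum D i j * ?H)"
        using False by (simp only: if_False incl_mult incl_power incl_uminus incl_1 incl_diff incl_braid_quotient)
          (simp only: braid_quotient_def Let_def if_False s[of "Y (Suc b) - Y (b - 1)"])
      then show ?thesis by (simp add: mult.assoc eqs_power_sign_mult eqs_sign_mult)
    qed
    then have "asc T (b - 1) * (desc N T (N - b - 1) * (incl ?G * x)) =\<^sub>\<plusminus>
        asc T (b - 1) * (desc N T (N - b - 1) * (?H * x))"
      by (intro eqs_mult_left)
    also have "\<dots> =\<^sub>\<plusminus> x"
      by (rule homotopy_odd[OF b x p' pm]) simp
    finally show ?thesis .
  qed
  from homotopy_mid[OF b x G this] show ?thesis .
qed

end


section \<open>Normalising the homotopy\<close>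

text \<open>The signs live in the product of quotients but have to be lifted to words of the free
  algebra; a power of - 1 makes sense in both.\<close>

lemma sign_exponent: "\<alpha> = 1 \<or> \<alpha> = - 1 \<Longrightarrow> \<exists>n. \<alpha> = (- 1 :: 'a::ring_1) ^ n"
  by (metis power_0 power_one_right)

text \<open>If \<open>e = \<plusminus> X Z \<plusminus> Z X\<close> for a complex \<open>X\<close>, then the signs can be absorbed in \<open>Z\<close> to give a
  contracting homotopy \<open>S'\<close>, and \<open>S' X S'\<close> is a contracting homotopy of square zero.\<close>

lemma normalised_homotopy:
  fixes e X Z :: "nat \<Rightarrow> 'a::ring_1"
  assumes eX: "\<And>k. k < n \<Longrightarrow> e k * X k = X k" and Xe: "\<And>k. k < n \<Longrightarrow> X k * e (Suc k) = X k"
    and eZ: "\<And>k. k < n \<Longrightarrow> e (Suc k) * Z k = Z k" and Ze: "\<And>k. k < n \<Longrightarrow> Z k * e k = Z k"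
    and XX: "\<And>k. Suc k < n \<Longrightarrow> X k * X (Suc k) = 0"
    and h: "\<And>k. k \<le> n \<Longrightarrow> \<exists>\<alpha> \<beta>. (\<alpha> = 1 \<or> \<alpha> = - 1) \<and> (\<beta> = 1 \<or> \<beta> = - 1) \<and>
      e k = (if k < n then \<alpha> * (X k * Z k) else 0) + (if 0 < k then \<beta> * (Z (k - 1) * X (k - 1)) else 0)"
  shows "\<exists>(a :: nat \<Rightarrow> nat) S.
    (\<forall>k. S k = (- 1) ^ a k * Z k * (X k * ((- 1) ^ a k * Z k))) \<and>
    (\<forall>k\<le>n. e k = (if k < n then X k * S k else 0) + (if 0 < k then S (k - 1) * X (k - 1) else 0)) \<and>
    (\<forall>k. Suc k < n \<longrightarrow> S (Suc k) * S k = 0)"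
proof -
  have "\<exists>a b. k \<le> n \<longrightarrow> e k = (if k < n then (- 1) ^ a * (X k * Z k) else 0)
      + (if 0 < k then (- 1) ^ b * (Z (k - 1) * X (k - 1)) else 0)" for k
    using h[of k] sign_exponent by metis
  then obtain a b where ab: "\<And>k. k \<le> n \<Longrightarrow> e k = (if k < n then (- 1) ^ a k * (X k * Z k) else 0)
      + (if 0 < k then (- 1) ^ b k * (Z (k - 1) * X (k - 1)) else 0)"
    by metis
  define Z' where "Z' k = (- 1) ^ a k * Z k" for k
  define S where "S k = Z' k * (X k * Z' k)" for k
  have sc: "x * ((- 1) ^ l * z) = (- 1) ^ l * (x * z)" for x z :: 'a and l
    by (cases "even l") auto
  have ss: "(- 1) ^ l * ((- 1) ^ l * z) = z" for z :: 'a and l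
    by (cases "even l") auto
  have eZ': "e (Suc k) * Z' k = Z' k" and Z'e: "Z' k * e k = Z' k" if "k < n" for k
    using eZ Ze that by (simp_all add: Z'_def sc[of "e (Suc k)"] mult.assoc)
  have ab': "e k = (if k < n then X k * Z' k else 0)
      + (if 0 < k then (- 1) ^ b k * (Z (k - 1) * X (k - 1)) else 0)" if "k \<le> n" for k
    using ab[OF that] by (simp add: Z'_def sc[of "X k"])
  have XZX: "X k * (Z' k * X k) = X k" if "k < n" for k
  proof -
    have "(if 0 < k then (- 1) ^ b k * (Z (k - 1) * X (k - 1)) else 0) * X k = 0"
      using XX[of "k - 1"] that by (auto simp: mult.assoc)
    then have "e k * X k = X k * Z' k * X k"
      using that unfolding ab'[OF less_imp_le[OF that]] by (simp add: distrib_right)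
    then show ?thesis using eX[OF that] by (simp add: mult.assoc)
  qed
  \<comment> \<open>The identities at \<open>k\<close> and at \<open>Suc k\<close>, multiplied by
    \<open>X k\<close>, express the same \<open>?W\<close> as a signed square of itself, with the
    signs given by \<open>a k\<close> and \<open>b (Suc k)\<close>. So the two signs agree on
    \<open>?W\<close>.\<close>
  have ZX: "(- 1) ^ b (Suc k) * (Z k * X k) = Z' k * X k" if k: "k < n" for k
  proof -
    let ?W = "Z k * X k"
    have "X k * (if Suc k < n then X (Suc k) * Z' (Suc k) else 0) = 0"
      using XX[of k] by (simp add: mult.assoc[symmetric])
    then have "X k * e (Suc k) = (- 1) ^ b (Suc k) * (X k * ?W)"
      using k ab'[of "Suc k"] by (simp add: distrib_left sc[of "X k"] Suc_leI)
    then have "X k = (- 1) ^ b (Suc k) * (X k * ?W)" using Xe[OF k] by simp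
    then have "Z k * X k = Z k * ((- 1) ^ b (Suc k) * (X k * ?W))" by simp
    then have 1: "?W = (- 1) ^ b (Suc k) * (?W * ?W)"
      by (simp add: sc[of "Z k"] mult.assoc)
    have "X k = (- 1) ^ a k * (X k * ?W)"
      using XZX[OF k] by (simp add: Z'_def mult.assoc sc[of "X k"])
    then have "Z k * X k = Z k * ((- 1) ^ a k * (X k * ?W))" by simp
    then have 2: "?W = (- 1) ^ a k * (?W * ?W)"
      by (simp add: sc[of "Z k"] mult.assoc)
    have "(- 1) ^ b (Suc k) * ?W = ?W * ?W"
      using ss[of "b (Suc k)" "?W * ?W"] 1 by simp
    also have "\<dots> = (- 1) ^ a k * ?W"
      using ss[of "a k" "?W * ?W"] 2 by simp
    finally show ?thesis by (simp add: Z'_def mult.assoc)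
  qed
  have hom: "e k = (if k < n then X k * Z' k else 0) + (if 0 < k then Z' (k - 1) * X (k - 1) else 0)"
    if "k \<le> n" for k
    using ab'[OF that] ZX[of "k - 1"] that by (cases k) auto
  have XS: "X k * S k = X k * Z' k" and SX: "S k * X k = Z' k * X k" if "k < n" for k
    using XZX[OF that] by (simp_all add: S_def mult.assoc) (simp add: mult.assoc[symmetric])
  show ?thesis
  proof (rule exI[of _ a], rule exI[of _ S], intro conjI allI impI)
    fix k
    show "S k = (- 1) ^ a k * Z k * (X k * ((- 1) ^ a k * Z k))"
      by (simp add: S_def Z'_def)
    show "e k = (if k < n then X k * S k else 0) + (if 0 < k then S (k - 1) * X (k - 1) else 0)"
      if "k \<le> n"
      using hom[OF that] XS[of k] SX[of "k - 1"] that by (cases k) auto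
    show "S (Suc k) * S k = 0" if k: "Suc k < n"
    proof -
      \<comment> \<open>\<open>Z' k * X k\<close> is idempotent, so its complement, which is
        produced by \<open>S (Suc k)\<close>, annihilates \<open>S k\<close>.\<close>
      have "X (Suc k) * Z' (Suc k) = e (Suc k) - Z' k * X k"
        using hom[of "Suc k"] k by simp
      then have "S (Suc k) * S k = Z' (Suc k) * ((e (Suc k) - Z' k * X k) * (Z' k * (X k * Z' k)))"
        by (simp add: S_def mult.assoc)
      also have "(e (Suc k) - Z' k * X k) * (Z' k * (X k * Z' k))
          = (e (Suc k) * Z' k) * (X k * Z' k) - Z' k * (X k * (Z' k * X k)) * Z' k"
        by (simp add: left_diff_distrib mult.assoc)
      also have "\<dots> = 0" using XZX[of k] eZ'[of k] k by (simp add: mult.assoc)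
      finally show ?thesis by simp
    qed
  qed
qed

context serre_setting
begin

abbreviation idem_word :: "nat \<Rightarrow> ('v gen, 'k) ncpoly" where
  "idem_word k \<equiv> serre_idem D i j (N - k) k"

text \<open>Homogeneity is a property of classes of elements of the free algebra, so the maps are
  given by words, while their identities are proved for the images under \<open>img\<close>. The
  index \<open>k\<close> counts the strands to the right of j, which is at position
  \<open>N - k\<close>.\<close>

definition diff_word :: "nat \<Rightarrow> ('v gen, 'k) ncpoly" where
  "diff_word k = asc tt (N - k) * idem_word (Suc k)"

definition back_word :: "nat \<Rightarrow> ('v gen, 'k) ncpoly" where
  "back_word k = desc N tt (Suc k) * idem_word k"

lemma incl_asc: "incl (asc f n) = asc (\<lambda>r. incl (f r)) n"
  by (induction n) simp_all

lemma img_idem_word: "k \<le> N \<Longrightarrow> img (idem_word k) = gidem (N - k)"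
  using img_serre_idem[of "N - k"] by simp

lemma img_diff_word: "k < N \<Longrightarrow> img (diff_word k) = asc T (N - k) * gidem (N - Suc k)"
  by (simp add: diff_word_def img_mult incl_asc img_idem_word del: asc.simps)

lemma img_back_word: "k < N \<Longrightarrow> img (back_word k) = desc N T (Suc k) * gidem (N - k)"
  by (simp add: back_word_def img_mult incl_asc img_idem_word del: asc.simps)

lemma killed_gidem': "p \<le> N \<Longrightarrow> killed p (gidem p)"
  by (intro killed_gidem E_idem)

lemma killed_diff: "k < N \<Longrightarrow> killed q x \<Longrightarrow> q = N - Suc k \<Longrightarrow> killed (N - k) (asc T (N - k) * x)"
  using killed_asc[of "N - Suc k" x] by (simp add: Suc_diff_Suc del: asc.simps)

lemma killed_back: "k < N \<Longrightarrow> killed q x \<Longrightarrow> q = N - k \<Longrightarrow> killed (N - Suc k) (desc N T (Suc k) * x)"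
  using killed_desc[of "N - k" x] by (simp add: del: asc.simps)

lemma idem_diff: "k < N \<Longrightarrow> img (idem_word k) * img (diff_word k) = img (diff_word k)"
  using gidem_fix[OF _ killed_diff[OF _ killed_gidem' refl], of k]
  by (simp add: img_idem_word img_diff_word del: asc.simps)

lemma diff_idem: "k < N \<Longrightarrow> img (diff_word k) * img (idem_word (Suc k)) = img (diff_word k)"
  by (simp add: img_idem_word img_diff_word gidem_fix killed_gidem' mult.assoc del: asc.simps)

lemma idem_back: "k < N \<Longrightarrow> img (idem_word (Suc k)) * img (back_word k) = img (back_word k)"
  using gidem_fix[OF _ killed_back[OF _ killed_gidem' refl], of k]
  by (simp add: img_idem_word img_back_word del: asc.simps)

lemma back_idem: "k < N \<Longrightarrow> img (back_word k) * img (idem_word k) = img (back_word k)"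
  by (simp add: img_idem_word img_back_word gidem_fix killed_gidem' mult.assoc del: asc.simps)

lemma diff_diff:
  assumes "Suc k < N"
  shows "img (diff_word k) * img (diff_word (Suc k)) = 0"
proof -
  let ?q = "N - Suc (Suc k)"
  have q: "N - k = Suc (Suc ?q)" "N - Suc k = Suc ?q" using assms by simp_all
  have "img (diff_word k) * img (diff_word (Suc k))
      = asc T (N - k) * (gidem (N - Suc k) * (asc T (N - Suc k) * gidem ?q))"
    using assms by (simp add: img_diff_word mult.assoc del: asc.simps)
  also have "gidem (N - Suc k) * (asc T (N - Suc k) * gidem ?q) = asc T (N - Suc k) * gidem ?q"
    using assms by (intro gidem_fix killed_diff[of _ ?q] killed_gidem') auto
  also have "asc T (N - k) * \<dots> = 0"
    unfolding q using assms killed_gidem'[of ?q] by (intro asc_asc_killed) auto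
  finally show ?thesis .
qed

lemma homotopy_words:
  assumes k: "k \<le> N"
  shows "\<exists>\<alpha> \<beta>. (\<alpha> = 1 \<or> \<alpha> = - 1) \<and> (\<beta> = 1 \<or> \<beta> = - 1) \<and> img (idem_word k) =
    (if k < N then \<alpha> * (img (diff_word k) * img (back_word k)) else 0) +
    (if 0 < k then \<beta> * (img (back_word (k - 1)) * img (diff_word (k - 1))) else 0)"
proof -
  let ?x = "gidem (N - k)"
  have x: "killed (N - k) ?x" by (rule killed_gidem') simp
  have DB: "img (diff_word k) * img (back_word k) = asc T (N - k) * (desc N T (Suc k) * ?x)" if "k < N"
    using that gidem_fix[OF _ killed_back[OF that x refl]]
    by (simp add: img_diff_word img_back_word mult.assoc del: asc.simps)
  have BD: "img (back_word (k - 1)) * img (diff_word (k - 1)) = desc N T k * (asc T (Suc (N - k)) * ?x)"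
    if "0 < k"
  proof -
    have "gidem (N - (k - 1)) * (asc T (N - (k - 1)) * ?x) = asc T (N - (k - 1)) * ?x"
      using that k x by (intro gidem_fix killed_diff[of _ "N - k"]) auto
    moreover have "N - (k - 1) = Suc (N - k)" "Suc (k - 1) = k" using that k by auto
    ultimately show ?thesis
      using that k by (simp add: img_diff_word img_back_word mult.assoc del: asc.simps)
  qed
  have pm: "\<exists>\<alpha>. (\<alpha> = 1 \<or> \<alpha> = - 1) \<and> z = \<alpha> * y" if "y =\<^sub>\<plusminus> z" for y z :: "('v gen, 'k) ncpoly allquot"
    using that unfolding eqs_def by (metis minus_minus mult_1 mult_minus1)
  consider "k = 0" | "k = N" | "0 < k" "k < N" using k by linarith
  then show ?thesis
  proof cases
    case 1
    have "asc T N * (desc N T 1 * gidem N) =\<^sub>\<plusminus> gidem N"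
      by (intro homotopy_E_last killed_gidem') simp
    then obtain \<alpha> where "\<alpha> = 1 \<or> \<alpha> = - 1" "gidem N = \<alpha> * (asc T N * (desc N T 1 * gidem N))"
      using pm by blast
    then show ?thesis
      using 1 DB N_pos img_idem_word[of 0] by (intro exI[of _ \<alpha>] exI[of _ 1]) simp
  next
    case 2
    have "desc N T N * (asc T 1 * gidem 0) =\<^sub>\<plusminus> gidem 0"
      by (intro homotopy_E_first killed_gidem') simp
    then obtain \<beta> where "\<beta> = 1 \<or> \<beta> = - 1" "gidem 0 = \<beta> * (desc N T N * (asc T 1 * gidem 0))"
      using pm by blast
    then show ?thesis
      using 2 BD N_pos img_idem_word[of N] by (intro exI[of _ 1] exI[of _ \<beta>]) simp
  next
    case 3
    then have "N - (N - k) = k" by simp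
    then show ?thesis
      using homotopy_E_mid[OF _ _ x] 3 DB BD by (simp add: img_idem_word del: asc.simps)
  qed
qed

end


section \<open>Homogeneous elements\<close>

context serre_setting
begin

abbreviation H :: "(('v gen, 'k) ncpoly set) ring" where
  "H \<equiv> klr D \<nu>"

abbreviation cls :: "('v gen, 'k) ncpoly \<Rightarrow> ('v gen, 'k) ncpoly set" where
  "cls \<equiv> klr_class D \<nu>"

abbreviation words :: "('v gen, 'k) ncpoly set" where
  "words \<equiv> carrier (free_alg (gens \<nu>))"

interpretation klr_ideal: ideal "klr_ideal D \<nu>" "free_alg (gens \<nu>) :: (('v gen, 'k) ncpoly) ring"
  by (rule ideal_klr_ideal)

lemma cls_hom: "cls \<in> ring_hom (free_alg (gens \<nu>)) H"
  unfolding klr_def klr_class_def using klr_ideal.rcos_ring_hom .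

lemma ring_H: "ring H"
  unfolding klr_def by (rule klr_ideal.quotient_is_ring)

lemma cls_closed: "x \<in> words \<Longrightarrow> cls x \<in> carrier H"
  by (rule ring_hom_closed[OF cls_hom])

lemma cls_mult: "x \<in> words \<Longrightarrow> y \<in> words \<Longrightarrow> cls x \<otimes>\<^bsub>H\<^esub> cls y = cls (x * y)"
  using ring_hom_mult[OF cls_hom] by simp

lemma cls_add: "x \<in> words \<Longrightarrow> y \<in> words \<Longrightarrow> cls x \<oplus>\<^bsub>H\<^esub> cls y = cls (x + y)"
  using ring_hom_add[OF cls_hom] by simp

lemma cls_0: "cls 0 = \<zero>\<^bsub>H\<^esub>"
  using ring_hom_zero[OF cls_hom ring_free_alg ring_H] by simp

lemma cls_eqI: "x \<in> words \<Longrightarrow> y \<in> words \<Longrightarrow> img x = img y \<Longrightarrow> cls x = cls y"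
  using coset_eq_iff[OF ideal_klr_ideal] unfolding klr_class_def img_def unit_def by blast

lemma letters_closed [simp]:
  "r < N \<Longrightarrow> tt r \<in> words" "r \<le> N \<Longrightarrow> yy r \<in> words" "p \<le> N \<Longrightarrow> ee (sq p) \<in> words"
  by (auto simp: gens_def sq_seqs)

definition homog :: "int \<Rightarrow> bit \<Rightarrow> ('v gen, 'k) ncpoly \<Rightarrow> bool" where
  "homog d \<epsilon> w \<longleftrightarrow> w \<in> words \<and> klr_homog D \<nu> d \<epsilon> (cls w)"

lemma homog_words: "homog d \<epsilon> w \<Longrightarrow> w \<in> words"
  by (simp add: homog_def)

lemma homog_mult: "homog d \<epsilon> w \<Longrightarrow> homog d' \<epsilon>' w' \<Longrightarrow> homog (d + d') (\<epsilon> + \<epsilon>') (w * w')"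
  unfolding homog_def using klr_homog.mult[of D \<nu> d \<epsilon> "cls w" d' \<epsilon>' "cls w'"]
  by (simp only: cls_mult free_alg_closed simp_thms)

lemma homog_sign:
  assumes "homog d \<epsilon> w"
  shows "homog d \<epsilon> ((- 1) ^ n * w)"
proof -
  have "(Poly_Mapping.single [] 1 :: ('v gen, 'k) ncpoly) = 1"
    by (metis single_one zero_list_def)
  then have "scalar ((- 1) ^ n) = ((- 1) ^ n :: ('v gen, 'k) ncpoly)"
    by (cases "even n") (simp_all add: scalar_def single_uminus)
  then show ?thesis
    using assms klr_homog.scale[of D \<nu> d \<epsilon> "cls w" "(- 1) ^ n"]
    by (auto simp: homog_def cls_mult)
qed

lemma homog_uminus: "homog d \<epsilon> w \<Longrightarrow> homog d \<epsilon> (- w)"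
  using homog_sign[of d \<epsilon> w 1] by simp

definition located :: "nat \<Rightarrow> ('v gen, 'k) ncpoly \<Rightarrow> bool" where
  "located p w \<longleftrightarrow> E p * img w = img w"

lemma located_incl_ee:
  assumes "located p w"
  shows "incl (ee (sq p)) * img w = img w"
proof -
  have "incl (ee (sq p)) * (unit * img w) = E p * img w"
    by (simp only: E_def img_def mult.assoc[symmetric] unit_commute[of "incl (ee (sq p))"])
  moreover have "unit * img w = img w"
    by (simp only: img_def mult.assoc[symmetric] unit_idem)
  ultimately show ?thesis using assms by (simp add: located_def)
qed

text \<open>Only a letter times an idempotent is declared homogeneous, with a degree that depends on
  the colours. So the colour sequence at the left end of \<open>w\<close> has to be known, and
  \<open>located\<close> records it.\<close>

lemma homog_letter:
  assumes p: "p \<le> N" and g: "g \<in> words" "homog d \<epsilon> (g * ee (sq p))"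
    and w: "located p w" "homog d' \<epsilon>' w"
  shows "homog (d + d') (\<epsilon> + \<epsilon>') (g * w)"
proof -
  have "homog (d + d') (\<epsilon> + \<epsilon>') (g * ee (sq p) * w)" by (rule homog_mult[OF g(2) w(2)])
  moreover have "cls (g * ee (sq p) * w) = cls (g * w)"
    using p g(1) homog_words[OF w(2)] located_incl_ee[OF w(1)]
    by (intro cls_eqI) (simp_all add: img_mult mult.assoc)
  ultimately show ?thesis using g(1) homog_words[OF w(2)] by (simp add: homog_def)
qed

lemma homog_tt:
  assumes "p \<le> N" "r < N" "located p w" "homog d \<epsilon> w"
  shows "homog (- form D (sq p ! r) (sq p ! Suc r) + d)
    (of_nat (par D (sq p ! r) * par D (sq p ! Suc r)) + \<epsilon>) (tt r * w)"
  using assms klr_homog.cross[of "sq p" \<nu> r D]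
  by (intro homog_letter) (simp_all add: homog_def sq_seqs)

lemma homog_yy:
  assumes "p \<le> N" "r \<le> N" "located p w" "homog d \<epsilon> w"
  shows "homog (form D (sq p ! r) (sq p ! r) + d) (of_nat (par D (sq p ! r)) + \<epsilon>) (yy r * w)"
  using assms klr_homog.dot[of "sq p" \<nu> r D]
  by (intro homog_letter) (simp_all add: homog_def sq_seqs)

lemma located_tt: "p \<le> N \<Longrightarrow> r < N \<Longrightarrow> located p w \<Longrightarrow> located (swp r p) (tt r * w)"
  unfolding located_def img_mult by (rule t_E)

lemma located_yy: "p \<le> N \<Longrightarrow> r \<le> N \<Longrightarrow> located p w \<Longrightarrow> located p (yy r * w)"
  unfolding located_def img_mult by (rule y_E)

lemma of_nat_bit: "(of_nat n :: bit) = (if even n then 0 else 1)"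
  by (induction n) auto

lemma of_nat_bit_eq: "even (m + n) \<Longrightarrow> (of_nat m :: bit) = of_nat n"
  by (auto simp: of_nat_bit)

text \<open>A crossing of two strands of colour i has the opposite degree and the same parity as a
  dot on one of them.\<close>

lemma homog_dbar:
  assumes p: "p \<le> N" "r < N" "p \<noteq> r" "p \<noteq> Suc r" and w: "located p w" "homog d \<epsilon> w"
  shows "homog d \<epsilon> (dbar D i r * w)" "located p (dbar D i r * w)"
proof -
  have "homog (- form D (sq p ! r) (sq p ! Suc r) + (form D (sq p ! r) (sq p ! r) + d))
      (of_nat (par D (sq p ! r) * par D (sq p ! Suc r)) + (of_nat (par D (sq p ! r)) + \<epsilon>)) (tt r * (yy r * w))"
    using p w by (intro homog_tt homog_yy located_yy) auto
  moreover have "of_nat (par D i * par D i) + (of_nat (par D i) + \<epsilon>) = \<epsilon>"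
    using par_cases[of i] by (cases \<epsilon>) auto
  ultimately have *: "homog d \<epsilon> (tt r * (yy r * w))" using p by (simp add: sq_nth)
  show "homog d \<epsilon> (dbar D i r * w)"
    using * homog_uminus[OF *] by (simp add: dbar_def mult.assoc)
  show "located p (dbar D i r * w)"
    using p w by (simp add: located_def img_mult incl_dbar db_E)
qed

lemma homog_dbars:
  "p \<le> N \<Longrightarrow> l + n \<le> N \<Longrightarrow> p < l \<or> l + n < p \<or> n = 0 \<Longrightarrow> located p w \<Longrightarrow> homog d \<epsilon> w \<Longrightarrow>
    homog d \<epsilon> (prod_list (map (\<lambda>r. dbar D i (l + r)) [0..<n]) * w)"
proof (induction n arbitrary: w)
  case (Suc n)
  have "homog d \<epsilon> (prod_list (map (\<lambda>r. dbar D i (l + r)) [0..<n]) * (dbar D i (l + n) * w))"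
    using Suc.prems by (intro Suc.IH homog_dbar[of p]) auto
  then show ?case by (simp add: mult.assoc)
qed simp

lemma homog_divpow:
  "p \<le> N \<Longrightarrow> l + n \<le> Suc N \<Longrightarrow> p < l \<or> l + n \<le> p \<Longrightarrow> located p w \<Longrightarrow> homog d \<epsilon> w \<Longrightarrow>
    homog d \<epsilon> (divpow D i l n * w) \<and> located p (divpow D i l n * w)"
proof (induction n)
  case 0
  then show ?case by (simp add: divpow_def)
next
  case (Suc n)
  then have IH: "homog d \<epsilon> (divpow D i l n * w)" "located p (divpow D i l n * w)" by auto
  have "homog d \<epsilon> (divpow D i l (Suc n) * w)"
    unfolding divpow_Suc mult.assoc using Suc.prems IH by (intro homog_dbars[of p]) auto
  moreover have "located p (divpow D i l (Suc n) * w)"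
    using Suc.prems unfolding located_def img_mult incl_divpow by (intro Dv_E) auto
  ultimately show ?case by simp
qed

lemma homog_idem_word:
  assumes "k \<le> N"
  shows "homog 0 0 (idem_word k)" "located (N - k) (idem_word k)"
proof -
  let ?p = "N - k" and ?e = "ee (sq (N - k)) :: ('v gen, 'k) ncpoly"
  have e: "homog 0 0 ?e" "located ?p ?e"
    using klr_homog.idem[of "sq ?p" \<nu> D] E_idem[of ?p]
    by (simp_all add: homog_def located_def sq_seqs flip: E_def)
  have w: "idem_word k = divpow D i 0 ?p * (divpow D i (Suc ?p) k * ?e)"
    using assms by (simp add: serre_idem_def sq_def mult.assoc)
  have "homog 0 0 (divpow D i (Suc ?p) k * ?e) \<and> located ?p (divpow D i (Suc ?p) k * ?e)"
    using assms e by (intro homog_divpow) auto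
  then show "homog 0 0 (idem_word k)" "located (N - k) (idem_word k)"
    unfolding w using homog_divpow[of ?p 0 ?p] by auto
qed

lemma homog_asc:
  assumes p: "p \<le> N" and w: "located p w" "homog d \<epsilon> w"
  shows "(\<And>r. r < n \<Longrightarrow> f r < N \<and> p \<noteq> f r \<and> p \<noteq> Suc (f r)) \<Longrightarrow>
    homog (d - int n * form D i i) (\<epsilon> + of_nat (n * par D i)) (asc (\<lambda>r. tt (f r)) n * w)"
  using w
proof (induction n arbitrary: w d \<epsilon>)
  case (Suc n)
  have f: "f n < N" "p \<noteq> f n" "p \<noteq> Suc (f n)" using Suc.prems(1) by auto
  have "homog (- form D i i + d) (of_nat (par D i * par D i) + \<epsilon>) (tt (f n) * w)"
    using homog_tt[OF p f(1) Suc.prems(2,3)] p f by (simp add: sq_nth)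
  moreover have "located p (tt (f n) * w)"
    using located_tt[OF p f(1) Suc.prems(2)] f by (simp add: swp_def)
  ultimately have "homog ((- form D i i + d) - int n * form D i i)
      ((of_nat (par D i * par D i) + \<epsilon>) + of_nat (n * par D i)) (asc (\<lambda>r. tt (f r)) n * (tt (f n) * w))"
    using Suc.prems(1) by (intro Suc.IH) auto
  moreover have "(of_nat (par D i * par D i) + \<epsilon>) + of_nat (n * par D i) = \<epsilon> + of_nat (Suc n * par D i)"
    using par_cases[of i] by (auto simp: algebra_simps)
  ultimately show ?case by (simp add: algebra_simps)
next
  case 0
  then show ?case by (cases \<epsilon>) simp_all
qed

text \<open>The crossing that acts first involves the strand j, the other \<open>N - Suc k\<close>
  join strands of colour i.\<close>

lemma homog_diff_word:
  assumes k: "k < N"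
  shows "homog (- form D i j - int (N - Suc k) * form D i i)
    (of_nat (par D i * par D j) + of_nat ((N - Suc k) * par D i)) (diff_word k)"
proof -
  let ?q = "N - Suc k" and ?w = "idem_word (Suc k)"
  have w: "homog 0 0 ?w" "located ?q ?w" using homog_idem_word[of "Suc k"] k by auto
  have "homog (- form D (sq ?q ! ?q) (sq ?q ! Suc ?q) + 0)
      (of_nat (par D (sq ?q ! ?q) * par D (sq ?q ! Suc ?q)) + 0) (tt ?q * ?w)"
    using k w by (intro homog_tt) auto
  then have 1: "homog (- form D i j) (of_nat (par D i * par D j)) (tt ?q * ?w)"
    using k form_commute[of i j] by (simp add: sq_nth mult.commute)
  have 2: "located (Suc ?q) (tt ?q * ?w)" using located_tt[of ?q ?q ?w] k w by (simp add: swp_def)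
  have "homog (- form D i j - int ?q * form D i i) (of_nat (par D i * par D j) + of_nat (?q * par D i))
      (asc (\<lambda>r. tt r) ?q * (tt ?q * ?w))"
    using k by (intro homog_asc[of "Suc ?q"] 1 2) auto
  moreover have "N - k = Suc ?q" using k by simp
  ultimately show ?thesis by (simp only: diff_word_def asc.simps mult.assoc)
qed

lemma homog_back_word:
  assumes k: "k < N"
  shows "homog (- form D i j - int k * form D i i)
    (of_nat (par D i * par D j) + of_nat (k * par D i)) (back_word k)"
proof -
  let ?q = "N - Suc k" and ?p = "N - k" and ?w = "idem_word k"
  have p: "?p = Suc ?q" using k by simp
  have w: "homog 0 0 ?w" "located ?p ?w" using homog_idem_word[of k] k by auto
  have "homog (- form D (sq ?p ! ?q) (sq ?p ! Suc ?q) + 0)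
      (of_nat (par D (sq ?p ! ?q) * par D (sq ?p ! Suc ?q)) + 0) (tt ?q * ?w)"
    using k w by (intro homog_tt) auto
  then have 1: "homog (- form D i j) (of_nat (par D i * par D j)) (tt ?q * ?w)"
    using k p by (simp add: sq_nth)
  have 2: "located ?q (tt ?q * ?w)" using located_tt[of ?p ?q ?w] k w p by (simp add: swp_def)
  have "homog (- form D i j - int k * form D i i) (of_nat (par D i * par D j) + of_nat (k * par D i))
      (desc N tt k * (tt ?q * ?w))"
    using k by (intro homog_asc[of ?q] 1 2) auto
  then show ?thesis by (simp only: back_word_def asc.simps mult.assoc)
qed

section \<open>Shifts of degree and parity along the complex\<close>

definition degree_at :: "nat \<Rightarrow> nat" where
  "degree_at k = (N - k choose 2) + (k choose 2)"

text \<open>The explicit parity shift of the k-th term together with the one contained in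
  \<open>PP\<close>.\<close>

definition parity_at :: "nat \<Rightarrow> nat" where
  "parity_at k = pshift D k i j + par D i * degree_at k"

lemma form_ij: "- form D i j = int (orbsize D i) * (int N - 1)"
proof -
  have "orbsize D i * (N - 1) = card (joining i j)"
    using orbsize_qexp_mexp[OF reps_ij] exponents by simp
  then have "int (card (joining i j)) = int (orbsize D i * (N - 1))" by simp
  then show ?thesis using N_pos by (simp add: form_joining[OF ij] of_nat_diff)
qed

lemma choose_2_Suc: "Suc n choose 2 = n + (n choose 2)"
  by (simp add: numeral_2_eq_2)

lemma degree_at_Suc:
  assumes "k < N"
  shows "int (orbsize D i * degree_at (Suc k))
    = int (orbsize D i * degree_at k) + int (orbsize D i) * (int k - int (N - Suc k))"
proof -
  have "N - k = Suc (N - Suc k)" using assms by simp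
  then have "int (degree_at (Suc k)) = int (degree_at k) + (int k - int (N - Suc k))"
    unfolding degree_at_def by (simp only: choose_2_Suc)
  then show ?thesis by (simp add: distrib_left)
qed

lemma diff_word_degree:
  "k < N \<Longrightarrow> - form D i j - int (N - Suc k) * form D i i
    = int (orbsize D i * degree_at (Suc k)) - int (orbsize D i * degree_at k)"
  unfolding degree_at_Suc form_ij form_self by (simp add: algebra_simps of_nat_diff)

lemma back_word_degree:
  "k < N \<Longrightarrow> - form D i j - int k * form D i i
    = int (orbsize D i * degree_at k) - int (orbsize D i * degree_at (Suc k))"
  unfolding degree_at_Suc form_ij form_self by (simp add: algebra_simps of_nat_diff)

lemma parity_at_eq:
  "parity_at k = par D i * (k * par D j + (k choose 2) + ((N - k choose 2) + (k choose 2)))"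
  by (simp add: parity_at_def pshift_def degree_at_def choose_two algebra_simps)

text \<open>For odd i the quadratic part of \<open>pshift\<close> grows by \<open>k\<close>. Modulo
  two this cancels the \<open>k\<close> in the growth of \<open>degree_at\<close> and leaves
  \<open>N - Suc k\<close>, the number of crossings of equal strands.\<close>

lemma diff_word_parity:
  assumes "k < N"
  shows "(of_nat (par D i * par D j) + of_nat ((N - Suc k) * par D i) :: bit)
    = of_nat (parity_at (Suc k)) + of_nat (parity_at k)"
proof -
  define m where "m = N - Suc k"
  have m: "N - Suc k = m" "N - k = Suc m" using assms by (simp_all add: m_def)
  have "even (parity_at (Suc k) + parity_at k + (par D i * par D j + (N - Suc k) * par D i))"
  proof (cases "par D i = 0")
    case False
    then have 1: "par D i = 1" using par_cases[of i] by auto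
    define a c c' where "a = k * par D j" and "c = (k choose 2)" and "c' = (m choose 2)"
    have "parity_at (Suc k) = a + par D j + (k + c) + (c' + (k + c))"
      unfolding parity_at_eq m 1 a_def c_def c'_def choose_2_Suc by simp
    moreover have "parity_at k = a + c + ((m + c') + c)"
      unfolding parity_at_eq m 1 a_def c_def c'_def choose_2_Suc by simp
    ultimately show ?thesis unfolding m 1 by presburger
  qed (simp add: parity_at_eq)
  then show ?thesis
    unfolding of_nat_add[symmetric] by (intro of_nat_bit_eq) (simp add: add.commute)
qed

text \<open>For odd i the sum of \<open>k\<close> and \<open>N - Suc k\<close> is
  \<open>N - 1\<close>, which is even because the Cartan integer is; so both words have the same
  parity.\<close>

lemma back_word_parity:
  assumes "k < N"
  shows "(of_nat (par D i * par D j) + of_nat (k * par D i) :: bit)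
    = of_nat (parity_at (Suc k)) + of_nat (parity_at k)"
proof -
  have "even (k * par D i + (N - Suc k) * par D i)"
  proof (cases "par D i = 0")
    case False
    then have "odd (orbsize D i)" using par_cases[of i] by auto
    then have "even (N - 1)" using odd_orbsize(1)[OF reps_ij] exponents by simp
    moreover have "k + (N - Suc k) = N - 1" using assms by simp
    ultimately show ?thesis by (simp flip: distrib_right)
  qed simp
  then show ?thesis
    unfolding diff_word_parity[OF assms, symmetric] by (simp only: of_nat_bit_eq)
qed

end


section \<open>The Serre complex\<close>

declare add_bit_eq_xor [simp del]

lemma funpow_parity_shift:
  "(parity_shift ^^ n) M = M\<lparr>component := \<lambda>d \<epsilon>. component M d (\<epsilon> + of_nat n)\<rparr>"
proof (induction n)
  case 0
  then show ?case by (cases M) simp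
next
  case (Suc n)
  then show ?case by (simp add: parity_shift_def add.assoc)
qed

context serre_setting
begin

abbreviation dgs :: "nat \<Rightarrow> int" where
  "dgs k \<equiv> int (orbsize D i * degree_at k)"

abbreviation prs :: "nat \<Rightarrow> bit" where
  "prs k \<equiv> of_nat (parity_at k)"

lemma words_closed:
  "k \<le> N \<Longrightarrow> idem_word k \<in> words" "k < N \<Longrightarrow> diff_word k \<in> words" "k < N \<Longrightarrow> back_word k \<in> words"
  using homog_words homog_idem_word(1) homog_diff_word homog_back_word by blast+

text \<open>Beyond \<open>N\<close> the exponent is negative and the module is zero, the left ideal
  generated by \<open>e k = \<zero>\<close>. This lets the direct sums run past the end of the
  complex.\<close>

lemma represents_PP:
  assumes c: "contractible H (klr_homog D \<nu>) e X S dgs prs"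
    and e: "\<And>k. k \<le> N \<Longrightarrow> e k = cls (idem_word k)" "\<And>k. N < k \<Longrightarrow> e k = \<zero>\<^bsub>H\<^esub>"
  shows "contractible.represents H (klr_homog D \<nu>) e dgs prs
    ((parity_shift ^^ pshift D k i j) (PP D i j (int N - int k) (int k))) k"
proof -
  interpret contractible H "klr_homog D \<nu>" e X S dgs prs
    by (rule c)
  show ?thesis
  proof (cases "k \<le> N")
    case True
    then have n: "nat (int N - int k) = N - k" "\<not> int N - int k < 0" "\<not> int k < 0" "nat (int N - int k + int k) = N"
      by auto
    have p: "\<epsilon> + of_nat (pshift D k i j) + of_nat (par D i * degree_at k) = \<epsilon> + of_nat (parity_at k)" for \<epsilon> :: bit
      by (simp only: parity_at_def of_nat_add add.assoc)
    have PP: "PP D i j (int N - int k) (int k) = (parity_shift ^^ (par D i * degree_at k))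
      (degree_shift (- int (orbsize D i * degree_at k)) (klr_left_ideal D \<nu> (cls (idem_word k))))"
      unfolding PP_def Let_def by (simp only: n if_False simp_thms nat_int degree_at_def)
    show ?thesis
      unfolding represents_def PP
      by (simp add: funpow_parity_shift degree_shift_def klr_left_ideal_def Let_def e(1)[OF True] p
          del: of_nat_mult of_nat_add)
  next
    case False
    then have n: "int N - int k < 0" "nat (int N - int k + int k) = N" by auto
    have e0: "e k = \<zero>\<^bsub>H\<^esub>" using e(2) False by simp
    have "h \<otimes>\<^bsub>H\<^esub> e k = \<zero>\<^bsub>H\<^esub>" if "h \<in> carrier H" for h
      unfolding e0 using that by (rule r_null)
    then have z: "{h \<otimes>\<^bsub>H\<^esub> e k |h. h \<in> carrier H} = {\<zero>\<^bsub>H\<^esub>}"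
      using zero_closed by force
    have PP: "PP D i j (int N - int k) (int k) = zero_gmodule \<zero>\<^bsub>H\<^esub>"
      unfolding PP_def Let_def by (simp only: n if_True simp_thms)
    have "{\<zero>\<^bsub>H\<^esub>} = {x. x = \<zero>\<^bsub>H\<^esub> \<and> klr_homog D \<nu> d \<epsilon> x}" for d \<epsilon>
      using hg_zero by blast
    then show ?thesis
      unfolding represents_def PP z
      by (simp add: zero_gmodule_def funpow_parity_shift r_null del: of_nat_mult of_nat_add)
  qed
qed

lemma exists_contractible:
  obtains e X S where
    "contractible H (klr_homog D \<nu>) e X S dgs prs"
    "\<And>k. k \<le> N \<Longrightarrow> e k = cls (idem_word k)" "\<And>k. N < k \<Longrightarrow> e k = \<zero>\<^bsub>H\<^esub>"
    "\<And>k. N \<le> k \<Longrightarrow> X k = \<zero>\<^bsub>H\<^esub>" "\<And>k. N \<le> k \<Longrightarrow> S k = \<zero>\<^bsub>H\<^esub>"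
proof -
  have "\<exists>(a :: nat \<Rightarrow> nat) S.
    (\<forall>k. S k = (- 1) ^ a k * img (back_word k) * (img (diff_word k) * ((- 1) ^ a k * img (back_word k)))) \<and>
    (\<forall>k\<le>N. img (idem_word k) = (if k < N then img (diff_word k) * S k else 0)
      + (if 0 < k then S (k - 1) * img (diff_word (k - 1)) else 0)) \<and>
    (\<forall>k. Suc k < N \<longrightarrow> S (Suc k) * S k = 0)"
    by (rule normalised_homotopy[OF idem_diff diff_idem idem_back back_idem diff_diff homotopy_words])
  then obtain a :: "nat \<Rightarrow> nat" and S' where
    S': "\<And>k. S' k = (- 1) ^ a k * img (back_word k) * (img (diff_word k) * ((- 1) ^ a k * img (back_word k)))"
    and hom: "\<And>k. k \<le> N \<Longrightarrow> img (idem_word k) = (if k < N then img (diff_word k) * S' k else 0)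
      + (if 0 < k then S' (k - 1) * img (diff_word (k - 1)) else 0)"
    and SS: "\<And>k. Suc k < N \<Longrightarrow> S' (Suc k) * S' k = 0"
    by blast
  \<comment> \<open>The lift of \<open>S'\<close> to the free algebra, where its degree and parity
    can be computed.\<close>
  define s where "s k = (- 1) ^ a k * back_word k * (diff_word k * ((- 1) ^ a k * back_word k))" for k
  have sc: "x * ((- 1) ^ l * z) = (- 1) ^ l * (x * z)" for x z :: "('v gen, 'k) ncpoly allquot" and l
    by (cases "even l") auto
  have img_sign: "img ((- 1) ^ l * w) = (- 1) ^ l * img w" for l w
    by (simp add: img_mult)
  have img_s: "img (s k) = S' k" for k
    unfolding s_def S'[of k]
    by (simp only: img_mult_img[symmetric, of "(- 1) ^ a k * back_word k"]
        img_mult_img[symmetric, of "diff_word k"] img_sign)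
  have sw: "s k \<in> words" if "k < N" for k
    using words_closed(2,3)[OF that] by (auto simp: s_def)
  have se: "img (s k * idem_word k) = img (s k)" if "k < N" for k
    unfolding img_mult_img[symmetric] img_s S'[of k] by (simp only: mult.assoc back_idem[OF that])
  have es: "img (idem_word (Suc k) * s k) = img (s k)" if "k < N" for k
  proof -
    have "img (idem_word (Suc k)) * (img (back_word k) * w) = img (back_word k) * w" for w
      by (simp only: mult.assoc[symmetric] idem_back[OF that])
    then show ?thesis
      unfolding img_mult_img[symmetric] img_s S'[of k]
      by (simp only: mult.assoc sc[of "img (idem_word (Suc k))"])
  qed
  define e where "e k = (if k \<le> N then cls (idem_word k) else \<zero>\<^bsub>H\<^esub>)" for k
  define X where "X k = (if k < N then cls (diff_word k) else \<zero>\<^bsub>H\<^esub>)" for k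
  define S where "S k = (if k < N then cls (s k) else \<zero>\<^bsub>H\<^esub>)" for k
  interpret H: ring H by (rule ring_H)
  note closed = words_closed sw
  have eqI: "cls x \<otimes>\<^bsub>H\<^esub> cls y = cls z" if "x \<in> words" "y \<in> words" "z \<in> words" "img (x * y) = img z" for x y z
    unfolding cls_mult[OF that(1,2)] using that by (intro cls_eqI free_alg_closed)
  have img0: "img 0 = 0" by (simp add: img_def)
  have "contractible H (klr_homog D \<nu>) e X S dgs prs"
  proof
    show "klr_homog D \<nu> d \<epsilon> \<zero>\<^bsub>H\<^esub>" for d \<epsilon> by (rule klr_homog.zero)
    show "klr_homog D \<nu> d \<epsilon> (x \<oplus>\<^bsub>H\<^esub> y)" if "klr_homog D \<nu> d \<epsilon> x" "klr_homog D \<nu> d \<epsilon> y" for d \<epsilon> x y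
      using that by (rule klr_homog.add)
    show "klr_homog D \<nu> (d + d') (\<epsilon> + \<epsilon>') (x \<otimes>\<^bsub>H\<^esub> y)"
      if "klr_homog D \<nu> d \<epsilon> x" "klr_homog D \<nu> d' \<epsilon>' y" for d \<epsilon> x d' \<epsilon>' y
      using that by (rule klr_homog.mult)
    fix k
    show ec: "e k \<in> carrier H" for k using closed by (simp add: e_def cls_closed)
    show Xc: "X k \<in> carrier H" for k using closed by (simp add: X_def cls_closed)
    show Sc: "S k \<in> carrier H" for k using closed by (simp add: S_def cls_closed)
    show "X k \<otimes>\<^bsub>H\<^esub> e (Suc k) = X k"
    proof (cases "k < N")
      case True
      then have "cls (diff_word k) \<otimes>\<^bsub>H\<^esub> cls (idem_word (Suc k)) = cls (diff_word k)"
        using closed diff_idem[of k, unfolded img_mult_img] by (intro eqI) simp_all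
      then show ?thesis using True by (simp add: X_def e_def)
    next
      case False
      then show ?thesis using ec by (simp add: X_def)
    qed
    show "S k \<otimes>\<^bsub>H\<^esub> e k = S k"
    proof (cases "k < N")
      case True
      then have "cls (s k) \<otimes>\<^bsub>H\<^esub> cls (idem_word k) = cls (s k)"
        using closed se[of k] by (intro eqI) simp_all
      then show ?thesis using True by (simp add: S_def e_def)
    next
      case False
      then show ?thesis using ec by (simp add: S_def)
    qed
    show "e k \<otimes>\<^bsub>H\<^esub> X k = X k"
    proof (cases "k < N")
      case True
      then have "cls (idem_word k) \<otimes>\<^bsub>H\<^esub> cls (diff_word k) = cls (diff_word k)"
        using closed idem_diff[of k, unfolded img_mult_img] by (intro eqI) simp_all
      then show ?thesis using True by (simp add: X_def e_def)
    next
      case False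
      then show ?thesis using ec by (simp add: X_def)
    qed
    show "e (Suc k) \<otimes>\<^bsub>H\<^esub> S k = S k"
    proof (cases "k < N")
      case True
      then have "cls (idem_word (Suc k)) \<otimes>\<^bsub>H\<^esub> cls (s k) = cls (s k)"
        using closed es[of k] by (intro eqI) simp_all
      then show ?thesis using True by (simp add: S_def e_def)
    next
      case False
      then show ?thesis using ec by (simp add: S_def)
    qed
    show "X k \<otimes>\<^bsub>H\<^esub> X (Suc k) = \<zero>\<^bsub>H\<^esub>"
    proof (cases "Suc k < N")
      case True
      then have "cls (diff_word k) \<otimes>\<^bsub>H\<^esub> cls (diff_word (Suc k)) = cls 0"
        using closed diff_diff[of k] by (intro eqI) (auto simp: img_mult_img[symmetric] img0)
      then show ?thesis using True by (simp add: X_def cls_0)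
    qed (use Xc[of k] in \<open>simp add: X_def\<close>)
    show "S (Suc k) \<otimes>\<^bsub>H\<^esub> S k = \<zero>\<^bsub>H\<^esub>"
    proof (cases "Suc k < N")
      case True
      then have "cls (s (Suc k)) \<otimes>\<^bsub>H\<^esub> cls (s k) = cls 0"
        using closed SS[of k] by (intro eqI) (auto simp: img_mult_img[symmetric] img_s img0)
      then show ?thesis using True by (simp add: S_def cls_0)
    qed (use Sc[of k] in \<open>simp add: S_def\<close>)
    show "X 0 \<otimes>\<^bsub>H\<^esub> S 0 = e 0"
    proof -
      have "cls (diff_word 0) \<otimes>\<^bsub>H\<^esub> cls (s 0) = cls (idem_word 0)"
        using closed[of 0] hom[of 0] N_pos by (intro eqI) (simp_all add: img_mult_img[symmetric] img_s)
      then show ?thesis using N_pos by (simp add: X_def S_def e_def)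
    qed
    show "X (Suc k) \<otimes>\<^bsub>H\<^esub> S (Suc k) \<oplus>\<^bsub>H\<^esub> S k \<otimes>\<^bsub>H\<^esub> X k = e (Suc k)"
    proof -
      consider "Suc k < N" | "Suc k = N" | "N < Suc k" by linarith
      then show ?thesis
      proof cases
        case 1
        have "cls (diff_word (Suc k) * s (Suc k) + s k * diff_word k) = cls (idem_word (Suc k))"
        proof (rule cls_eqI)
          show "diff_word (Suc k) * s (Suc k) + s k * diff_word k \<in> words" "idem_word (Suc k) \<in> words"
            using 1 closed by auto
          have "img (x + y) = img x + img y" for x y by (simp add: img_def distrib_left)
          then show "img (diff_word (Suc k) * s (Suc k) + s k * diff_word k) = img (idem_word (Suc k))"
            using 1 hom[of "Suc k"] by (simp add: img_mult_img[symmetric] img_s)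
        qed
        then show ?thesis
          using 1 closed by (simp add: X_def S_def e_def cls_mult cls_add)
      next
        case 2
        then have k: "k < N" "Suc k \<le> N" "\<not> Suc k < N" by auto
        have "cls (s k) \<otimes>\<^bsub>H\<^esub> cls (diff_word k) = cls (idem_word (Suc k))"
          using k(1,2) closed words_closed(1)[of "Suc k"] hom[OF k(2)]
          by (intro eqI) (simp_all only: k(3) if_False zero_less_Suc if_True diff_Suc_1 add_0
              img_mult_img[symmetric] img_s)
        then show ?thesis
          using k words_closed(1)[of "Suc k"] by (simp add: X_def S_def e_def cls_closed)
      next
        case 3
        then show ?thesis by (simp add: X_def S_def e_def)
      qed
    qed
    show "klr_homog D \<nu> (dgs (Suc k) - dgs k) (prs (Suc k) + prs k) (X k)"
    proof (cases "k < N")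
      case True
      then show ?thesis
        using homog_diff_word[OF True] unfolding diff_word_degree[OF True] diff_word_parity[OF True]
        by (simp only: homog_def X_def if_True)
    qed (simp only: X_def if_False klr_homog.zero)
    show "klr_homog D \<nu> (dgs k - dgs (Suc k)) (prs (Suc k) + prs k) (S k)"
    proof (cases "k < N")
      case True
      let ?d = "dgs k" and ?d' = "dgs (Suc k)" and ?\<epsilon> = "prs (Suc k) + prs k"
      have x: "homog (?d' - ?d) ?\<epsilon> (diff_word k)"
        using homog_diff_word[OF True] unfolding diff_word_degree[OF True] diff_word_parity[OF True] .
      have z: "homog (?d - ?d') ?\<epsilon> ((- 1) ^ a k * back_word k)"
        using homog_back_word[OF True] unfolding back_word_degree[OF True] back_word_parity[OF True]
        by (rule homog_sign)
      \<comment> \<open>The middle factor \<open>diff_word k\<close> has the opposite degree and the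
        same parity as the two outer ones, so the product has the bidegree of
        \<open>back_word k\<close>.\<close>
      have "homog ((?d - ?d') + ((?d' - ?d) + (?d - ?d'))) (?\<epsilon> + (?\<epsilon> + ?\<epsilon>)) (s k)"
        unfolding s_def by (intro homog_mult x z)
      moreover have "(?d - ?d') + ((?d' - ?d) + (?d - ?d')) = ?d - ?d'" by simp
      moreover have "b + (b + b) = b" for b :: bit by (cases b) simp_all
      ultimately have "homog (?d - ?d') ?\<epsilon> (s k)" by (simp only:)
      then show ?thesis using True by (simp only: homog_def S_def if_True)
    qed (simp only: S_def if_False klr_homog.zero)
  qed
  then show thesis by (rule that) (simp_all add: e_def X_def S_def)
qed

end

theorem theorem5p9:
  fixes D :: "('v, 'e) quiver_datum" and i j :: 'v and N :: nat
    and H :: "(('v gen, 'k::field) ncpoly set) ring"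
    and P :: "int \<Rightarrow> int \<Rightarrow>
      (('v gen, 'k) ncpoly set, ('v gen, 'k) ncpoly set) graded_module"
  assumes "CHAR('k) \<noteq> 2"
    and "spin_datum D"
    and "i \<in> reps D" and "j \<in> reps D" and "i \<noteq> j"
    and "int N = 1 - cartan D i j"
    and "H = klr D (serre_weight i j N)"
    and "P = PP D i j"
  shows "(\<exists>d. split_exact_seq H N
            (\<lambda>k. (parity_shift ^^ pshift D k i j) (P (int N - int k) (int k))) d)
       \<and> graded_iso H
           (gdirect_sum {0..(N + 1) div 2}
             (\<lambda>k. (parity_shift ^^ pshift D (2 * k) i j)
                    (P (int N - 2 * int k) (2 * int k))))
           (gdirect_sum {0..N div 2}
             (\<lambda>k. (parity_shift ^^ pshift D (2 * k + 1) i j)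
                    (P (int N - 2 * int k - 1) (2 * int k + 1))))"
proof -
  interpret s: serre_setting D i j N "TYPE('k)"
    using assms by (intro serre_setting.intro serre_setting_axioms.intro)
  obtain e X S where c: "contractible s.H (klr_homog D s.\<nu>) e X S s.dgs s.prs"
    and e: "\<And>k. k \<le> N \<Longrightarrow> e k = s.cls (s.idem_word k)" "\<And>k. N < k \<Longrightarrow> e k = \<zero>\<^bsub>s.H\<^esub>"
    and X: "\<And>k. N \<le> k \<Longrightarrow> X k = \<zero>\<^bsub>s.H\<^esub>" and S: "\<And>k. N \<le> k \<Longrightarrow> S k = \<zero>\<^bsub>s.H\<^esub>"
    by (rule s.exists_contractible) blast
  interpret c: contractible s.H "klr_homog D s.\<nu>" e X S s.dgs s.prs by (rule c)
  let ?M = "\<lambda>k. (parity_shift ^^ pshift D k i j) (PP D i j (int N - int k) (int k))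
    :: (('v gen, 'k) ncpoly set, ('v gen, 'k) ncpoly set) graded_module"
  \<comment> \<open>No bound on \<open>k\<close> is imposed: the direct sums use the index
    \<open>N + 1\<close> as well.\<close>
  have M: "c.represents (?M k) k" for k
    by (rule s.represents_PP[OF c e])
  have "split_exact_seq s.H N ?M (\<lambda>k x. x \<otimes>\<^bsub>s.H\<^esub> X k)"
    using M X by (intro c.split_exact) auto
  moreover have "graded_iso s.H (gdirect_sum {0..(N + 1) div 2} (\<lambda>k. ?M (2 * k)))
      (gdirect_sum {0..N div 2} (\<lambda>k. ?M (2 * k + 1)))"
    by (rule c.even_odd_iso, rule M, rule M, erule X, erule S)
  moreover have "?M (2 * k) = (parity_shift ^^ pshift D (2 * k) i j) (PP D i j (int N - 2 * int k) (2 * int k))"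
    and "?M (2 * k + 1) = (parity_shift ^^ pshift D (2 * k + 1) i j)
      (PP D i j (int N - 2 * int k - 1) (2 * int k + 1))" for k
    by (simp_all add: algebra_simps)
  ultimately show ?thesis unfolding assms(7,8) by auto
qed

end
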